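(* Let $\mathsf{T}$ be a big tt-category. For every $\mathbf{p}\in\mathrm{Spc}(\mathsf{T}^c)$ there exists a big prime $\mathsf{P}$ of $\mathsf{T}$ such that $\mathsf{P}\cap\mathsf{T}^c=\mathbf{p}$.
   Context: A big tt-category is a rigidly-compactly generated tensor-triangulated category $(\mathsf{T},\otimes,\mathbf{1})$: a triangulated category with all small coproducts and a compatible closed symmetric monoidal structure, in which compact and rigid objects coincide and form an essentially small subcategory $\mathsf{T}^c$ generating $\mathsf{T}$ as a localizing subcategory. A localizing ideal is a full triangulated subcategory closed under coproducts and under tensoring with arbitrary objects of $\mathsf{T}$. It is radical if $X^{\otimes n}\in\mathsf{I}$ for some $n\geq 1$ implies $X\in\mathsf{I}$. A big prime of $\mathsf{T}$ is a proper radical localizing ideal $\mathsf{P}$ such that whenever $\mathsf{I},\mathsf{J}$ are radical localizing ideals with $\mathsf{I}\cap\mathsf{J}\subseteq\mathsf{P}$, then $\mathsf{I}\subseteq\mathsf{P}$ or $\mathsf{J}\subseteq\mathsf{P}$. $\mathrm{Spc}(\mathsf{T}^c)$ is the Balmer spectrum: the set of proper thick tensor ideals $\mathbf{p}$ of $\mathsf{T}^c$ such that $a\otimes b\in\mathbf{p}$ implies $a\in\mathbf{p}$ or $b\in\mathbf{p}$. *)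

theory Defs
  imports "HOL-Algebra.Product_Groups" "HOL-Algebra.FiniteProduct"
begin

unbundle cardinal_syntax

section \<open>Categories\<close>

record ('o, 'm) category_data =
  obj :: "'o set"
  arr :: "'m set"
  src :: "'m \<Rightarrow> 'o"
  tgt :: "'m \<Rightarrow> 'o"
  ident :: "'o \<Rightarrow> 'm"
  after :: "'m \<Rightarrow> 'm \<Rightarrow> 'm"  (infixr \<open>\<cdot>\<index>\<close> 70)

definition homset :: "('o, 'm, 'z) category_data_scheme \<Rightarrow> 'o \<Rightarrow> 'o \<Rightarrow> 'm set" where
  "homset T X Y = {f \<in> arr T. src T f = X \<and> tgt T f = Y}"

locale category =
  fixes T :: "('o, 'm, 'z) category_data_scheme" (structure)
  assumes src_obj: "f \<in> arr T \<Longrightarrow> src T f \<in> obj T"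
    and tgt_obj: "f \<in> arr T \<Longrightarrow> tgt T f \<in> obj T"
    and ident_hom: "X \<in> obj T \<Longrightarrow> ident T X \<in> homset T X X"
    and after_hom: "\<lbrakk>f \<in> homset T X Y; g \<in> homset T Y Z\<rbrakk> \<Longrightarrow> g \<cdot> f \<in> homset T X Z"
    and after_ident: "f \<in> homset T X Y \<Longrightarrow> f \<cdot> ident T X = f"
    and ident_after: "f \<in> homset T X Y \<Longrightarrow> ident T Y \<cdot> f = f"
    and after_assoc: "\<lbrakk>f \<in> homset T W X; g \<in> homset T X Y; h \<in> homset T Y Z\<rbrakk>
          \<Longrightarrow> (h \<cdot> g) \<cdot> f = h \<cdot> (g \<cdot> f)"

definition inverse_mors :: "('o, 'm, 'z) category_data_scheme \<Rightarrow> 'm \<Rightarrow> 'm \<Rightarrow> bool" where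
  "inverse_mors T f g \<longleftrightarrow> f \<in> arr T \<and> g \<in> homset T (tgt T f) (src T f) \<and>
     g \<cdot>\<^bsub>T\<^esub> f = ident T (src T f) \<and> f \<cdot>\<^bsub>T\<^esub> g = ident T (tgt T f)"

definition iso_mor :: "('o, 'm, 'z) category_data_scheme \<Rightarrow> 'm \<Rightarrow> bool" where
  "iso_mor T f \<longleftrightarrow> (\<exists>g. inverse_mors T f g)"

definition inv_mor :: "('o, 'm, 'z) category_data_scheme \<Rightarrow> 'm \<Rightarrow> 'm" where
  "inv_mor T f = (THE g. inverse_mors T f g)"

definition isos :: "('o, 'm, 'z) category_data_scheme \<Rightarrow> 'o \<Rightarrow> 'o \<Rightarrow> 'm set" where
  "isos T X Y = {f \<in> homset T X Y. iso_mor T f}"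

definition isomorphic_objs :: "('o, 'm, 'z) category_data_scheme \<Rightarrow> 'o \<Rightarrow> 'o \<Rightarrow> bool" where
  "isomorphic_objs T X Y \<longleftrightarrow> isos T X Y \<noteq> {}"

definition zero_object :: "('o, 'm, 'z) category_data_scheme \<Rightarrow> 'o \<Rightarrow> bool" where
  "zero_object T Z \<longleftrightarrow> Z \<in> obj T \<and>
     (\<forall>Y\<in>obj T. (\<exists>!f. f \<in> homset T Z Y) \<and> (\<exists>!f. f \<in> homset T Y Z))"

definition is_coproduct ::
  "('o, 'm, 'z) category_data_scheme \<Rightarrow> 'i set \<Rightarrow> ('i \<Rightarrow> 'o) \<Rightarrow> 'o \<Rightarrow> ('i \<Rightarrow> 'm) \<Rightarrow> bool" where
  "is_coproduct T I X S \<iota> \<longleftrightarrow> S \<in> obj T \<and> (\<forall>i\<in>I. \<iota> i \<in> homset T (X i) S) \<and>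
     (\<forall>Y\<in>obj T. \<forall>f. (\<forall>i\<in>I. f i \<in> homset T (X i) Y) \<longrightarrow>
        (\<exists>!g. g \<in> homset T S Y \<and> (\<forall>i\<in>I. g \<cdot>\<^bsub>T\<^esub> \<iota> i = f i)))"


section \<open>Additive categories\<close>

record ('o, 'm) additive_data = "('o, 'm) category_data" +
  plus_mor :: "'m \<Rightarrow> 'm \<Rightarrow> 'm"  (infixl \<open>\<boxplus>\<index>\<close> 65)
  zero_mor :: "'o \<Rightarrow> 'o \<Rightarrow> 'm"

text \<open>The abelian group of morphisms, written multiplicatively as in \<^theory>\<open>HOL-Algebra.Group\<close>.\<close>

definition hom_group :: "('o, 'm, 'z) additive_data_scheme \<Rightarrow> 'o \<Rightarrow> 'o \<Rightarrow> 'm monoid" where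
  "hom_group T X Y = \<lparr>carrier = homset T X Y, mult = plus_mor T, one = zero_mor T X Y\<rparr>"

definition neg_mor :: "('o, 'm, 'z) additive_data_scheme \<Rightarrow> 'm \<Rightarrow> 'm" where
  "neg_mor T f = inv\<^bsub>hom_group T (src T f) (tgt T f)\<^esub> f"

definition is_biproduct :: "('o, 'm, 'z) additive_data_scheme \<Rightarrow> 'o \<Rightarrow> 'o \<Rightarrow> 'o \<Rightarrow> bool" where
  "is_biproduct T X Y Z \<longleftrightarrow> X \<in> obj T \<and> Y \<in> obj T \<and> Z \<in> obj T \<and>
     (\<exists>i \<in> homset T X Z. \<exists>j \<in> homset T Y Z. \<exists>p \<in> homset T Z X. \<exists>q \<in> homset T Z Y.
        p \<cdot>\<^bsub>T\<^esub> i = ident T X \<and> q \<cdot>\<^bsub>T\<^esub> j = ident T Y \<and>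
        q \<cdot>\<^bsub>T\<^esub> i = zero_mor T X Y \<and> p \<cdot>\<^bsub>T\<^esub> j = zero_mor T Y X \<and>
        (i \<cdot>\<^bsub>T\<^esub> p) \<boxplus>\<^bsub>T\<^esub> (j \<cdot>\<^bsub>T\<^esub> q) = ident T Z)"

locale additive_category = category T
  for T :: "('o, 'm, 'z) additive_data_scheme" (structure) +
  assumes hom_comm_group: "\<lbrakk>X \<in> obj T; Y \<in> obj T\<rbrakk> \<Longrightarrow> comm_group (hom_group T X Y)"
    and after_plus: "\<lbrakk>f \<in> homset T X Y; f' \<in> homset T X Y; g \<in> homset T Y Z\<rbrakk>
          \<Longrightarrow> g \<cdot> (f \<boxplus> f') = (g \<cdot> f) \<boxplus> (g \<cdot> f')"
    and plus_after: "\<lbrakk>f \<in> homset T X Y; g \<in> homset T Y Z; g' \<in> homset T Y Z\<rbrakk>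
          \<Longrightarrow> (g \<boxplus> g') \<cdot> f = (g \<cdot> f) \<boxplus> (g' \<cdot> f)"
    and zero_object_exists: "\<exists>Z. zero_object T Z"
    and biproduct_exists: "\<lbrakk>X \<in> obj T; Y \<in> obj T\<rbrakk> \<Longrightarrow> \<exists>Z. is_biproduct T X Y Z"


section \<open>Triangulated categories\<close>

text \<open>An element \<open>(f, g, h)\<close> of \<open>dist T\<close> is an exact triangle
  \<open>X \<rightarrow> Y \<rightarrow> Z \<rightarrow> \<Sigma>X\<close>. The suspension is an additive self-equivalence, not necessarily strict.\<close>

record ('o, 'm) triangulated_data = "('o, 'm) additive_data" +
  sh :: "'o \<Rightarrow> 'o"
  shm :: "'m \<Rightarrow> 'm"
  dist :: "('m \<times> 'm \<times> 'm) set"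

definition candidate_triangle ::
  "('o, 'm, 'z) triangulated_data_scheme \<Rightarrow> 'o \<Rightarrow> 'o \<Rightarrow> 'o \<Rightarrow> 'm \<Rightarrow> 'm \<Rightarrow> 'm \<Rightarrow> bool" where
  "candidate_triangle T X Y Z f g h \<longleftrightarrow>
     f \<in> homset T X Y \<and> g \<in> homset T Y Z \<and> h \<in> homset T Z (sh T X)"

definition exact_triangle ::
  "('o, 'm, 'z) triangulated_data_scheme \<Rightarrow> 'o \<Rightarrow> 'o \<Rightarrow> 'o \<Rightarrow> 'm \<Rightarrow> 'm \<Rightarrow> 'm \<Rightarrow> bool" where
  "exact_triangle T X Y Z f g h \<longleftrightarrow> candidate_triangle T X Y Z f g h \<and> (f, g, h) \<in> dist T"

locale triangulated_category = additive_category T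
  for T :: "('o, 'm, 'z) triangulated_data_scheme" (structure) +
  assumes sh_obj: "X \<in> obj T \<Longrightarrow> sh T X \<in> obj T"
    and shm_hom: "f \<in> homset T X Y \<Longrightarrow> shm T f \<in> homset T (sh T X) (sh T Y)"
    and shm_ident: "X \<in> obj T \<Longrightarrow> shm T (ident T X) = ident T (sh T X)"
    and shm_after: "\<lbrakk>f \<in> homset T X Y; g \<in> homset T Y Z\<rbrakk> \<Longrightarrow> shm T (g \<cdot> f) = shm T g \<cdot> shm T f"
    and shm_plus: "\<lbrakk>f \<in> homset T X Y; g \<in> homset T X Y\<rbrakk> \<Longrightarrow> shm T (f \<boxplus> g) = shm T f \<boxplus> shm T g"
    and shm_full_faithful: "\<lbrakk>X \<in> obj T; Y \<in> obj T\<rbrakk>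
          \<Longrightarrow> bij_betw (shm T) (homset T X Y) (homset T (sh T X) (sh T Y))"
    and sh_ess_surj: "Y \<in> obj T \<Longrightarrow> \<exists>X\<in>obj T. isomorphic_objs T (sh T X) Y"
    and triangle_ident: "\<lbrakk>X \<in> obj T; zero_object T Z\<rbrakk>
          \<Longrightarrow> exact_triangle T X X Z (ident T X) (zero_mor T X Z) (zero_mor T Z (sh T X))"
    and triangle_iso: "\<lbrakk>exact_triangle T X Y Z f g h; candidate_triangle T X' Y' Z' f' g' h';
          a \<in> isos T X X'; b \<in> isos T Y Y'; c \<in> isos T Z Z';
          b \<cdot> f = f' \<cdot> a; c \<cdot> g = g' \<cdot> b; shm T a \<cdot> h = h' \<cdot> c\<rbrakk>
          \<Longrightarrow> exact_triangle T X' Y' Z' f' g' h'"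
    and triangle_completion: "f \<in> homset T X Y \<Longrightarrow> \<exists>Z g h. exact_triangle T X Y Z f g h"
    and triangle_rotation: "candidate_triangle T X Y Z f g h \<Longrightarrow>
          exact_triangle T X Y Z f g h \<longleftrightarrow>
          exact_triangle T Y Z (sh T X) g h (neg_mor T (shm T f))"
    and triangle_morphism: "\<lbrakk>exact_triangle T X Y Z f g h; exact_triangle T X' Y' Z' f' g' h';
          a \<in> homset T X X'; b \<in> homset T Y Y'; b \<cdot> f = f' \<cdot> a\<rbrakk>
          \<Longrightarrow> \<exists>c \<in> homset T Z Z'. c \<cdot> g = g' \<cdot> b \<and> shm T a \<cdot> h = h' \<cdot> c"
    and octahedral: "\<lbrakk>exact_triangle T X Y Z' f i i'; exact_triangle T Y Z X' g j j';
          exact_triangle T X Z Y' (g \<cdot> f) k k'\<rbrakk>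
          \<Longrightarrow> \<exists>u v. exact_triangle T Z' Y' X' u v (shm T i \<cdot> j') \<and>
                u \<cdot> i = k \<cdot> g \<and> k' \<cdot> u = i' \<and> v \<cdot> k = j \<and> j' \<cdot> v = shm T f \<cdot> k'"


section \<open>Tensor-triangulated categories\<close>

text \<open>\<open>sh_tensor T X Y : \<Sigma>X \<otimes> Y \<rightarrow> \<Sigma>(X \<otimes> Y)\<close> is the isomorphism that makes
  \<open>- \<otimes> Y\<close> commute with suspension.\<close>

record ('o, 'm) tt_data = "('o, 'm) triangulated_data" +
  unit_obj :: "'o"
  tensor :: "'o \<Rightarrow> 'o \<Rightarrow> 'o"  (infixl \<open>\<boxtimes>\<index>\<close> 75)
  tensorm :: "'m \<Rightarrow> 'm \<Rightarrow> 'm"  (infixl \<open>\<boxtimes>\<^sub>m\<index>\<close> 75)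
  assoc :: "'o \<Rightarrow> 'o \<Rightarrow> 'o \<Rightarrow> 'm"
  lunit :: "'o \<Rightarrow> 'm"
  runit :: "'o \<Rightarrow> 'm"
  braid :: "'o \<Rightarrow> 'o \<Rightarrow> 'm"
  sh_tensor :: "'o \<Rightarrow> 'o \<Rightarrow> 'm"

locale symmetric_monoidal_category = category T
  for T :: "('o, 'm, 'z) tt_data_scheme" (structure) +
  assumes unit_obj: "unit_obj T \<in> obj T"
    and tensor_obj: "\<lbrakk>X \<in> obj T; Y \<in> obj T\<rbrakk> \<Longrightarrow> X \<boxtimes> Y \<in> obj T"
    and tensorm_hom: "\<lbrakk>f \<in> homset T X X'; g \<in> homset T Y Y'\<rbrakk>
          \<Longrightarrow> f \<boxtimes>\<^sub>m g \<in> homset T (X \<boxtimes> Y) (X' \<boxtimes> Y')"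
    and tensorm_ident: "\<lbrakk>X \<in> obj T; Y \<in> obj T\<rbrakk>
          \<Longrightarrow> ident T X \<boxtimes>\<^sub>m ident T Y = ident T (X \<boxtimes> Y)"
    and tensorm_after: "\<lbrakk>f \<in> homset T X X'; f' \<in> homset T X' X'';
          g \<in> homset T Y Y'; g' \<in> homset T Y' Y''\<rbrakk>
          \<Longrightarrow> (f' \<cdot> f) \<boxtimes>\<^sub>m (g' \<cdot> g) = (f' \<boxtimes>\<^sub>m g') \<cdot> (f \<boxtimes>\<^sub>m g)"
    and assoc_iso: "\<lbrakk>X \<in> obj T; Y \<in> obj T; Z \<in> obj T\<rbrakk>
          \<Longrightarrow> assoc T X Y Z \<in> isos T ((X \<boxtimes> Y) \<boxtimes> Z) (X \<boxtimes> (Y \<boxtimes> Z))"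
    and assoc_natural: "\<lbrakk>f \<in> homset T X X'; g \<in> homset T Y Y'; h \<in> homset T Z Z'\<rbrakk>
          \<Longrightarrow> assoc T X' Y' Z' \<cdot> ((f \<boxtimes>\<^sub>m g) \<boxtimes>\<^sub>m h) = (f \<boxtimes>\<^sub>m (g \<boxtimes>\<^sub>m h)) \<cdot> assoc T X Y Z"
    and lunit_iso: "X \<in> obj T \<Longrightarrow> lunit T X \<in> isos T (unit_obj T \<boxtimes> X) X"
    and lunit_natural: "f \<in> homset T X Y
          \<Longrightarrow> lunit T Y \<cdot> (ident T (unit_obj T) \<boxtimes>\<^sub>m f) = f \<cdot> lunit T X"
    and runit_iso: "X \<in> obj T \<Longrightarrow> runit T X \<in> isos T (X \<boxtimes> unit_obj T) X"
    and runit_natural: "f \<in> homset T X Y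
          \<Longrightarrow> runit T Y \<cdot> (f \<boxtimes>\<^sub>m ident T (unit_obj T)) = f \<cdot> runit T X"
    and braid_iso: "\<lbrakk>X \<in> obj T; Y \<in> obj T\<rbrakk> \<Longrightarrow> braid T X Y \<in> isos T (X \<boxtimes> Y) (Y \<boxtimes> X)"
    and braid_natural: "\<lbrakk>f \<in> homset T X X'; g \<in> homset T Y Y'\<rbrakk>
          \<Longrightarrow> braid T X' Y' \<cdot> (f \<boxtimes>\<^sub>m g) = (g \<boxtimes>\<^sub>m f) \<cdot> braid T X Y"
    and braid_symmetric: "\<lbrakk>X \<in> obj T; Y \<in> obj T\<rbrakk>
          \<Longrightarrow> braid T Y X \<cdot> braid T X Y = ident T (X \<boxtimes> Y)"
    and pentagon: "\<lbrakk>W \<in> obj T; X \<in> obj T; Y \<in> obj T; Z \<in> obj T\<rbrakk>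
          \<Longrightarrow> assoc T W X (Y \<boxtimes> Z) \<cdot> assoc T (W \<boxtimes> X) Y Z =
              (ident T W \<boxtimes>\<^sub>m assoc T X Y Z) \<cdot> assoc T W (X \<boxtimes> Y) Z \<cdot>
                (assoc T W X Y \<boxtimes>\<^sub>m ident T Z)"
    and triangle: "\<lbrakk>X \<in> obj T; Y \<in> obj T\<rbrakk>
          \<Longrightarrow> (ident T X \<boxtimes>\<^sub>m lunit T Y) \<cdot> assoc T X (unit_obj T) Y = runit T X \<boxtimes>\<^sub>m ident T Y"
    and hexagon: "\<lbrakk>X \<in> obj T; Y \<in> obj T; Z \<in> obj T\<rbrakk>
          \<Longrightarrow> assoc T Y Z X \<cdot> braid T X (Y \<boxtimes> Z) \<cdot> assoc T X Y Z =
              (ident T Y \<boxtimes>\<^sub>m braid T X Z) \<cdot> assoc T Y X Z \<cdot> (braid T X Y \<boxtimes>\<^sub>m ident T Z)"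

text \<open>Closedness: every functor \<open>- \<otimes> Y\<close> has a right adjoint, given by the universal
  evaluations \<open>H \<otimes> Y \<rightarrow> Z\<close>.\<close>

definition is_internal_hom ::
  "('o, 'm, 'z) tt_data_scheme \<Rightarrow> 'o \<Rightarrow> 'o \<Rightarrow> 'o \<Rightarrow> 'm \<Rightarrow> bool" where
  "is_internal_hom T Y Z H ev \<longleftrightarrow> H \<in> obj T \<and> ev \<in> homset T (H \<boxtimes>\<^bsub>T\<^esub> Y) Z \<and>
     (\<forall>X\<in>obj T. \<forall>f \<in> homset T (X \<boxtimes>\<^bsub>T\<^esub> Y) Z.
        \<exists>!g. g \<in> homset T X H \<and> ev \<cdot>\<^bsub>T\<^esub> (g \<boxtimes>\<^sub>m\<^bsub>T\<^esub> ident T Y) = f)"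

locale closed_symmetric_monoidal_category = symmetric_monoidal_category T
  for T :: "('o, 'm, 'z) tt_data_scheme" (structure) +
  assumes internal_hom_exists: "\<lbrakk>Y \<in> obj T; Z \<in> obj T\<rbrakk> \<Longrightarrow> \<exists>H ev. is_internal_hom T Y Z H ev"

text \<open>The isomorphism \<open>X \<otimes> \<Sigma>Y \<rightarrow> \<Sigma>(X \<otimes> Y)\<close> obtained from \<open>sh_tensor\<close> by symmetry.\<close>

definition tensor_sh :: "('o, 'm, 'z) tt_data_scheme \<Rightarrow> 'o \<Rightarrow> 'o \<Rightarrow> 'm" where
  "tensor_sh T X Y =
     shm T (braid T Y X) \<cdot>\<^bsub>T\<^esub> sh_tensor T Y X \<cdot>\<^bsub>T\<^esub> braid T X (sh T Y)"

text \<open>Compatibility of the tensor product with the triangulation: \<open>- \<otimes> W\<close> is an exact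
  functor for every \<open>W\<close> (and so is \<open>W \<otimes> -\<close>, by symmetry), coherently with the unit and
  associativity isomorphisms, and the two ways of moving suspensions out of
  \<open>\<Sigma>X \<otimes> \<Sigma>Y\<close> differ by the sign \<open>-1\<close>. Exactness of the internal hom is not
  required.\<close>

locale closed_tt_category = triangulated_category T + closed_symmetric_monoidal_category T
  for T :: "('o, 'm, 'z) tt_data_scheme" (structure) +
  assumes tensor_plus: "\<lbrakk>f \<in> homset T X Y; g \<in> homset T X Y; W \<in> obj T\<rbrakk>
          \<Longrightarrow> (f \<boxplus> g) \<boxtimes>\<^sub>m ident T W = (f \<boxtimes>\<^sub>m ident T W) \<boxplus> (g \<boxtimes>\<^sub>m ident T W)"
    and sh_tensor_iso: "\<lbrakk>X \<in> obj T; Y \<in> obj T\<rbrakk>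
          \<Longrightarrow> sh_tensor T X Y \<in> isos T (sh T X \<boxtimes> Y) (sh T (X \<boxtimes> Y))"
    and sh_tensor_natural: "\<lbrakk>f \<in> homset T X X'; g \<in> homset T Y Y'\<rbrakk>
          \<Longrightarrow> sh_tensor T X' Y' \<cdot> (shm T f \<boxtimes>\<^sub>m g) = shm T (f \<boxtimes>\<^sub>m g) \<cdot> sh_tensor T X Y"
    and sh_tensor_unit: "X \<in> obj T
          \<Longrightarrow> shm T (runit T X) \<cdot> sh_tensor T X (unit_obj T) = runit T (sh T X)"
    and sh_tensor_assoc: "\<lbrakk>X \<in> obj T; Y \<in> obj T; Z \<in> obj T\<rbrakk>
          \<Longrightarrow> shm T (assoc T X Y Z) \<cdot> sh_tensor T (X \<boxtimes> Y) Z \<cdot> (sh_tensor T X Y \<boxtimes>\<^sub>m ident T Z) =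
              sh_tensor T X (Y \<boxtimes> Z) \<cdot> assoc T (sh T X) Y Z"
    and tensor_exact: "\<lbrakk>exact_triangle T X Y Z f g h; W \<in> obj T\<rbrakk>
          \<Longrightarrow> exact_triangle T (X \<boxtimes> W) (Y \<boxtimes> W) (Z \<boxtimes> W)
                (f \<boxtimes>\<^sub>m ident T W) (g \<boxtimes>\<^sub>m ident T W) (sh_tensor T X W \<cdot> (h \<boxtimes>\<^sub>m ident T W))"
    and tensor_sign: "\<lbrakk>X \<in> obj T; Y \<in> obj T\<rbrakk>
          \<Longrightarrow> shm T (tensor_sh T X Y) \<cdot> sh_tensor T X (sh T Y) =
              neg_mor T (shm T (sh_tensor T X Y) \<cdot> tensor_sh T (sh T X) Y)"

text \<open>Rigid objects are those possessing a dual, expressed by the two zig-zag identities.\<close>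

definition is_dual :: "('o, 'm, 'z) tt_data_scheme \<Rightarrow> 'o \<Rightarrow> 'o \<Rightarrow> bool" where
  "is_dual T X D \<longleftrightarrow> X \<in> obj T \<and> D \<in> obj T \<and>
     (\<exists>ev \<in> homset T (D \<boxtimes>\<^bsub>T\<^esub> X) (unit_obj T). \<exists>coev \<in> homset T (unit_obj T) (X \<boxtimes>\<^bsub>T\<^esub> D).
        runit T X \<cdot>\<^bsub>T\<^esub> (ident T X \<boxtimes>\<^sub>m\<^bsub>T\<^esub> ev) \<cdot>\<^bsub>T\<^esub> assoc T X D X \<cdot>\<^bsub>T\<^esub>
          (coev \<boxtimes>\<^sub>m\<^bsub>T\<^esub> ident T X) = lunit T X \<and>
        lunit T D \<cdot>\<^bsub>T\<^esub> (ev \<boxtimes>\<^sub>m\<^bsub>T\<^esub> ident T D) \<cdot>\<^bsub>T\<^esub> inv_mor T (assoc T D X D) \<cdot>\<^bsub>T\<^esub>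
          (ident T D \<boxtimes>\<^sub>m\<^bsub>T\<^esub> coev) = runit T D)"

definition rigid_objs :: "('o, 'm, 'z) tt_data_scheme \<Rightarrow> 'o set" where
  "rigid_objs T = {X \<in> obj T. \<exists>D. is_dual T X D}"

text \<open>\<open>X\<^sup>\<otimes>\<^sup>n\<close>\<close>

fun tensor_power :: "('o, 'm, 'z) tt_data_scheme \<Rightarrow> 'o \<Rightarrow> nat \<Rightarrow> 'o" where
  "tensor_power T X 0 = unit_obj T"
| "tensor_power T X (Suc 0) = X"
| "tensor_power T X (Suc (Suc n)) = X \<boxtimes>\<^bsub>T\<^esub> tensor_power T X (Suc n)"


section \<open>Subcategories\<close>

text \<open>Full replete subcategories are identified with their classes of objects.\<close>

definition triangulated_subcat :: "('o, 'm, 'z) triangulated_data_scheme \<Rightarrow> 'o set \<Rightarrow> bool" where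
  "triangulated_subcat T L \<longleftrightarrow> L \<subseteq> obj T \<and> L \<noteq> {} \<and>
     (\<forall>X\<in>L. \<forall>Y\<in>obj T. isomorphic_objs T X Y \<longrightarrow> Y \<in> L) \<and>
     (\<forall>X\<in>obj T. sh T X \<in> L \<longleftrightarrow> X \<in> L) \<and>
     (\<forall>X Y Z f g h. exact_triangle T X Y Z f g h \<and> X \<in> L \<and> Y \<in> L \<longrightarrow> Z \<in> L)"

definition full_subcat :: "('o, 'm, 'z) tt_data_scheme \<Rightarrow> 'o set \<Rightarrow> ('o, 'm, 'z) tt_data_scheme" where
  "full_subcat T A = T\<lparr>obj := A,
     arr := {f \<in> arr T. src T f \<in> A \<and> tgt T f \<in> A},
     dist := {(f, g, h) \<in> dist T. src T f \<in> A \<and> tgt T f \<in> A \<and> tgt T g \<in> A}\<rparr>"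


section \<open>Smallness\<close>

text \<open>``Small'' means of cardinality less than a fixed (uncountable, strongly) inaccessible
  cardinal \<open>\<kappa>\<close>. Up to bijection, every small set is a subset of \<open>Field \<kappa>\<close>, so these
  subsets suffice as index sets.\<close>

definition inaccessible :: "'i rel \<Rightarrow> bool" where
  "inaccessible \<kappa> \<longleftrightarrow> Card_order \<kappa> \<and> natLeq <o \<kappa> \<and> regularCard \<kappa> \<and>
     (\<forall>A \<subseteq> Field \<kappa>. |A| <o \<kappa> \<longrightarrow> |Pow A| <o \<kappa>)"

definition small_index :: "'i rel \<Rightarrow> 'i set \<Rightarrow> bool" where
  "small_index \<kappa> I \<longleftrightarrow> I \<subseteq> Field \<kappa> \<and> |I| <o \<kappa>"

definition localizing_subcat ::
  "'i rel \<Rightarrow> ('o, 'm, 'z) triangulated_data_scheme \<Rightarrow> 'o set \<Rightarrow> bool" where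
  "localizing_subcat \<kappa> T L \<longleftrightarrow> triangulated_subcat T L \<and>
     (\<forall>I X S \<iota>. small_index \<kappa> I \<and> (\<forall>i\<in>I. X i \<in> L) \<and> is_coproduct T I X S \<iota> \<longrightarrow> S \<in> L)"

definition localizing_hull ::
  "'i rel \<Rightarrow> ('o, 'm, 'z) triangulated_data_scheme \<Rightarrow> 'o set \<Rightarrow> 'o set" where
  "localizing_hull \<kappa> T C = \<Inter>{L. localizing_subcat \<kappa> T L \<and> C \<subseteq> L}"

text \<open>\<open>C\<close> is compact if the canonical map
  \<open>\<Oplus>\<^sub>i Hom(C, X\<^sub>i) \<rightarrow> Hom(C, \<Coprod>\<^sub>i X\<^sub>i)\<close> is an isomorphism for every small family;
  \<^const>\<open>finprod\<close> is a sum here, since \<^const>\<open>hom_group\<close> is written multiplicatively.\<close>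

definition compact_objs :: "'i rel \<Rightarrow> ('o, 'm, 'z) additive_data_scheme \<Rightarrow> 'o set" where
  "compact_objs \<kappa> T = {C \<in> obj T.
     \<forall>I X S \<iota>. small_index \<kappa> I \<and> (\<forall>i\<in>I. X i \<in> obj T) \<and> is_coproduct T I X S \<iota> \<longrightarrow>
       (\<lambda>f. finprod (hom_group T C S) (\<lambda>i. \<iota> i \<cdot>\<^bsub>T\<^esub> f i)
              {i \<in> I. f i \<noteq> zero_mor T C (X i)})
       \<in> iso (sum_group I (\<lambda>i. hom_group T C (X i))) (hom_group T C S)}"

definition essentially_small :: "'i rel \<Rightarrow> ('o, 'm, 'z) category_data_scheme \<Rightarrow> 'o set \<Rightarrow> bool" where
  "essentially_small \<kappa> T A \<longleftrightarrow>
     (\<exists>S \<subseteq> A. |S| <o \<kappa> \<and> (\<forall>X\<in>A. \<exists>Y\<in>S. isomorphic_objs T X Y))"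


section \<open>Big tt-categories and their spectra\<close>

locale big_tt_category = closed_tt_category T
  for \<kappa> :: "'i rel" and T :: "('o, 'm, 'z) tt_data_scheme" (structure) +
  assumes inaccessible: "inaccessible \<kappa>"
    and locally_small: "\<lbrakk>X \<in> obj T; Y \<in> obj T\<rbrakk> \<Longrightarrow> |homset T X Y| <o \<kappa>"
    and coproducts_exist: "\<lbrakk>small_index \<kappa> I; \<forall>i\<in>I. F i \<in> obj T\<rbrakk>
          \<Longrightarrow> \<exists>S \<iota>. is_coproduct T I F S \<iota>"
    and compact_eq_rigid: "compact_objs \<kappa> T = rigid_objs T"
    and compact_essentially_small: "essentially_small \<kappa> T (compact_objs \<kappa> T)"
    and compactly_generated: "localizing_hull \<kappa> T (compact_objs \<kappa> T) = obj T"

definition compact_part :: "'i rel \<Rightarrow> ('o, 'm, 'z) tt_data_scheme \<Rightarrow> ('o, 'm, 'z) tt_data_scheme" where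
  "compact_part \<kappa> T = full_subcat T (compact_objs \<kappa> T)"

definition thick_tensor_ideal :: "('o, 'm, 'z) tt_data_scheme \<Rightarrow> 'o set \<Rightarrow> bool" where
  "thick_tensor_ideal K J \<longleftrightarrow> triangulated_subcat K J \<and>
     (\<forall>X Y Z. is_biproduct K X Y Z \<and> Z \<in> J \<longrightarrow> X \<in> J \<and> Y \<in> J) \<and>
     (\<forall>a\<in>obj K. \<forall>x\<in>J. a \<boxtimes>\<^bsub>K\<^esub> x \<in> J)"

definition Spc :: "('o, 'm, 'z) tt_data_scheme \<Rightarrow> 'o set set" where
  "Spc K = {p. thick_tensor_ideal K p \<and> p \<noteq> obj K \<and>
     (\<forall>a\<in>obj K. \<forall>b\<in>obj K. a \<boxtimes>\<^bsub>K\<^esub> b \<in> p \<longrightarrow> a \<in> p \<or> b \<in> p)}"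

definition localizing_ideal :: "'i rel \<Rightarrow> ('o, 'm, 'z) tt_data_scheme \<Rightarrow> 'o set \<Rightarrow> bool" where
  "localizing_ideal \<kappa> T I \<longleftrightarrow> localizing_subcat \<kappa> T I \<and> (\<forall>Y\<in>obj T. \<forall>X\<in>I. Y \<boxtimes>\<^bsub>T\<^esub> X \<in> I)"

definition radical_localizing_ideal :: "'i rel \<Rightarrow> ('o, 'm, 'z) tt_data_scheme \<Rightarrow> 'o set \<Rightarrow> bool" where
  "radical_localizing_ideal \<kappa> T I \<longleftrightarrow> localizing_ideal \<kappa> T I \<and>
     (\<forall>X\<in>obj T. \<forall>n\<ge>1. tensor_power T X n \<in> I \<longrightarrow> X \<in> I)"

definition big_prime :: "'i rel \<Rightarrow> ('o, 'm, 'z) tt_data_scheme \<Rightarrow> 'o set \<Rightarrow> bool" where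
  "big_prime \<kappa> T P \<longleftrightarrow> radical_localizing_ideal \<kappa> T P \<and> P \<noteq> obj T \<and>
     (\<forall>I J. radical_localizing_ideal \<kappa> T I \<and> radical_localizing_ideal \<kappa> T J \<and> I \<inter> J \<subseteq> P \<longrightarrow>
        I \<subseteq> P \<or> J \<subseteq> P)"

end

theory Submission
  imports Defs
begin

text \<open>
  The big prime is the kernel of a homological residue field. Let \<open>K\<close> be the category of compact
  (equivalently, rigid) objects. The maps of \<open>K\<close> that factor through an object of \<open>p\<close> form an
  ideal closed under tensoring and under extensions, which amounts to a Serre tensor ideal of the
  finitely presented functors on \<open>K\<close>; an object of \<open>K\<close> lies in \<open>p\<close> iff its identity lies in this
  ideal. By Zorn's lemma choose \<open>I\<close> maximal among such ideals that contain no further identities,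
  and let \<open>P\<close> consist of the objects of \<open>T\<close> that vanish modulo the localizing subcategory
  generated by \<open>I\<close>. The latter condition is phrased elementwise, so that no functor categories are
  needed.

  Then \<open>P\<close> is a localizing ideal with \<open>P \<inter> K = p\<close>. If \<open>X \<otimes> Y \<in> P\<close> and \<open>X \<notin> P\<close>, some map \<open>v\<close> of
  \<open>K\<close> outside \<open>I\<close> becomes torsion after tensoring with \<open>Y\<close>. The maps with this property form an
  ideal strictly containing \<open>I\<close>, so by maximality it contains the identity of some \<open>x \<notin> p\<close>, that
  is, \<open>x \<otimes> Y \<in> P\<close>; maximality again lets one cancel \<open>x\<close>, giving \<open>Y \<in> P\<close>. Hence \<open>P\<close> is prime even
  for objects, in particular radical and a big prime.
\<close>

section \<open>Categories and hom groups\<close>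

text \<open>Zorn's lemma is not applied to localizing ideals of \<open>T\<close> themselves, because
  the union of a chain of them need not be closed under coproducts. Each axiom for an ideal of
  compact maps involves only finitely many memberships, so unions of chains are harmless there; big
  objects enter once a maximal ideal has been chosen.

  The delicate point of primality is how a nontorsion \<open>X\<close> yields
  \<open>v \<notin> I\<close> with \<open>v \<otimes> Y\<close> torsion. A failed test for
  \<open>X\<close> consists of a map \<open>u : d \<rightarrow> X \<otimes> c\<close> and a map
  \<open>v \<notin> I\<close> on \<open>d\<close> whose restriction to the kernel of
  \<open>u\<close> lies in \<open>I\<close>. Modulo torsion, \<open>v\<close> thus factors through
  the image of \<open>u\<close> inside the functor of \<open>X \<otimes> c\<close>. Tensoring with
  \<open>Y\<close> has to keep this image inside the functor of
  \<open>X \<otimes> Y \<otimes> c\<close>, a flatness statement about big objects. Without functor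
  categories it rests on an assertion about maps: a map from a compact object to
  \<open>W \<otimes> F\<close> factors through \<open>W \<otimes> e'\<close> with \<open>e'\<close>
  compact over \<open>F\<close>. Duality gives this for compact \<open>W\<close>, and compact
  generation extends it to all \<open>W\<close>.\<close>

context category
begin

lemma homset_iff: "f \<in> homset T X Y \<longleftrightarrow> f \<in> arr T \<and> src T f = X \<and> tgt T f = Y"
  by (simp add: homset_def)

lemma src_in [simp]: "f \<in> arr T \<Longrightarrow> src T f \<in> obj T"
  and tgt_in [simp]: "f \<in> arr T \<Longrightarrow> tgt T f \<in> obj T"
  by (simp_all add: src_obj tgt_obj)

lemma homset_objs: "f \<in> homset T X Y \<Longrightarrow> X \<in> obj T \<and> Y \<in> obj T"
  by (auto simp: homset_iff)

lemma ident_arr [simp]: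
  assumes "X \<in> obj T"
  shows "ident T X \<in> arr T" "src T (ident T X) = X" "tgt T (ident T X) = X"
  using ident_hom[OF assms] by (simp_all add: homset_iff)

lemma after_arr [simp]:
  assumes "f \<in> arr T" "g \<in> arr T" "src T g = tgt T f"
  shows "g \<cdot> f \<in> arr T" "src T (g \<cdot> f) = src T f" "tgt T (g \<cdot> f) = tgt T g"
  using after_hom[of f "src T f" "tgt T f" g "tgt T g"] assms by (simp_all add: homset_iff)

lemma after_ident_arr [simp]: "\<lbrakk>f \<in> arr T; src T f = X\<rbrakk> \<Longrightarrow> f \<cdot> ident T X = f"
  and ident_after_arr [simp]: "\<lbrakk>f \<in> arr T; tgt T f = X\<rbrakk> \<Longrightarrow> ident T X \<cdot> f = f"
  using after_ident[of f "src T f" "tgt T f"] ident_after[of f "src T f" "tgt T f"]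
  by (auto simp: homset_iff)

lemma after_assoc_arr [simp]:
  "\<lbrakk>f \<in> arr T; g \<in> arr T; h \<in> arr T; src T g = tgt T f; src T h = tgt T g\<rbrakk>
    \<Longrightarrow> (h \<cdot> g) \<cdot> f = h \<cdot> (g \<cdot> f)"
  using after_assoc[of f "src T f" "tgt T f" g "tgt T g" h "tgt T h"] by (simp add: homset_iff)

section \<open>Isomorphisms and their inverses\<close>

lemma inverse_mors_unique:
  assumes "inverse_mors T f g" "inverse_mors T f g'"
  shows "g = g'"
proof -
  have a: "f \<in> arr T" "g \<in> arr T" "g' \<in> arr T" "src T g = tgt T f" "tgt T g = src T f"
    "src T g' = tgt T f" "tgt T g' = src T f" "g \<cdot> f = ident T (src T f)"
    "f \<cdot> g' = ident T (tgt T f)"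
    using assms by (auto simp: inverse_mors_def homset_iff)
  have "g = g \<cdot> (f \<cdot> g')" using a by simp
  also have "\<dots> = (g \<cdot> f) \<cdot> g'" using a(1-7) by simp
  also have "\<dots> = g'" using a by simp
  finally show ?thesis .
qed

lemma isos_inverse:
  assumes "f \<in> isos T X Y"
  shows "inverse_mors T f (inv_mor T f)"
proof -
  obtain g where g: "inverse_mors T f g"
    using assms by (auto simp: isos_def iso_mor_def)
  then have "inv_mor T f = g"
    unfolding inv_mor_def using inverse_mors_unique by blast
  then show ?thesis using g by simp
qed

lemma isos_arr:
  assumes "f \<in> isos T X Y"
  shows "f \<in> arr T" "src T f = X" "tgt T f = Y"
    "inv_mor T f \<in> arr T" "src T (inv_mor T f) = Y" "tgt T (inv_mor T f) = X"
    "inv_mor T f \<cdot> f = ident T X" "f \<cdot> inv_mor T f = ident T Y"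
  using isos_inverse[OF assms] assms by (auto simp: inverse_mors_def isos_def homset_iff)

lemma isos_cancel:
  assumes "f \<in> isos T X Y" "g \<in> arr T"
  shows "tgt T g = X \<Longrightarrow> inv_mor T f \<cdot> (f \<cdot> g) = g"
    "tgt T g = Y \<Longrightarrow> f \<cdot> (inv_mor T f \<cdot> g) = g"
proof -
  note i = isos_arr[OF assms(1)]
  show "inv_mor T f \<cdot> (f \<cdot> g) = g" if "tgt T g = X"
    using after_assoc_arr[of g f "inv_mor T f"] i assms that by simp
  show "f \<cdot> (inv_mor T f \<cdot> g) = g" if "tgt T g = Y"
    using after_assoc_arr[of g "inv_mor T f" f] i assms that by simp
qed

lemma isosI:
  assumes "f \<in> homset T X Y" "g \<in> homset T Y X" "g \<cdot> f = ident T X" "f \<cdot> g = ident T Y"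
  shows "f \<in> isos T X Y"
  using assms by (auto simp: isos_def iso_mor_def inverse_mors_def homset_iff)

lemma isos_inv: "f \<in> isos T X Y \<Longrightarrow> inv_mor T f \<in> isos T Y X"
  using isos_arr[of f X Y] by (intro isosI[where g = f]) (auto simp: homset_iff)

lemma isos_after:
  assumes "f \<in> isos T X Y" "g \<in> isos T Y Z"
  shows "g \<cdot> f \<in> isos T X Z"
proof (rule isosI[where g = "inv_mor T f \<cdot> inv_mor T g"])
  note a = isos_arr[OF assms(1)] isos_arr[OF assms(2)]
  show "g \<cdot> f \<in> homset T X Z" "inv_mor T f \<cdot> inv_mor T g \<in> homset T Z X"
    using a by (auto simp: homset_iff)
  show "(inv_mor T f \<cdot> inv_mor T g) \<cdot> g \<cdot> f = ident T X"
    "(g \<cdot> f) \<cdot> inv_mor T f \<cdot> inv_mor T g = ident T Z"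
    using a isos_cancel[OF assms(2), of f] isos_cancel[OF assms(1), of "inv_mor T g"] by simp_all
qed

lemma isos_ident: "X \<in> obj T \<Longrightarrow> ident T X \<in> isos T X X"
  by (rule isosI[where g = "ident T X"]) (auto simp: homset_iff)

lemma isos_epi:
  assumes "f \<in> isos T X Y" "g \<in> arr T" "h \<in> arr T" "src T g = Y" "src T h = Y" "g \<cdot> f = h \<cdot> f"
  shows "g = h"
proof -
  note a = isos_arr[OF assms(1)]
  have "(g \<cdot> f) \<cdot> inv_mor T f = (h \<cdot> f) \<cdot> inv_mor T f" using assms(6) by simp
  then show ?thesis using a assms(2-5) by simp
qed

lemma isos_mono:
  assumes "f \<in> isos T X Y" "g \<in> arr T" "h \<in> arr T" "tgt T g = X" "tgt T h = X" "f \<cdot> g = f \<cdot> h"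
  shows "g = h"
  using isos_cancel(1)[OF assms(1,2,4)] isos_cancel(1)[OF assms(1,3,5)] assms(6) by metis

section \<open>The universal property of coproducts\<close>

lemma coproduct_arr:
  assumes "is_coproduct T I X S \<iota>"
  shows "S \<in> obj T" "\<And>i. i \<in> I \<Longrightarrow> \<iota> i \<in> arr T" "\<And>i. i \<in> I \<Longrightarrow> src T (\<iota> i) = X i"
    "\<And>i. i \<in> I \<Longrightarrow> tgt T (\<iota> i) = S" "\<And>i. i \<in> I \<Longrightarrow> X i \<in> obj T"
proof -
  have a: "\<And>i. i \<in> I \<Longrightarrow> \<iota> i \<in> homset T (X i) S" using assms by (simp add: is_coproduct_def)
  show "\<And>i. i \<in> I \<Longrightarrow> X i \<in> obj T" using a homset_objs by blast
  from a show "\<And>i. i \<in> I \<Longrightarrow> \<iota> i \<in> arr T" "\<And>i. i \<in> I \<Longrightarrow> src T (\<iota> i) = X i"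
    "\<And>i. i \<in> I \<Longrightarrow> tgt T (\<iota> i) = S"
    by (auto simp: homset_iff)
  show "S \<in> obj T" using assms by (simp add: is_coproduct_def)
qed

lemma coproduct_ex:
  assumes "is_coproduct T I X S \<iota>" "Y \<in> obj T" "\<And>i. i \<in> I \<Longrightarrow> f i \<in> homset T (X i) Y"
  obtains g where "g \<in> homset T S Y" "\<And>i. i \<in> I \<Longrightarrow> g \<cdot> \<iota> i = f i"
  using assms unfolding is_coproduct_def by metis

lemma coproduct_eq:
  assumes "is_coproduct T I X S \<iota>" "g \<in> homset T S Y" "h \<in> homset T S Y"
    "\<And>i. i \<in> I \<Longrightarrow> g \<cdot> \<iota> i = h \<cdot> \<iota> i"
  shows "g = h"
proof -
  have h: "\<forall>i\<in>I. h \<cdot> \<iota> i \<in> homset T (X i) Y"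
    using coproduct_arr[OF assms(1)] assms(3) by (auto simp: homset_iff)
  have "Y \<in> obj T" using assms(2) homset_objs by blast
  with assms(1) have "\<And>f. (\<forall>i\<in>I. f i \<in> homset T (X i) Y) \<longrightarrow>
      (\<exists>!k. k \<in> homset T S Y \<and> (\<forall>i\<in>I. k \<cdot> \<iota> i = f i))"
    unfolding is_coproduct_def by blast
  from this[of "\<lambda>i. h \<cdot> \<iota> i"] h have "\<exists>!k. k \<in> homset T S Y \<and> (\<forall>i\<in>I. k \<cdot> \<iota> i = h \<cdot> \<iota> i)"
    by blast
  then show ?thesis using assms by blast
qed

end

context additive_category
begin

section \<open>Additive arithmetic of morphisms\<close>

lemma hom_group_simps [simp]:
  "carrier (hom_group T X Y) = homset T X Y" "x \<otimes>\<^bsub>hom_group T X Y\<^esub> y = x \<boxplus> y"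
  "\<one>\<^bsub>hom_group T X Y\<^esub> = zero_mor T X Y"
  by (simp_all add: hom_group_def)

lemma zero_arr [simp]:
  assumes "X \<in> obj T" "Y \<in> obj T"
  shows "zero_mor T X Y \<in> arr T" "src T (zero_mor T X Y) = X" "tgt T (zero_mor T X Y) = Y"
proof -
  interpret G: comm_group "hom_group T X Y" using hom_comm_group assms .
  show "zero_mor T X Y \<in> arr T" "src T (zero_mor T X Y) = X" "tgt T (zero_mor T X Y) = Y"
    using G.one_closed by (simp_all add: homset_iff)
qed

lemma plus_arr [simp]:
  assumes "f \<in> arr T" "g \<in> arr T" "src T f = src T g" "tgt T f = tgt T g"
  shows "f \<boxplus> g \<in> arr T" "src T (f \<boxplus> g) = src T g" "tgt T (f \<boxplus> g) = tgt T g"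
proof -
  interpret G: comm_group "hom_group T (src T g) (tgt T g)" using hom_comm_group assms by simp
  show "f \<boxplus> g \<in> arr T" "src T (f \<boxplus> g) = src T g" "tgt T (f \<boxplus> g) = tgt T g"
    using G.m_closed[of f g] assms by (simp_all add: homset_iff)
qed

lemma neg_arr [simp]:
  assumes "f \<in> arr T"
  shows "neg_mor T f \<in> arr T" "src T (neg_mor T f) = src T f" "tgt T (neg_mor T f) = tgt T f"
    "f \<boxplus> neg_mor T f = zero_mor T (src T f) (tgt T f)"
    "neg_mor T f \<boxplus> f = zero_mor T (src T f) (tgt T f)"
proof -
  interpret G: comm_group "hom_group T (src T f) (tgt T f)" using hom_comm_group assms by simp
  show "neg_mor T f \<in> arr T" "src T (neg_mor T f) = src T f" "tgt T (neg_mor T f) = tgt T f"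
    "f \<boxplus> neg_mor T f = zero_mor T (src T f) (tgt T f)"
    "neg_mor T f \<boxplus> f = zero_mor T (src T f) (tgt T f)"
    using G.inv_closed[of f] G.r_inv[of f] G.l_inv[of f] assms
    by (simp_all add: homset_iff neg_mor_def)
qed

lemma plus_assoc:
  assumes "f \<in> homset T X Y" "g \<in> homset T X Y" "h \<in> homset T X Y"
  shows "(f \<boxplus> g) \<boxplus> h = f \<boxplus> (g \<boxplus> h)"
proof -
  interpret G: comm_group "hom_group T X Y" using hom_comm_group homset_objs[OF assms(1)] by simp
  show ?thesis using G.m_assoc[of f g h] assms by simp
qed

lemma plus_comm:
  assumes "f \<in> homset T X Y" "g \<in> homset T X Y"
  shows "f \<boxplus> g = g \<boxplus> f"
proof -
  interpret G: comm_group "hom_group T X Y" using hom_comm_group homset_objs[OF assms(1)] by simp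
  show ?thesis using G.m_comm[of f g] assms by simp
qed

lemma plus_zero [simp]:
  assumes "f \<in> arr T" "src T f = X" "tgt T f = Y"
  shows "f \<boxplus> zero_mor T X Y = f" "zero_mor T X Y \<boxplus> f = f"
proof -
  interpret G: comm_group "hom_group T X Y" using hom_comm_group assms by auto
  show "f \<boxplus> zero_mor T X Y = f" "zero_mor T X Y \<boxplus> f = f"
    using G.r_one[of f] G.l_one[of f] assms by (simp_all add: homset_iff)
qed

lemma plus_cancel:
  assumes "f \<in> homset T X Y" "g \<in> homset T X Y" "h \<in> homset T X Y" "f \<boxplus> h = g \<boxplus> h"
  shows "f = g"
proof -
  interpret G: comm_group "hom_group T X Y" using hom_comm_group homset_objs[OF assms(1)] by simp
  show ?thesis using G.right_cancel[of h f g] assms by simp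
qed

lemma zero_if_idem:
  assumes "f \<in> homset T X Y" "f \<boxplus> f = f"
  shows "f = zero_mor T X Y"
  using plus_cancel[of f X Y "zero_mor T X Y" f] assms homset_objs[OF assms(1)]
  by (simp add: homset_iff)

lemma after_plus_arr:
  "\<lbrakk>f \<in> arr T; f' \<in> arr T; src T f = src T f'; tgt T f = tgt T f'; g \<in> arr T; src T g = tgt T f'\<rbrakk>
    \<Longrightarrow> g \<cdot> (f \<boxplus> f') = (g \<cdot> f) \<boxplus> (g \<cdot> f')"
  using after_plus[of f "src T f" "tgt T f" f' g "tgt T g"] by (simp add: homset_iff)

lemma plus_after_arr:
  "\<lbrakk>f \<in> arr T; g \<in> arr T; g' \<in> arr T; src T g = tgt T f; src T g' = tgt T f; tgt T g = tgt T g'\<rbrakk>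
    \<Longrightarrow> (g \<boxplus> g') \<cdot> f = (g \<cdot> f) \<boxplus> (g' \<cdot> f)"
  using plus_after[of f "src T f" "tgt T f" g "tgt T g" g'] by (simp add: homset_iff)

lemma after_zero [simp]:
  assumes "g \<in> arr T" "X \<in> obj T" "src T g = Y"
  shows "g \<cdot> zero_mor T X Y = zero_mor T X (tgt T g)"
proof (rule zero_if_idem)
  have Y: "Y \<in> obj T" using assms by auto
  then show "g \<cdot> zero_mor T X Y \<in> homset T X (tgt T g)" using assms by (simp add: homset_iff)
  show "(g \<cdot> zero_mor T X Y) \<boxplus> (g \<cdot> zero_mor T X Y) = g \<cdot> zero_mor T X Y"
    using after_plus_arr[of "zero_mor T X Y" "zero_mor T X Y" g] assms Y by simp
qed

lemma zero_after [simp]: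
  assumes "f \<in> arr T" "Z \<in> obj T" "tgt T f = Y"
  shows "zero_mor T Y Z \<cdot> f = zero_mor T (src T f) Z"
proof (rule zero_if_idem)
  have Y: "Y \<in> obj T" using assms by auto
  then show "zero_mor T Y Z \<cdot> f \<in> homset T (src T f) Z" using assms by (simp add: homset_iff)
  show "(zero_mor T Y Z \<cdot> f) \<boxplus> (zero_mor T Y Z \<cdot> f) = zero_mor T Y Z \<cdot> f"
    using plus_after_arr[of f "zero_mor T Y Z" "zero_mor T Y Z"] assms Y by simp
qed

lemma neg_unique:
  assumes "f \<in> homset T X Y" "g \<in> homset T X Y" "f \<boxplus> g = zero_mor T X Y"
  shows "g = neg_mor T f"
proof (rule plus_cancel[of _ X Y _ f])
  show "g \<in> homset T X Y" "neg_mor T f \<in> homset T X Y" "f \<in> homset T X Y"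
    using assms by (simp_all add: homset_iff)
  show "g \<boxplus> f = neg_mor T f \<boxplus> f"
    using assms plus_comm[of f X Y g] by (simp add: homset_iff)
qed

lemma neg_after:
  assumes "f \<in> arr T" "g \<in> arr T" "src T g = tgt T f"
  shows "neg_mor T g \<cdot> f = neg_mor T (g \<cdot> f)" "g \<cdot> neg_mor T f = neg_mor T (g \<cdot> f)"
proof -
  show "neg_mor T g \<cdot> f = neg_mor T (g \<cdot> f)"
    by (rule neg_unique[of _ "src T f" "tgt T g"])
      (use assms plus_after_arr[of f g "neg_mor T g"] in \<open>simp_all add: homset_iff\<close>)
  show "g \<cdot> neg_mor T f = neg_mor T (g \<cdot> f)"
    by (rule neg_unique[of _ "src T f" "tgt T g"])
      (use assms after_plus_arr[of f "neg_mor T f" g] in \<open>simp_all add: homset_iff\<close>)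
qed

lemma neg_neg [simp]: "f \<in> arr T \<Longrightarrow> neg_mor T (neg_mor T f) = f"
  by (rule neg_unique[of _ "src T f" "tgt T f", symmetric]) (simp_all add: homset_iff)

lemma neg_zero [simp]: "\<lbrakk>X \<in> obj T; Y \<in> obj T\<rbrakk> \<Longrightarrow> neg_mor T (zero_mor T X Y) = zero_mor T X Y"
  by (rule neg_unique[of _ X Y, symmetric]) (simp_all add: homset_iff)

lemma eq_if_diff_zero:
  assumes "f \<in> homset T X Y" "g \<in> homset T X Y" "f \<boxplus> neg_mor T g = zero_mor T X Y"
  shows "f = g"
proof -
  have "neg_mor T g = neg_mor T f"
    using neg_unique[of f X Y "neg_mor T g"] assms by (simp add: homset_iff)
  then show ?thesis
    using neg_neg[of f] neg_neg[of g] assms by (metis homset_iff)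
qed

lemma diff_plus:
  assumes "f \<in> homset T X Y" "g \<in> homset T X Y"
  shows "(f \<boxplus> neg_mor T g) \<boxplus> g = f"
  using plus_assoc[of f X Y "neg_mor T g" g] assms by (simp add: homset_iff)

lemma zero_object_mor:
  assumes "zero_object T Z"
  shows "\<And>f. f \<in> arr T \<Longrightarrow> src T f = Z \<Longrightarrow> f = zero_mor T Z (tgt T f)"
    "\<And>f. f \<in> arr T \<Longrightarrow> tgt T f = Z \<Longrightarrow> f = zero_mor T (src T f) Z"
proof -
  have Z: "Z \<in> obj T" using assms by (simp add: zero_object_def)
  fix f assume f: "f \<in> arr T"
  show "f = zero_mor T Z (tgt T f)" if "src T f = Z"
  proof -
    have "\<exists>!k. k \<in> homset T Z (tgt T f)" using assms f by (simp add: zero_object_def)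
    then show ?thesis using f that Z by (metis homset_iff zero_arr tgt_in)
  qed
  show "f = zero_mor T (src T f) Z" if "tgt T f = Z"
  proof -
    have "\<exists>!k. k \<in> homset T (src T f) Z" using assms f by (simp add: zero_object_def)
    then show ?thesis using f that Z by (metis homset_iff zero_arr src_in)
  qed
qed

lemma zero_objectI:
  assumes "Z \<in> obj T" "ident T Z = zero_mor T Z Z"
  shows "zero_object T Z"
  unfolding zero_object_def
proof (intro conjI ballI)
  show "Z \<in> obj T" by fact
  fix Y assume Y: "Y \<in> obj T"
  show "\<exists>!f. f \<in> homset T Z Y"
  proof (rule ex1I[of _ "zero_mor T Z Y"])
    fix f assume "f \<in> homset T Z Y"
    then have "f = f \<cdot> ident T Z" by (simp add: homset_iff)
    also have "\<dots> = zero_mor T Z Y"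
      using \<open>f \<in> homset T Z Y\<close> assms by (simp add: homset_iff)
    finally show "f = zero_mor T Z Y" .
  qed (use Y assms in \<open>simp add: homset_iff\<close>)
  show "\<exists>!f. f \<in> homset T Y Z"
  proof (rule ex1I[of _ "zero_mor T Y Z"])
    fix f assume "f \<in> homset T Y Z"
    then have "f = ident T Z \<cdot> f" by (simp add: homset_iff)
    also have "\<dots> = zero_mor T Y Z"
      using \<open>f \<in> homset T Y Z\<close> assms by (simp add: homset_iff)
    finally show "f = zero_mor T Y Z" .
  qed (use Y assms in \<open>simp add: homset_iff\<close>)
qed

lemma zero_object_ident: "zero_object T Z \<Longrightarrow> ident T Z = zero_mor T Z Z"
  using zero_object_mor(1)[of Z "ident T Z"] by (simp add: zero_object_def)

end

section \<open>Triangles\<close>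

context additive_category
begin

lemma biproductE:
  assumes "X \<in> obj T" "Y \<in> obj T"
  obtains Z i j p q where "i \<in> homset T X Z" "j \<in> homset T Y Z" "p \<in> homset T Z X"
    "q \<in> homset T Z Y" "p \<cdot> i = ident T X" "q \<cdot> j = ident T Y" "q \<cdot> i = zero_mor T X Y"
    "p \<cdot> j = zero_mor T Y X" "(i \<cdot> p) \<boxplus> (j \<cdot> q) = ident T Z"
  using biproduct_exists[OF assms] unfolding is_biproduct_def by blast

end

context triangulated_category
begin

section \<open>Suspension as a full and faithful additive functor\<close>

lemma sh_in [simp]: "X \<in> obj T \<Longrightarrow> sh T X \<in> obj T"
  by (rule sh_obj)

lemma shm_arr [simp]:
  assumes "f \<in> arr T"
  shows "shm T f \<in> arr T" "src T (shm T f) = sh T (src T f)" "tgt T (shm T f) = sh T (tgt T f)"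
  using shm_hom[of f "src T f" "tgt T f"] assms by (simp_all add: homset_iff)

lemma shm_after_arr:
  "\<lbrakk>f \<in> arr T; g \<in> arr T; src T g = tgt T f\<rbrakk> \<Longrightarrow> shm T (g \<cdot> f) = shm T g \<cdot> shm T f"
  using shm_after[of f "src T f" "tgt T f" g "tgt T g"] by (simp add: homset_iff)

lemma shm_ident_arr [simp]: "X \<in> obj T \<Longrightarrow> shm T (ident T X) = ident T (sh T X)"
  by (rule shm_ident)

lemma shm_eq:
  assumes "f \<in> homset T X Y" "g \<in> homset T X Y" "shm T f = shm T g"
  shows "f = g"
  using shm_full_faithful[of X Y] assms homset_objs[OF assms(1)]
  by (auto simp: bij_betw_def inj_on_def)

lemma shm_ex:
  assumes "g \<in> homset T (sh T X) (sh T Y)" "X \<in> obj T" "Y \<in> obj T"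
  obtains f where "f \<in> homset T X Y" "shm T f = g"
proof -
  have "g \<in> shm T ` homset T X Y" using shm_full_faithful[of X Y] assms by (simp add: bij_betw_def)
  then show ?thesis using that by blast
qed

lemma shm_zero [simp]:
  assumes "X \<in> obj T" "Y \<in> obj T"
  shows "shm T (zero_mor T X Y) = zero_mor T (sh T X) (sh T Y)"
  using shm_plus[of "zero_mor T X Y" X Y "zero_mor T X Y"] assms
  by (intro zero_if_idem) (simp_all add: homset_iff)

lemma shm_isos:
  assumes "f \<in> isos T X Y"
  shows "shm T f \<in> isos T (sh T X) (sh T Y)"
proof (rule isosI[where g = "shm T (inv_mor T f)"])
  note a = isos_arr[OF assms]
  show "shm T f \<in> homset T (sh T X) (sh T Y)" "shm T (inv_mor T f) \<in> homset T (sh T Y) (sh T X)"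
    using a by (simp_all add: homset_iff)
  show "shm T (inv_mor T f) \<cdot> shm T f = ident T (sh T X)"
    "shm T f \<cdot> shm T (inv_mor T f) = ident T (sh T Y)"
    using a shm_after_arr[of f "inv_mor T f"] shm_after_arr[of "inv_mor T f" f] shm_ident_arr
    by (metis src_in tgt_in)+
qed

section \<open>Exact triangles: rotation, weak kernels, weak cokernels and fibres\<close>

lemma exact_arr:
  assumes "exact_triangle T X Y Z f g h"
  shows "f \<in> arr T" "src T f = X" "tgt T f = Y" "g \<in> arr T" "src T g = Y" "tgt T g = Z"
    "h \<in> arr T" "src T h = Z" "tgt T h = sh T X" "X \<in> obj T" "Y \<in> obj T" "Z \<in> obj T"
  using assms by (auto simp: exact_triangle_def candidate_triangle_def homset_iff)

lemma rotate:
  assumes "exact_triangle T X Y Z f g h"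
  shows "exact_triangle T Y Z (sh T X) g h (neg_mor T (shm T f))"
  using triangle_rotation[of X Y Z f g h] assms by (simp add: exact_triangle_def)

lemma zero_object_sh:
  assumes "zero_object T Z"
  shows "zero_object T (sh T Z)"
proof (rule zero_objectI)
  have Z: "Z \<in> obj T" using assms by (simp add: zero_object_def)
  then show "sh T Z \<in> obj T" by simp
  show "ident T (sh T Z) = zero_mor T (sh T Z) (sh T Z)"
    using zero_object_ident[OF assms] shm_ident[OF Z] shm_zero[OF Z Z] by simp
qed

text \<open>Comes from \<open>triangle_ident\<close> by one backward rotation; the third object of
  the rotated triangle is \<open>sh T Z\<close>, which is again zero.\<close>

lemma triangle_zero_ident:
  assumes "zero_object T Z" "X \<in> obj T"
  shows "exact_triangle T Z X X (zero_mor T Z X) (ident T X) (zero_mor T X (sh T Z))"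
proof -
  have Z: "Z \<in> obj T" using assms by (simp add: zero_object_def)
  have "exact_triangle T X X (sh T Z) (ident T X) (zero_mor T X (sh T Z))
      (neg_mor T (shm T (zero_mor T Z X)))"
    using triangle_ident[OF assms(2) zero_object_sh[OF assms(1)]] Z assms by simp
  then show ?thesis
    by (subst triangle_rotation)
      (use Z assms in \<open>simp_all add: candidate_triangle_def homset_iff\<close>)
qed

text \<open>A morphism of triangles from \<open>X \<rightarrow> X \<rightarrow> 0\<close> exhibits
  \<open>g \<cdot> f\<close> as a map through a zero object. The second equation is the first one
  for the rotated triangle.\<close>

lemma triangle_comp_zero:
  assumes t: "exact_triangle T X Y Z f g h"
  shows "g \<cdot> f = zero_mor T X Z" "h \<cdot> g = zero_mor T Y (sh T X)"
proof -
  have *: "g \<cdot> f = zero_mor T X Z" if t: "exact_triangle T X Y Z f g h" for X Y Z f g h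
  proof -
    note a = exact_arr[OF t]
    obtain Z0 where Z0: "zero_object T Z0" using zero_object_exists by blast
    have Z0': "Z0 \<in> obj T" using Z0 by (simp add: zero_object_def)
    obtain c where "c \<in> homset T Z0 Z" "c \<cdot> zero_mor T X Z0 = g \<cdot> f"
      using triangle_morphism[OF triangle_ident[OF \<open>X \<in> obj T\<close> Z0] t, of "ident T X" f] a
      by (auto simp: homset_iff)
    then show ?thesis using a Z0' by (simp add: homset_iff)
  qed
  show "g \<cdot> f = zero_mor T X Z" using * t .
  show "h \<cdot> g = zero_mor T Y (sh T X)" using *[OF rotate[OF t]] .
qed

text \<open>\<open>f\<close> is a weak kernel of \<open>g\<close>: the map \<open>u\<close> extends
  to a morphism from \<open>W \<rightarrow> 0 \<rightarrow> sh T W\<close> to the rotated triangle,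
  whose third component is the suspension of the lift.\<close>

lemma factor_first:
  assumes t: "exact_triangle T X Y Z f g h" and u: "u \<in> homset T W Y" "g \<cdot> u = zero_mor T W Z"
  obtains v where "v \<in> homset T W X" "u = f \<cdot> v"
proof -
  note a = exact_arr[OF t]
  have W: "W \<in> obj T" using u(1) homset_objs by blast
  obtain O0 where O0: "zero_object T O0" using zero_object_exists by blast
  have O0': "O0 \<in> obj T" using O0 by (simp add: zero_object_def)
  have t1: "exact_triangle T W O0 (sh T W) (zero_mor T W O0) (zero_mor T O0 (sh T W))
      (neg_mor T (shm T (ident T W)))"
    using rotate[OF triangle_ident[OF W O0]] .
  obtain c where c: "c \<in> homset T (sh T W) (sh T X)"
    "shm T u \<cdot> neg_mor T (shm T (ident T W)) = neg_mor T (shm T f) \<cdot> c"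
    using triangle_morphism[OF t1 rotate[OF t] u(1), of "zero_mor T O0 Z"] u a O0' W
    by (auto simp: homset_iff)
  \<comment> \<open>Rotation puts a minus sign on both sides, and the two signs cancel.\<close>
  have "neg_mor T (shm T u) = neg_mor T (shm T f \<cdot> c)"
    using c a u W neg_after(2)[of "shm T (ident T W)" "shm T u"] neg_after(1)[of c "shm T f"]
    by (simp add: homset_iff)
  then have c': "shm T u = shm T f \<cdot> c"
  proof -
    have "shm T u \<in> arr T" "shm T f \<cdot> c \<in> arr T" using c(1) a u(1) by (simp_all add: homset_iff)
    then show ?thesis
      using neg_neg[of "shm T u"] neg_neg[of "shm T f \<cdot> c"] \<open>neg_mor T (shm T u) = _\<close> by metis
  qed
  obtain v where v: "v \<in> homset T W X" "shm T v = c" using shm_ex[OF c(1)] W a by blast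
  have "u = f \<cdot> v"
    by (rule shm_eq[of _ W Y])
      (use c' v u a shm_after_arr[of v f] in \<open>auto simp: homset_iff\<close>)
  then show ?thesis using v that by blast
qed

text \<open>Dually, \<open>g\<close> is a weak cokernel of \<open>f\<close>, by comparison with the
  triangle \<open>0 \<rightarrow> W \<rightarrow> W\<close>.\<close>

lemma factor_last:
  assumes t: "exact_triangle T X Y Z f g h" and v: "v \<in> homset T Y W" "v \<cdot> f = zero_mor T X W"
  obtains w where "w \<in> homset T Z W" "v = w \<cdot> g"
proof -
  note a = exact_arr[OF t]
  have W: "W \<in> obj T" using v(1) homset_objs by blast
  obtain O0 where O0: "zero_object T O0" using zero_object_exists by blast
  have O0': "O0 \<in> obj T" using O0 by (simp add: zero_object_def)
  have "v \<cdot> f = zero_mor T O0 W \<cdot> zero_mor T X O0" using v(2) a(10) O0' W by simp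
  moreover have "zero_mor T X O0 \<in> homset T X O0" using a(10) O0' by (simp add: homset_iff)
  ultimately obtain c where c: "c \<in> homset T Z W" "c \<cdot> g = ident T W \<cdot> v"
    using triangle_morphism[OF t triangle_zero_ident[OF O0 W] _ v(1)] by blast
  have "ident T W \<cdot> v = v" using v(1) by (simp add: homset_iff)
  then show ?thesis using that[of c] c by simp
qed

text \<open>\<open>triangle_completion\<close> extends a map to the right only. The third object has
  to be desuspended, which is possible only up to an isomorphism \<open>b\<close>, and the triangle
  is transported along \<open>b\<close> before it is rotated back.\<close>

lemma fibre_exists:
  assumes f: "f \<in> homset T X Y"
  obtains W w k where "exact_triangle T W X Y w f k"
proof -
  obtain Z g h where t: "exact_triangle T X Y Z f g h" using triangle_completion[OF f] by blast
  note a = exact_arr[OF t]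
  obtain W b where W: "W \<in> obj T" and b: "b \<in> isos T (sh T W) Z"
    using sh_ess_surj[of Z] a by (auto simp: isomorphic_objs_def)
  note b' = isos_arr[OF b]
  \<comment> \<open>The sign cancels the one that \<open>triangle_rotation\<close> attaches to
    \<open>shm T w\<close>.\<close>
  obtain w where w: "w \<in> homset T W X" "shm T w = neg_mor T (h \<cdot> b)"
    by (rule shm_ex[of "neg_mor T (h \<cdot> b)" W X]) (use a b' W in \<open>auto simp: homset_iff\<close>)
  have n: "neg_mor T (shm T w) = h \<cdot> b" using w(2) a b' by simp
  have c: "candidate_triangle T X Y (sh T W) f (inv_mor T b \<cdot> g) (h \<cdot> b)"
    using a b' W by (simp add: candidate_triangle_def homset_iff)
  have "exact_triangle T X Y (sh T W) f (inv_mor T b \<cdot> g) (h \<cdot> b)"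
    by (rule triangle_iso[OF t c isos_ident isos_ident isos_inv[OF b]]) (use a b' in auto)
  then have "exact_triangle T W X Y w f (inv_mor T b \<cdot> g)"
    by (subst triangle_rotation)
      (use w n a b' W f in \<open>simp_all add: candidate_triangle_def homset_iff\<close>)
  then show ?thesis using that by blast
qed

end

section \<open>Coproducts and compact objects\<close>

context additive_category
begin

text \<open>The idempotent of \<open>S\<close> that keeps the summands in \<open>F\<close> and kills
  the others. It turns compactness into an equation
  \<open>coproj I X S \<iota> F \<cdot> m = m\<close> with \<open>F\<close> finite, which
  coproduct-preserving functors respect, in place of an isomorphism of sum groups.\<close>

definition coproj :: "'i set \<Rightarrow> ('i \<Rightarrow> 'o) \<Rightarrow> 'o \<Rightarrow> ('i \<Rightarrow> 'm) \<Rightarrow> 'i set \<Rightarrow> 'm" where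
  "coproj I X S \<iota> F =
    (THE g. g \<in> homset T S S \<and> (\<forall>i\<in>I. g \<cdot> \<iota> i = (if i \<in> F then \<iota> i else zero_mor T (X i) S)))"

lemma coproj:
  assumes "is_coproduct T I X S \<iota>"
  shows coproj_hom: "coproj I X S \<iota> F \<in> homset T S S"
    and coproj_inj: "i \<in> I \<Longrightarrow> coproj I X S \<iota> F \<cdot> \<iota> i = (if i \<in> F then \<iota> i else zero_mor T (X i) S)"
proof -
  note a = coproduct_arr[OF assms]
  have "\<exists>g. g \<in> homset T S S \<and> (\<forall>i\<in>I. g \<cdot> \<iota> i = (if i \<in> F then \<iota> i else zero_mor T (X i) S))"
    by (rule coproduct_ex[OF assms, of S "\<lambda>i. if i \<in> F then \<iota> i else zero_mor T (X i) S"])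
      (use a in \<open>auto simp: homset_iff\<close>)
  then have "\<exists>!g. g \<in> homset T S S \<and> (\<forall>i\<in>I. g \<cdot> \<iota> i = (if i \<in> F then \<iota> i else zero_mor T (X i) S))"
    using coproduct_eq[OF assms] by metis
  from theI'[OF this] show "coproj I X S \<iota> F \<in> homset T S S"
    "i \<in> I \<Longrightarrow> coproj I X S \<iota> F \<cdot> \<iota> i = (if i \<in> F then \<iota> i else zero_mor T (X i) S)"
    unfolding coproj_def by blast+
qed

lemma coproj_arr:
  assumes "is_coproduct T I X S \<iota>"
  shows "coproj I X S \<iota> F \<in> arr T" "src T (coproj I X S \<iota> F) = S" "tgt T (coproj I X S \<iota> F) = S"
  using coproj_hom[OF assms, of F] by (simp_all add: homset_iff)

lemma coproj_after:
  assumes "is_coproduct T I X S \<iota>"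
  shows "coproj I X S \<iota> F \<cdot> coproj I X S \<iota> G = coproj I X S \<iota> (F \<inter> G)"
proof (rule coproduct_eq[OF assms, of _ S])
  note a = coproduct_arr[OF assms] coproj_arr[OF assms]
  show "coproj I X S \<iota> F \<cdot> coproj I X S \<iota> G \<in> homset T S S" using a by (simp add: homset_iff)
  show "coproj I X S \<iota> (F \<inter> G) \<in> homset T S S" using coproj_hom[OF assms] .
  show "(coproj I X S \<iota> F \<cdot> coproj I X S \<iota> G) \<cdot> \<iota> i = coproj I X S \<iota> (F \<inter> G) \<cdot> \<iota> i"
    if "i \<in> I" for i
    using that a coproj_inj[OF assms that] by simp
qed

lemma coproj_mono:
  assumes "is_coproduct T I X S \<iota>" "m \<in> homset T C S" "coproj I X S \<iota> F \<cdot> m = m" "F \<subseteq> G"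
  shows "coproj I X S \<iota> G \<cdot> m = m"
proof -
  note a = coproj_arr[OF assms(1)]
  have "coproj I X S \<iota> G \<cdot> m = coproj I X S \<iota> G \<cdot> (coproj I X S \<iota> F \<cdot> m)" using assms by simp
  also have "\<dots> = (coproj I X S \<iota> G \<cdot> coproj I X S \<iota> F) \<cdot> m"
    using a assms(2) by (simp add: homset_iff)
  also have "\<dots> = m" using assms(3,4) coproj_after[OF assms(1), of G F] by (simp add: Int_absorb1)
  finally show ?thesis .
qed

lemma coproj_empty:
  assumes "is_coproduct T I X S \<iota>"
  shows "coproj I X S \<iota> {} = zero_mor T S S"
  by (rule coproduct_eq[OF assms, of _ S])
    (use coproduct_arr[OF assms] coproj_hom[OF assms] coproj_inj[OF assms]
     in \<open>auto simp: homset_iff\<close>)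

lemma coproj_insert:
  assumes "is_coproduct T I X S \<iota>" "j \<notin> F"
  shows "coproj I X S \<iota> (insert j F) = coproj I X S \<iota> {j} \<boxplus> coproj I X S \<iota> F"
proof (rule coproduct_eq[OF assms(1), of _ S])
  note a = coproduct_arr[OF assms(1)] coproj_arr[OF assms(1)]
  show "coproj I X S \<iota> (insert j F) \<in> homset T S S" using coproj_hom[OF assms(1)] .
  show "coproj I X S \<iota> {j} \<boxplus> coproj I X S \<iota> F \<in> homset T S S" using a by (simp add: homset_iff)
  show "coproj I X S \<iota> (insert j F) \<cdot> \<iota> i = (coproj I X S \<iota> {j} \<boxplus> coproj I X S \<iota> F) \<cdot> \<iota> i"
    if "i \<in> I" for i
    using that a plus_after_arr[of "\<iota> i" "coproj I X S \<iota> {j}" "coproj I X S \<iota> F"]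
      coproj_inj[OF assms(1) that] assms(2) by auto
qed

lemma coproduct_proj:
  assumes "is_coproduct T I X S \<iota>" "j \<in> I"
  obtains p where "p \<in> homset T S (X j)" "p \<cdot> \<iota> j = ident T (X j)"
    "\<And>i. i \<in> I \<Longrightarrow> i \<noteq> j \<Longrightarrow> p \<cdot> \<iota> i = zero_mor T (X i) (X j)" "\<iota> j \<cdot> p = coproj I X S \<iota> {j}"
proof -
  note a = coproduct_arr[OF assms(1)] coproj_arr[OF assms(1)]
  obtain p where p: "p \<in> homset T S (X j)"
    "\<And>i. i \<in> I \<Longrightarrow> p \<cdot> \<iota> i = (if i = j then ident T (X j) else zero_mor T (X i) (X j))"
    by (rule coproduct_ex[OF assms(1), of "X j"
          "\<lambda>i. if i = j then ident T (X j) else zero_mor T (X i) (X j)"])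
      (use a assms(2) in \<open>auto simp: homset_iff\<close>)
  have "\<iota> j \<cdot> p = coproj I X S \<iota> {j}"
  proof (rule coproduct_eq[OF assms(1), of _ S])
    show "\<iota> j \<cdot> p \<in> homset T S S" using a p assms(2) by (simp add: homset_iff)
    show "coproj I X S \<iota> {j} \<in> homset T S S" using coproj_hom[OF assms(1)] .
    show "(\<iota> j \<cdot> p) \<cdot> \<iota> i = coproj I X S \<iota> {j} \<cdot> \<iota> i" if "i \<in> I" for i
      using that a p assms(2) coproj_inj[OF assms(1) that] by (simp add: homset_iff)
  qed
  then show ?thesis using that[of p] p assms(2) by simp
qed

lemma after_finprod:
  assumes "finite A" "g \<in> homset T Y Z" "X \<in> obj T" "f \<in> A \<rightarrow> homset T X Y"
  shows "g \<cdot> finprod (hom_group T X Y) f A = finprod (hom_group T X Z) (\<lambda>i. g \<cdot> f i) A"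
  using assms(1,4)
proof (induction A)
  case empty
  have o: "Y \<in> obj T" "Z \<in> obj T" using homset_objs[OF assms(2)] by auto
  interpret G: comm_group "hom_group T X Y" using hom_comm_group o assms by simp
  interpret H: comm_group "hom_group T X Z" using hom_comm_group o assms by simp
  show ?case using assms G.finprod_empty H.finprod_empty by (simp add: homset_iff)
next
  case (insert a A)
  have o: "Y \<in> obj T" "Z \<in> obj T" using homset_objs[OF assms(2)] by auto
  interpret G: comm_group "hom_group T X Y" using hom_comm_group o assms by simp
  interpret H: comm_group "hom_group T X Z" using hom_comm_group o assms by simp
  have f: "f \<in> A \<rightarrow> homset T X Y" "f a \<in> homset T X Y" using insert.prems by auto
  then have gf: "(\<lambda>i. g \<cdot> f i) \<in> A \<rightarrow> homset T X Z" "g \<cdot> f a \<in> homset T X Z"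
    using assms(2) by (auto intro: after_hom)
  have "finprod (hom_group T X Y) f A \<in> homset T X Y"
    using G.finprod_closed[of f A] f by simp
  then show ?case
    using insert f gf assms(2) G.finprod_insert[of A a f] H.finprod_insert[of A a "\<lambda>i. g \<cdot> f i"]
      after_plus[of "f a" X Y "finprod (hom_group T X Y) f A" g Z] by simp
qed

lemma finprod_supp:
  assumes "X \<in> obj T" "Y \<in> obj T" "finite B" "A \<subseteq> B" "f \<in> B \<rightarrow> homset T X Y"
    "\<And>i. i \<in> B - A \<Longrightarrow> f i = zero_mor T X Y"
  shows "finprod (hom_group T X Y) f A = finprod (hom_group T X Y) f B"
proof -
  interpret G: comm_group "hom_group T X Y" using hom_comm_group assms by simp
  show ?thesis
    by (rule G.finprod_mono_neutral_cong_left) (use assms in auto)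
qed

lemma coproj_finite_sum:
  assumes "is_coproduct T I X S \<iota>" "m \<in> homset T C S" "finite F" "F \<subseteq> I"
    "\<And>i. i \<in> I \<Longrightarrow> p i \<in> homset T S (X i)" "\<And>i. i \<in> I \<Longrightarrow> \<iota> i \<cdot> p i = coproj I X S \<iota> {i}"
  shows "coproj I X S \<iota> F \<cdot> m = finprod (hom_group T C S) (\<lambda>i. \<iota> i \<cdot> (p i \<cdot> m)) F"
  using assms(3,4)
proof (induction F)
  case empty
  have S: "S \<in> obj T" and C: "C \<in> obj T" using assms(2) homset_objs by blast+
  interpret G: comm_group "hom_group T C S" using hom_comm_group[OF C S] .
  show ?case
    using assms(2) coproj_empty[OF assms(1)] S G.finprod_empty by (simp add: homset_iff)
next
  case (insert j F)
  note a = coproduct_arr[OF assms(1)] coproj_arr[OF assms(1)]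
  have C: "C \<in> obj T" using assms(2) homset_objs by blast
  interpret G: comm_group "hom_group T C S" using hom_comm_group[OF C a(1)] .
  have f: "(\<lambda>i. \<iota> i \<cdot> (p i \<cdot> m)) \<in> I \<rightarrow> homset T C S"
    using a assms(2,5) by (auto simp: homset_iff)
  have "coproj I X S \<iota> (insert j F) \<cdot> m = (coproj I X S \<iota> {j} \<cdot> m) \<boxplus> (coproj I X S \<iota> F \<cdot> m)"
    using coproj_insert[OF assms(1) insert.hyps(2)] assms(2) a
      plus_after_arr[of m "coproj I X S \<iota> {j}" "coproj I X S \<iota> F"] by (simp add: homset_iff)
  also have "coproj I X S \<iota> {j} \<cdot> m = \<iota> j \<cdot> (p j \<cdot> m)"
    using assms(6)[of j, symmetric] insert.prems a assms(2,5) by (simp add: homset_iff)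
  finally show ?case
    using insert f G.finprod_insert[of F j "\<lambda>i. \<iota> i \<cdot> (p i \<cdot> m)"] by fastforce
qed

text \<open>A preimage of \<open>m\<close> under the canonical map has finite support, and the
  projection onto that support fixes \<open>m\<close>.\<close>

lemma compact_factors:
  assumes "C \<in> compact_objs \<kappa> T" "small_index \<kappa> I" "is_coproduct T I X S \<iota>" "m \<in> homset T C S"
  obtains F where "finite F" "F \<subseteq> I" "coproj I X S \<iota> F \<cdot> m = m"
proof -
  note a = coproduct_arr[OF assms(3)] coproj_arr[OF assms(3)]
  let ?\<phi> = "\<lambda>f. finprod (hom_group T C S) (\<lambda>i. \<iota> i \<cdot> f i) {i \<in> I. f i \<noteq> zero_mor T C (X i)}"
  have C: "C \<in> obj T" using assms(1) by (simp add: compact_objs_def)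
  have "?\<phi> \<in> iso (sum_group I (\<lambda>i. hom_group T C (X i))) (hom_group T C S)"
    using assms(1,2,3) a unfolding compact_objs_def by blast
  then have "m \<in> ?\<phi> ` carrier (sum_group I (\<lambda>i. hom_group T C (X i)))"
    using assms(4) by (simp add: iso_def bij_betw_def)
  then obtain f where f: "f \<in> carrier (sum_group I (\<lambda>i. hom_group T C (X i)))" "m = ?\<phi> f" by blast
  let ?F = "{i \<in> I. f i \<noteq> zero_mor T C (X i)}"
  have grp: "\<And>i. i \<in> I \<Longrightarrow> group (hom_group T C (X i))"
    using hom_comm_group[OF C] a by (simp add: comm_group_def)
  have fin: "finite ?F" and fi: "\<And>i. i \<in> I \<Longrightarrow> f i \<in> homset T C (X i)"
    using f(1) by (auto simp: carrier_sum_group[OF grp])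
  have fi': "(\<lambda>i. \<iota> i \<cdot> f i) \<in> ?F \<rightarrow> homset T C S" using fi a by (auto simp: homset_iff)
  interpret G: comm_group "hom_group T C S" using hom_comm_group[OF C a(1)] .
  have "coproj I X S \<iota> ?F \<cdot> ?\<phi> f
      = finprod (hom_group T C S) (\<lambda>i. coproj I X S \<iota> ?F \<cdot> (\<iota> i \<cdot> f i)) ?F"
    by (rule after_finprod[OF fin coproj_hom[OF assms(3)] C fi'])
  also have "\<dots> = ?\<phi> f"
  proof (rule G.finprod_cong')
    show "?F = ?F" ..
    show "(\<lambda>i. \<iota> i \<cdot> f i) \<in> ?F \<rightarrow> carrier (hom_group T C S)" using fi' by simp
    fix i assume "i \<in> ?F"
    then show "coproj I X S \<iota> ?F \<cdot> (\<iota> i \<cdot> f i) = \<iota> i \<cdot> f i"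
      using fi a coproj_inj[OF assms(3), of i ?F]
        after_assoc_arr[of "f i" "\<iota> i" "coproj I X S \<iota> ?F"] by (simp add: homset_iff)
  qed
  finally have "coproj I X S \<iota> ?F \<cdot> m = m" using f(2) by simp
  with fin show ?thesis using that by blast
qed

text \<open>The criterion yields surjectivity of the canonical map. Injectivity holds for every
  object, since the projections \<open>p j\<close> recover the components of a family from its
  sum.\<close>

lemma compactI:
  assumes "C \<in> obj T"
    and factor: "\<And>I X S \<iota> m. \<lbrakk>small_index \<kappa> I; is_coproduct T I X S \<iota>; m \<in> homset T C S\<rbrakk>
      \<Longrightarrow> \<exists>F. finite F \<and> F \<subseteq> I \<and> coproj I X S \<iota> F \<cdot> m = m"
  shows "C \<in> compact_objs \<kappa> T"
  unfolding compact_objs_def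
proof (intro CollectI conjI allI impI)
  show "C \<in> obj T" by fact
  fix I X S \<iota>
  assume asm: "small_index \<kappa> I \<and> (\<forall>i\<in>I. X i \<in> obj T) \<and> is_coproduct T I X S \<iota>"
  then have cop: "is_coproduct T I X S \<iota>" by blast
  note a = coproduct_arr[OF cop]
  let ?\<phi> = "\<lambda>f. finprod (hom_group T C S) (\<lambda>i. \<iota> i \<cdot> f i) {i \<in> I. f i \<noteq> zero_mor T C (X i)}"
  let ?D = "sum_group I (\<lambda>i. hom_group T C (X i))"
  have cg: "\<And>i. i \<in> I \<Longrightarrow> comm_group (hom_group T C (X i))"
    using hom_comm_group[OF assms(1)] a by simp
  then have grp: "\<And>i. i \<in> I \<Longrightarrow> group (hom_group T C (X i))" by (simp add: comm_group_def)
  interpret G: comm_group "hom_group T C S" using hom_comm_group[OF assms(1) a(1)] .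
  define p where "p j = (SOME p. p \<in> homset T S (X j) \<and> p \<cdot> \<iota> j = ident T (X j) \<and>
    (\<forall>i\<in>I. i \<noteq> j \<longrightarrow> p \<cdot> \<iota> i = zero_mor T (X i) (X j)) \<and> \<iota> j \<cdot> p = coproj I X S \<iota> {j})" for j
  have p: "p j \<in> homset T S (X j) \<and> p j \<cdot> \<iota> j = ident T (X j) \<and>
    (\<forall>i\<in>I. i \<noteq> j \<longrightarrow> p j \<cdot> \<iota> i = zero_mor T (X i) (X j)) \<and> \<iota> j \<cdot> p j = coproj I X S \<iota> {j}"
    if j: "j \<in> I" for j
  proof -
    have "\<exists>p. p \<in> homset T S (X j) \<and> p \<cdot> \<iota> j = ident T (X j) \<and>
      (\<forall>i\<in>I. i \<noteq> j \<longrightarrow> p \<cdot> \<iota> i = zero_mor T (X i) (X j)) \<and> \<iota> j \<cdot> p = coproj I X S \<iota> {j}"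
      by (rule coproduct_proj[OF cop j]) blast
    then show ?thesis unfolding p_def by (rule someI_ex)
  qed
  have D: "f \<in> carrier ?D \<longleftrightarrow> f \<in> extensional I \<and> (\<forall>i\<in>I. f i \<in> homset T C (X i)) \<and>
      finite {i \<in> I. f i \<noteq> zero_mor T C (X i)}" for f
    by (auto simp: carrier_sum_group[OF grp] PiE_iff)
  have hom: "(\<lambda>i. \<iota> i \<cdot> f i) \<in> I \<rightarrow> homset T C S" if "f \<in> carrier ?D" for f
    using that a unfolding D by (auto simp: homset_iff)
  have supp: "?\<phi> f = finprod (hom_group T C S) (\<lambda>i. \<iota> i \<cdot> f i) B"
    if "f \<in> carrier ?D" "finite B" "B \<subseteq> I" "{i \<in> I. f i \<noteq> zero_mor T C (X i)} \<subseteq> B" for f B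
    by (rule finprod_supp[OF assms(1) a(1) that(2,4)])
      (use hom[OF that(1)] that a assms(1) in \<open>auto\<close>)
  have coord: "p j \<cdot> ?\<phi> f = f j" if f: "f \<in> carrier ?D" and j: "j \<in> I" for f j
  proof -
    interpret H: comm_group "hom_group T C (X j)" using cg[OF j] .
    \<comment> \<open>The index \<open>j\<close> is added so that its term occurs in the sum even
      when \<open>f j\<close> is zero.\<close>
    let ?B = "insert j {i \<in> I. f i \<noteq> zero_mor T C (X i)}"
    have fin: "finite ?B" and B: "?B \<subseteq> I" using f j unfolding D by auto
    have f': "\<And>i. i \<in> I \<Longrightarrow> f i \<in> homset T C (X i)" using f unfolding D by blast
    have "p j \<cdot> ?\<phi> f = p j \<cdot> finprod (hom_group T C S) (\<lambda>i. \<iota> i \<cdot> f i) ?B"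
      using supp[OF f fin B subset_insertI] by simp
    also have "\<dots> = finprod (hom_group T C (X j)) (\<lambda>i. p j \<cdot> (\<iota> i \<cdot> f i)) ?B"
      by (rule after_finprod[OF fin _ assms(1)]) (use p[OF j] hom[OF f] B in auto)
    also have "\<dots> = finprod (hom_group T C (X j)) (\<lambda>i. if j = i then f j else \<one>\<^bsub>hom_group T C (X j)\<^esub>) ?B"
    proof (rule H.finprod_cong')
      show "?B = ?B" ..
      show "(\<lambda>i. if j = i then f j else \<one>\<^bsub>hom_group T C (X j)\<^esub>) \<in> ?B \<rightarrow> carrier (hom_group T C (X j))"
        using f' j a assms(1) by (auto simp: homset_iff)
      fix i assume "i \<in> ?B"
      then have i: "i \<in> I" using B by blast
      have *: "p j \<cdot> (\<iota> i \<cdot> f i) = (p j \<cdot> \<iota> i) \<cdot> f i"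
        using p[OF j] f'[OF i] a i by (simp add: homset_iff)
      then show "p j \<cdot> (\<iota> i \<cdot> f i) = (if j = i then f j else \<one>\<^bsub>hom_group T C (X j)\<^esub>)"
      proof (cases "i = j")
        case True
        then show ?thesis using * p[OF j] f'[OF i] by (simp add: homset_iff)
      next
        case False
        then have "p j \<cdot> \<iota> i = zero_mor T (X i) (X j)" using p[OF j] i by blast
        then show ?thesis using * False f'[OF i] a(5)[OF j] by (simp add: homset_iff)
      qed
    qed
    also have "\<dots> = f j"
      by (rule H.finprod_singleton[OF _ fin, of j "\<lambda>_. f j"]) (use f' j a assms(1) in \<open>auto\<close>)
    finally show ?thesis .
  qed
  show "?\<phi> \<in> iso ?D (hom_group T C S)"
  proof (rule isoI)
    show "?\<phi> \<in> hom ?D (hom_group T C S)"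
    proof (rule homI)
      show "?\<phi> f \<in> carrier (hom_group T C S)" if "f \<in> carrier ?D" for f
        by (rule G.finprod_closed) (use hom[OF that] in auto)
      fix f g assume f: "f \<in> carrier ?D" and g: "g \<in> carrier ?D"
      have fg: "f \<otimes>\<^bsub>?D\<^esub> g \<in> carrier ?D"
        using group.is_monoid[OF sum_group[of I "\<lambda>i. hom_group T C (X i)"]] grp f g
        by (meson monoid.m_closed)
      \<comment> \<open>One finite set containing the supports of \<open>f\<close>, of
        \<open>g\<close> and of their product lets the three sums be compared term by term.\<close>
      let ?B = "{i \<in> I. f i \<noteq> zero_mor T C (X i)} \<union> {i \<in> I. g i \<noteq> zero_mor T C (X i)}
        \<union> {i \<in> I. (f \<otimes>\<^bsub>?D\<^esub> g) i \<noteq> zero_mor T C (X i)}"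
      have B: "finite ?B" "?B \<subseteq> I" using f g fg unfolding D by auto
      have "?\<phi> (f \<otimes>\<^bsub>?D\<^esub> g) = finprod (hom_group T C S) (\<lambda>i. \<iota> i \<cdot> (f \<otimes>\<^bsub>?D\<^esub> g) i) ?B"
        by (rule supp[OF fg B]) blast
      also have "\<dots> = finprod (hom_group T C S) (\<lambda>i. (\<iota> i \<cdot> f i) \<otimes>\<^bsub>hom_group T C S\<^esub> (\<iota> i \<cdot> g i)) ?B"
      proof (rule G.finprod_cong')
        show "?B = ?B" ..
        show "(\<lambda>i. (\<iota> i \<cdot> f i) \<otimes>\<^bsub>hom_group T C S\<^esub> (\<iota> i \<cdot> g i)) \<in> ?B \<rightarrow> carrier (hom_group T C S)"
          using hom[OF f] hom[OF g] G.m_closed by fastforce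
        fix i assume "i \<in> ?B"
        then have i: "i \<in> I" by blast
        then have "(f \<otimes>\<^bsub>?D\<^esub> g) i = f i \<boxplus> g i" by simp
        then show "\<iota> i \<cdot> (f \<otimes>\<^bsub>?D\<^esub> g) i = (\<iota> i \<cdot> f i) \<otimes>\<^bsub>hom_group T C S\<^esub> (\<iota> i \<cdot> g i)"
          using i f g a after_plus[of "f i" C "X i" "g i" "\<iota> i" S] unfolding D
          by (simp add: homset_iff)
      qed
      also have "\<dots> = finprod (hom_group T C S) (\<lambda>i. \<iota> i \<cdot> f i) ?B
          \<otimes>\<^bsub>hom_group T C S\<^esub> finprod (hom_group T C S) (\<lambda>i. \<iota> i \<cdot> g i) ?B"
        by (rule G.finprod_multf) (use hom[OF f] hom[OF g] in auto)
      also have "finprod (hom_group T C S) (\<lambda>i. \<iota> i \<cdot> f i) ?B = ?\<phi> f"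
        by (rule supp[OF f B, symmetric]) blast
      also have "finprod (hom_group T C S) (\<lambda>i. \<iota> i \<cdot> g i) ?B = ?\<phi> g"
        by (rule supp[OF g B, symmetric]) blast
      finally show "?\<phi> (f \<otimes>\<^bsub>?D\<^esub> g) = ?\<phi> f \<otimes>\<^bsub>hom_group T C S\<^esub> ?\<phi> g" .
    qed
    show "bij_betw ?\<phi> (carrier ?D) (carrier (hom_group T C S))"
      unfolding bij_betw_def
    proof
      show "inj_on ?\<phi> (carrier ?D)"
      proof (rule inj_onI)
        fix f g assume f: "f \<in> carrier ?D" and g: "g \<in> carrier ?D" and eq: "?\<phi> f = ?\<phi> g"
        show "f = g"
        proof (rule extensionalityI)
          show "f \<in> extensional I" "g \<in> extensional I" using f g unfolding D by auto
          show "f j = g j" if j: "j \<in> I" for j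
            using coord[OF f j] coord[OF g j] eq by simp
        qed
      qed
      show "?\<phi> ` carrier ?D = carrier (hom_group T C S)"
      proof
        show "?\<phi> ` carrier ?D \<subseteq> carrier (hom_group T C S)"
          using hom G.finprod_closed[of "\<lambda>i. \<iota> i \<cdot> _ i"] by (fastforce intro!: G.finprod_closed)
        show "carrier (hom_group T C S) \<subseteq> ?\<phi> ` carrier ?D"
        proof
          fix m assume "m \<in> carrier (hom_group T C S)"
          then have m: "m \<in> homset T C S" by simp
          obtain F where F: "finite F" "F \<subseteq> I" "coproj I X S \<iota> F \<cdot> m = m"
            using factor[OF _ cop m] asm by blast
          \<comment> \<open>The preimage of \<open>m\<close> has the coordinates of \<open>m\<close>
            on \<open>F\<close> and zero elsewhere; the restricted abstraction makes it extensional,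
            as elements of \<open>sum_group\<close> must be.\<close>
          define f where "f = (\<lambda>i\<in>I. if i \<in> F then p i \<cdot> m else zero_mor T C (X i))"
          have sub: "{i \<in> I. f i \<noteq> zero_mor T C (X i)} \<subseteq> F" by (auto simp: f_def)
          have "f i \<in> homset T C (X i)" if "i \<in> I" for i
            using that p[OF that] m a assms(1) by (auto simp: f_def homset_iff)
          then have fD: "f \<in> carrier ?D"
            unfolding D using finite_subset[OF sub F(1)] by (auto simp: f_def)
          have "?\<phi> f = finprod (hom_group T C S) (\<lambda>i. \<iota> i \<cdot> f i) F" by (rule supp[OF fD F(1,2) sub])
          also have "\<dots> = finprod (hom_group T C S) (\<lambda>i. \<iota> i \<cdot> (p i \<cdot> m)) F"
            by (rule G.finprod_cong')
              (use F p m a in \<open>auto simp: f_def homset_iff subset_iff simp_implies_def\<close>)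
          also have "\<dots> = coproj I X S \<iota> F \<cdot> m"
            by (rule coproj_finite_sum[OF cop m F(1,2), symmetric]) (use p in auto)
          finally show "m \<in> ?\<phi> ` carrier ?D" using F(3) fD by (metis (no_types, lifting) imageI)
        qed
      qed
    qed
  qed
qed

end

section \<open>Recognition of coproducts and transport along isomorphisms\<close>

context category
begin

lemma coproductI:
  assumes "S \<in> obj T" "\<And>i. i \<in> I \<Longrightarrow> \<iota> i \<in> homset T (X i) S"
    and ex: "\<And>Y f. \<lbrakk>Y \<in> obj T; \<And>i. i \<in> I \<Longrightarrow> f i \<in> homset T (X i) Y\<rbrakk>
      \<Longrightarrow> \<exists>g. g \<in> homset T S Y \<and> (\<forall>i\<in>I. g \<cdot> \<iota> i = f i)"
    and uniq: "\<And>Y g h. \<lbrakk>g \<in> homset T S Y; h \<in> homset T S Y; \<And>i. i \<in> I \<Longrightarrow> g \<cdot> \<iota> i = h \<cdot> \<iota> i\<rbrakk>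
      \<Longrightarrow> g = h"
  shows "is_coproduct T I X S \<iota>"
  unfolding is_coproduct_def
proof (intro conjI ballI allI impI)
  fix Y f assume Y: "Y \<in> obj T" and f: "\<forall>i\<in>I. f i \<in> homset T (X i) Y"
  obtain g where g: "g \<in> homset T S Y \<and> (\<forall>i\<in>I. g \<cdot> \<iota> i = f i)" using ex[OF Y, of f] f by blast
  then show "\<exists>!g. g \<in> homset T S Y \<and> (\<forall>i\<in>I. g \<cdot> \<iota> i = f i)"
    using uniq[of g Y] by (intro ex1I[of _ g]) auto
qed (use assms in auto)

lemma coproduct_cong:
  assumes "is_coproduct T I X S \<iota>" "\<And>i. i \<in> I \<Longrightarrow> \<kappa> i = \<iota> i"
  shows "is_coproduct T I X S \<kappa>"
  using assms unfolding is_coproduct_def by simp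

text \<open>Needed because desuspended families, and families with exchanged tensor factors, agree
  with the original ones only up to isomorphism.\<close>

lemma coproduct_iso:
  assumes "is_coproduct T I X S \<iota>" "\<And>i. i \<in> I \<Longrightarrow> a i \<in> isos T (Y i) (X i)" "b \<in> isos T S R"
  shows "is_coproduct T I Y R (\<lambda>i. b \<cdot> (\<iota> i \<cdot> a i))"
proof (rule coproductI)
  note s = coproduct_arr[OF assms(1)] isos_arr[OF assms(3)]
  note a = isos_arr[OF assms(2)]
  show "R \<in> obj T" using s by auto
  show "b \<cdot> (\<iota> i \<cdot> a i) \<in> homset T (Y i) R" if "i \<in> I" for i
    using s a that by (simp add: homset_iff)
next
  note s = coproduct_arr[OF assms(1)] isos_arr[OF assms(3)]
  note a = isos_arr[OF assms(2)]
  fix Z f assume Z: "Z \<in> obj T" and f: "\<And>i. i \<in> I \<Longrightarrow> f i \<in> homset T (Y i) Z"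
  obtain g where g: "g \<in> homset T S Z" "\<And>i. i \<in> I \<Longrightarrow> g \<cdot> \<iota> i = f i \<cdot> inv_mor T (a i)"
    by (rule coproduct_ex[OF assms(1) Z, of "\<lambda>i. f i \<cdot> inv_mor T (a i)"])
      (use f a in \<open>auto simp: homset_iff\<close>)
  have "(g \<cdot> inv_mor T b) \<cdot> (b \<cdot> (\<iota> i \<cdot> a i)) = f i" if i: "i \<in> I" for i
  proof -
    have "(g \<cdot> inv_mor T b) \<cdot> (b \<cdot> (\<iota> i \<cdot> a i)) = (g \<cdot> \<iota> i) \<cdot> a i"
      using g(1) s i a[OF i] isos_cancel(1)[OF assms(3), of "\<iota> i \<cdot> a i"] by (simp add: homset_iff)
    also have "\<dots> = f i" using g(2)[OF i] f[OF i] a[OF i] by (simp add: homset_iff)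
    finally show ?thesis .
  qed
  then show "\<exists>g. g \<in> homset T R Z \<and> (\<forall>i\<in>I. g \<cdot> (b \<cdot> (\<iota> i \<cdot> a i)) = f i)"
    using g s by (intro exI[of _ "g \<cdot> inv_mor T b"]) (auto simp: homset_iff)
next
  note s = coproduct_arr[OF assms(1)] isos_arr[OF assms(3)]
  note a = isos_arr[OF assms(2)]
  fix Z g h assume g: "g \<in> homset T R Z" and h: "h \<in> homset T R Z"
    and eq: "\<And>i. i \<in> I \<Longrightarrow> g \<cdot> (b \<cdot> (\<iota> i \<cdot> a i)) = h \<cdot> (b \<cdot> (\<iota> i \<cdot> a i))"
  have "g \<cdot> b = h \<cdot> b"
  proof (rule coproduct_eq[OF assms(1), of _ Z])
    show "g \<cdot> b \<in> homset T S Z" "h \<cdot> b \<in> homset T S Z" using g h s by (simp_all add: homset_iff)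
    fix i assume i: "i \<in> I"
    show "(g \<cdot> b) \<cdot> \<iota> i = (h \<cdot> b) \<cdot> \<iota> i"
      by (rule isos_epi[OF assms(2)[OF i]])
        (use eq[OF i] g h s i a[OF i] in \<open>simp_all add: homset_iff\<close>)
  qed
  then show "g = h" using isos_epi[OF assms(3), of g h] g h by (simp add: homset_iff)
qed

end

section \<open>Compactness of isomorphic objects and of biproducts\<close>

context additive_category
begin

lemma coproj_unique:
  assumes "is_coproduct T I X S \<iota>" "g \<in> homset T S S"
    "\<And>i. i \<in> I \<Longrightarrow> g \<cdot> \<iota> i = (if i \<in> F then \<iota> i else zero_mor T (X i) S)"
  shows "g = coproj I X S \<iota> F"
  by (rule coproduct_eq[OF assms(1,2) coproj_hom[OF assms(1)]])
    (use assms coproj_inj[OF assms(1)] in simp)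

lemma compact_iso:
  assumes "C \<in> compact_objs \<kappa> T" "a \<in> isos T C D"
  shows "D \<in> compact_objs \<kappa> T"
proof (rule compactI)
  note a = isos_arr[OF assms(2)]
  show "D \<in> obj T" using a by auto
  fix I X S \<iota> m
  assume sm: "small_index \<kappa> I" and cop: "is_coproduct T I X S \<iota>" and m: "m \<in> homset T D S"
  obtain F where F: "finite F" "F \<subseteq> I" "coproj I X S \<iota> F \<cdot> (m \<cdot> a) = m \<cdot> a"
    by (rule compact_factors[OF assms(1) sm cop, of "m \<cdot> a"]) (use m a in \<open>auto simp: homset_iff\<close>)
  have "coproj I X S \<iota> F \<cdot> m = m"
    by (rule isos_epi[OF assms(2)])
      (use F(3) m a coproj_arr[OF cop] in \<open>simp_all add: homset_iff\<close>)
  with F show "\<exists>F. finite F \<and> F \<subseteq> I \<and> coproj I X S \<iota> F \<cdot> m = m" by blast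
qed

text \<open>A map out of \<open>Z\<close> is the sum of its restrictions along \<open>i\<close> and
  \<open>j\<close>, composed with \<open>p\<close> and \<open>q\<close>; the union of two finite
  supports serves both.\<close>

lemma compact_biproduct:
  assumes "C \<in> compact_objs \<kappa> T" "D \<in> compact_objs \<kappa> T" "i \<in> homset T C Z" "j \<in> homset T D Z"
    "p \<in> homset T Z C" "q \<in> homset T Z D" "(i \<cdot> p) \<boxplus> (j \<cdot> q) = ident T Z"
  shows "Z \<in> compact_objs \<kappa> T"
proof (rule compactI)
  show Z: "Z \<in> obj T" using assms(3) homset_objs by blast
  fix I X S \<iota> m
  assume sm: "small_index \<kappa> I" and cop: "is_coproduct T I X S \<iota>" and m: "m \<in> homset T Z S"
  have mi: "m \<cdot> i \<in> homset T C S" and mj: "m \<cdot> j \<in> homset T D S"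
    using m assms by (simp_all add: homset_iff)
  obtain F where F: "finite F" "F \<subseteq> I" "coproj I X S \<iota> F \<cdot> (m \<cdot> i) = m \<cdot> i"
    by (rule compact_factors[OF assms(1) sm cop mi])
  obtain G where G: "finite G" "G \<subseteq> I" "coproj I X S \<iota> G \<cdot> (m \<cdot> j) = m \<cdot> j"
    by (rule compact_factors[OF assms(2) sm cop mj])
  let ?e = "coproj I X S \<iota> (F \<union> G)"
  have e: "?e \<cdot> (m \<cdot> i) = m \<cdot> i" "?e \<cdot> (m \<cdot> j) = m \<cdot> j"
    using coproj_mono[OF cop mi F(3), of "F \<union> G"] coproj_mono[OF cop mj G(3), of "F \<union> G"] by auto
  note a = coproj_arr[OF cop]
  have *: "n = ((n \<cdot> i) \<cdot> p) \<boxplus> ((n \<cdot> j) \<cdot> q)" if "n \<in> homset T Z S" for n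
  proof -
    have "n \<cdot> ((i \<cdot> p) \<boxplus> (j \<cdot> q)) = (n \<cdot> (i \<cdot> p)) \<boxplus> (n \<cdot> (j \<cdot> q))"
      by (rule after_plus_arr) (use assms that in \<open>simp_all add: homset_iff\<close>)
    then show ?thesis using assms that by (simp add: homset_iff)
  qed
  have em: "?e \<cdot> m \<in> homset T Z S" using m a by (simp add: homset_iff)
  have "?e \<cdot> m = (((?e \<cdot> m) \<cdot> i) \<cdot> p) \<boxplus> (((?e \<cdot> m) \<cdot> j) \<cdot> q)" using *[OF em] .
  also have "(?e \<cdot> m) \<cdot> i = m \<cdot> i" using e m a assms by (simp add: homset_iff)
  also have "(?e \<cdot> m) \<cdot> j = m \<cdot> j" using e m a assms by (simp add: homset_iff)
  finally have "?e \<cdot> m = m" using *[OF m] by simp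
  then show "\<exists>F. finite F \<and> F \<subseteq> I \<and> coproj I X S \<iota> F \<cdot> m = m"
    using F G by (intro exI[of _ "F \<union> G"]) auto
qed

end

section \<open>Compact objects as a triangulated subcategory\<close>

context triangulated_category
begin

lemma desuspend_obj:
  assumes "Y \<in> obj T"
  obtains X b where "X \<in> obj T" "b \<in> isos T (sh T X) Y"
  using sh_ess_surj[OF assms] by (auto simp: isomorphic_objs_def)

text \<open>Suspension is an equivalence, though not a strict one: a target \<open>Y\<close> is
  replaced by \<open>sh T Y'\<close> along an isomorphism \<open>c\<close>, and then fullness and
  faithfulness apply.\<close>

lemma coproduct_sh:
  assumes "is_coproduct T I X S \<iota>"
  shows "is_coproduct T I (\<lambda>i. sh T (X i)) (sh T S) (\<lambda>i. shm T (\<iota> i))"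
proof (rule coproductI)
  note a = coproduct_arr[OF assms]
  show "sh T S \<in> obj T" using a by simp
  show "shm T (\<iota> i) \<in> homset T (sh T (X i)) (sh T S)" if "i \<in> I" for i
    using a that by (simp add: homset_iff)
next
  note a = coproduct_arr[OF assms]
  fix Y f assume Y: "Y \<in> obj T" and f: "\<And>i. i \<in> I \<Longrightarrow> f i \<in> homset T (sh T (X i)) Y"
  obtain Y' c where Y': "Y' \<in> obj T" and c: "c \<in> isos T (sh T Y') Y"
    by (rule desuspend_obj[OF Y])
  note c' = isos_arr[OF c]
  have "\<exists>f'. f' \<in> homset T (X i) Y' \<and> shm T f' = inv_mor T c \<cdot> f i" if i: "i \<in> I" for i
    by (rule shm_ex[of "inv_mor T c \<cdot> f i" "X i" Y'])
      (use f[OF i] c' a(5)[OF i] Y' in \<open>auto simp: homset_iff\<close>)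
  then obtain f' where f': "\<And>i. i \<in> I \<Longrightarrow> f' i \<in> homset T (X i) Y'"
    "\<And>i. i \<in> I \<Longrightarrow> shm T (f' i) = inv_mor T c \<cdot> f i" by metis
  obtain g where g: "g \<in> homset T S Y'" "\<And>i. i \<in> I \<Longrightarrow> g \<cdot> \<iota> i = f' i"
    using coproduct_ex[OF assms Y', of f'] f'(1) by blast
  have "(c \<cdot> shm T g) \<cdot> shm T (\<iota> i) = f i" if i: "i \<in> I" for i
  proof -
    have "(c \<cdot> shm T g) \<cdot> shm T (\<iota> i) = c \<cdot> shm T (g \<cdot> \<iota> i)"
      using g(1) a i c' shm_after_arr[of "\<iota> i" g] by (simp add: homset_iff)
    then show ?thesis
      using g(2)[OF i] f'(2)[OF i] isos_cancel(2)[OF c, of "f i"] f[OF i] by (simp add: homset_iff)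
  qed
  then show "\<exists>g. g \<in> homset T (sh T S) Y \<and> (\<forall>i\<in>I. g \<cdot> shm T (\<iota> i) = f i)"
    using g(1) c' by (intro exI[of _ "c \<cdot> shm T g"]) (auto simp: homset_iff)
next
  note a = coproduct_arr[OF assms]
  fix Y g h assume g: "g \<in> homset T (sh T S) Y" and h: "h \<in> homset T (sh T S) Y"
    and eq: "\<And>i. i \<in> I \<Longrightarrow> g \<cdot> shm T (\<iota> i) = h \<cdot> shm T (\<iota> i)"
  have Y: "Y \<in> obj T" using g homset_objs by blast
  obtain Y' c where Y': "Y' \<in> obj T" and c: "c \<in> isos T (sh T Y') Y"
    by (rule desuspend_obj[OF Y])
  note c' = isos_arr[OF c]
  obtain g' where g': "g' \<in> homset T S Y'" "shm T g' = inv_mor T c \<cdot> g"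
    by (rule shm_ex[of "inv_mor T c \<cdot> g" S Y']) (use g c' a Y' in \<open>auto simp: homset_iff\<close>)
  obtain h' where h': "h' \<in> homset T S Y'" "shm T h' = inv_mor T c \<cdot> h"
    by (rule shm_ex[of "inv_mor T c \<cdot> h" S Y']) (use h c' a Y' in \<open>auto simp: homset_iff\<close>)
  have "g' = h'"
  proof (rule coproduct_eq[OF assms g'(1) h'(1)])
    fix i assume i: "i \<in> I"
    have *: "shm T (k' \<cdot> \<iota> i) = inv_mor T c \<cdot> (k \<cdot> shm T (\<iota> i))"
      if "k' \<in> homset T S Y'" "shm T k' = inv_mor T c \<cdot> k" "k \<in> homset T (sh T S) Y" for k k'
    proof -
      have "shm T (k' \<cdot> \<iota> i) = shm T k' \<cdot> shm T (\<iota> i)"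
        by (rule shm_after_arr) (use that(1) a i in \<open>simp_all add: homset_iff\<close>)
      then show ?thesis using that(2,3) c' a i by (simp add: homset_iff)
    qed
    have "shm T (g' \<cdot> \<iota> i) = shm T (h' \<cdot> \<iota> i)"
      using *[OF g' g] *[OF h' h] eq[OF i] by simp
    then show "g' \<cdot> \<iota> i = h' \<cdot> \<iota> i"
      by (rule shm_eq[of _ "X i" Y', rotated 2])
        (use g'(1) h'(1) a i in \<open>simp_all add: homset_iff\<close>)
  qed
  then have "inv_mor T c \<cdot> g = inv_mor T c \<cdot> h" using g' h' by simp
  then show "g = h" using isos_mono[OF isos_inv[OF c], of g h] g h by (simp add: homset_iff)
qed

text \<open>Full and faithful functors reflect coproducts; this recognizes a desuspended family as a
  coproduct.\<close>

lemma coproduct_sh_cancel: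
  assumes "is_coproduct T I (\<lambda>i. sh T (X i)) (sh T S) (\<lambda>i. shm T (\<iota> i))"
    "S \<in> obj T" "\<And>i. i \<in> I \<Longrightarrow> \<iota> i \<in> homset T (X i) S"
  shows "is_coproduct T I X S \<iota>"
proof (rule coproductI[OF assms(2,3)])
  fix Y f assume Y: "Y \<in> obj T" and f: "\<And>i. i \<in> I \<Longrightarrow> f i \<in> homset T (X i) Y"
  obtain g where g: "g \<in> homset T (sh T S) (sh T Y)" "\<And>i. i \<in> I \<Longrightarrow> g \<cdot> shm T (\<iota> i) = shm T (f i)"
    by (rule coproduct_ex[OF assms(1), of "sh T Y" "\<lambda>i. shm T (f i)"])
      (use f Y in \<open>auto simp: homset_iff\<close>)
  obtain g' where g': "g' \<in> homset T S Y" "shm T g' = g" using shm_ex[OF g(1) assms(2) Y] .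
  have "g' \<cdot> \<iota> i = f i" if i: "i \<in> I" for i
    by (rule shm_eq[of _ "X i" Y])
      (use g' g(2)[OF i] f[OF i] assms(3)[OF i] shm_after_arr[of "\<iota> i" g'] in
        \<open>simp_all add: homset_iff\<close>)
  with g' show "\<exists>g. g \<in> homset T S Y \<and> (\<forall>i\<in>I. g \<cdot> \<iota> i = f i)" by blast
next
  fix Y g h assume g: "g \<in> homset T S Y" and h: "h \<in> homset T S Y"
    and eq: "\<And>i. i \<in> I \<Longrightarrow> g \<cdot> \<iota> i = h \<cdot> \<iota> i"
  have "shm T g = shm T h"
  proof (rule coproduct_eq[OF assms(1), of _ "sh T Y"])
    show "shm T g \<in> homset T (sh T S) (sh T Y)" "shm T h \<in> homset T (sh T S) (sh T Y)"
      using g h by (auto simp: homset_iff)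
    fix i assume i: "i \<in> I"
    show "shm T g \<cdot> shm T (\<iota> i) = shm T h \<cdot> shm T (\<iota> i)"
      using eq[OF i] g h assms(3)[OF i] shm_after_arr[of "\<iota> i" g] shm_after_arr[of "\<iota> i" h]
      by (simp add: homset_iff)
  qed
  then show "g = h" using shm_eq[OF g h] by blast
qed

lemma coproj_sh:
  assumes "is_coproduct T I X S \<iota>"
  shows "coproj I (\<lambda>i. sh T (X i)) (sh T S) (\<lambda>i. shm T (\<iota> i)) F = shm T (coproj I X S \<iota> F)"
proof (rule coproj_unique[OF coproduct_sh[OF assms], symmetric])
  note a = coproduct_arr[OF assms] coproj_arr[OF assms]
  show "shm T (coproj I X S \<iota> F) \<in> homset T (sh T S) (sh T S)" using a by (simp add: homset_iff)
  show "shm T (coproj I X S \<iota> F) \<cdot> shm T (\<iota> i)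
      = (if i \<in> F then shm T (\<iota> i) else zero_mor T (sh T (X i)) (sh T S))" if i: "i \<in> I" for i
    using shm_after_arr[of "\<iota> i" "coproj I X S \<iota> F"] a i coproj_inj[OF assms i, of F] by auto
qed

lemma compact_desuspend:
  assumes "sh T C \<in> compact_objs \<kappa> T" "C \<in> obj T"
  shows "C \<in> compact_objs \<kappa> T"
proof (rule compactI[OF assms(2)])
  fix I X S \<iota> m
  assume sm: "small_index \<kappa> I" and cop: "is_coproduct T I X S \<iota>" and m: "m \<in> homset T C S"
  note a = coproj_arr[OF cop]
  obtain F where F: "finite F" "F \<subseteq> I" "shm T (coproj I X S \<iota> F) \<cdot> shm T m = shm T m"
    using compact_factors[OF assms(1) sm coproduct_sh[OF cop], of "shm T m"] m
    by (auto simp: coproj_sh[OF cop] homset_iff)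
  have "coproj I X S \<iota> F \<cdot> m = m"
    by (rule shm_eq[of _ C S])
      (use F(3) m a shm_after_arr[of m "coproj I X S \<iota> F"] in \<open>simp_all add: homset_iff\<close>)
  with F show "\<exists>F. finite F \<and> F \<subseteq> I \<and> coproj I X S \<iota> F \<cdot> m = m" by blast
qed

text \<open>The whole coproduct is desuspended up to isomorphism: summands, coproduct and
  injections. Compactness of \<open>C\<close> is applied there, and the resulting projection is
  carried back.\<close>

lemma compact_suspend:
  assumes "C \<in> compact_objs \<kappa> T"
  shows "sh T C \<in> compact_objs \<kappa> T"
proof (rule compactI)
  have C: "C \<in> obj T" using assms by (simp add: compact_objs_def)
  then show "sh T C \<in> obj T" by simp
  fix I X S \<iota> m
  assume sm: "small_index \<kappa> I" and cop: "is_coproduct T I X S \<iota>" and m: "m \<in> homset T (sh T C) S"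
  note s = coproduct_arr[OF cop] coproj_arr[OF cop]
  obtain S' b where S': "S' \<in> obj T" and b: "b \<in> isos T (sh T S') S" by (rule desuspend_obj[OF s(1)])
  note b' = isos_arr[OF b]
  have "\<exists>X' a. X' \<in> obj T \<and> a \<in> isos T (sh T X') (X i)" if i: "i \<in> I" for i
    by (rule desuspend_obj[OF s(5)[OF i]]) blast
  then obtain X' a where X': "\<And>i. i \<in> I \<Longrightarrow> X' i \<in> obj T"
    and a: "\<And>i. i \<in> I \<Longrightarrow> a i \<in> isos T (sh T (X' i)) (X i)" by metis
  note a' = isos_arr[OF a]
  have "\<exists>k. k \<in> homset T (X' i) S' \<and> shm T k = inv_mor T b \<cdot> (\<iota> i \<cdot> a i)" if i: "i \<in> I" for i
    by (rule shm_ex[of "inv_mor T b \<cdot> (\<iota> i \<cdot> a i)" "X' i" S'])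
      (use s a'[OF i] b' X'[OF i] S' i in \<open>auto simp: homset_iff\<close>)
  then obtain k where k: "\<And>i. i \<in> I \<Longrightarrow> k i \<in> homset T (X' i) S'"
    "\<And>i. i \<in> I \<Longrightarrow> shm T (k i) = inv_mor T b \<cdot> (\<iota> i \<cdot> a i)" by metis
  have cop1: "is_coproduct T I (\<lambda>i. sh T (X' i)) (sh T S') (\<lambda>i. inv_mor T b \<cdot> (\<iota> i \<cdot> a i))"
    by (rule coproduct_iso[OF cop a isos_inv[OF b]])
  have "is_coproduct T I (\<lambda>i. sh T (X' i)) (sh T S') (\<lambda>i. shm T (k i))"
    using coproduct_cong[OF cop1 k(2)] .
  then have cop': "is_coproduct T I X' S' k" using coproduct_sh_cancel k(1) S' by blast
  note e = coproj_arr[OF cop']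
  obtain m' where m': "m' \<in> homset T C S'" "shm T m' = inv_mor T b \<cdot> m"
    by (rule shm_ex[of "inv_mor T b \<cdot> m" C S']) (use m b' C S' in \<open>auto simp: homset_iff\<close>)
  obtain F where F: "finite F" "F \<subseteq> I" "coproj I X' S' k F \<cdot> m' = m'"
    by (rule compact_factors[OF assms sm cop' m'(1)])
  let ?e = "coproj I X' S' k F"
  \<comment> \<open>Conjugation by \<open>b\<close> carries the suspended projection back to the
    original coproduct. It is recognized on each injection after precomposition with the isomorphism
    \<open>a i\<close>.\<close>
  have eq: "b \<cdot> (shm T ?e \<cdot> inv_mor T b) = coproj I X S \<iota> F"
  proof (rule coproj_unique[OF cop])
    show "b \<cdot> (shm T ?e \<cdot> inv_mor T b) \<in> homset T S S" using b' e by (simp add: homset_iff)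
    fix i assume i: "i \<in> I"
    note ai = a'[OF i]
    have 1: "inv_mor T b \<cdot> (\<iota> i \<cdot> a i) = shm T (k i)" using k(2)[OF i] by simp
    have "((b \<cdot> (shm T ?e \<cdot> inv_mor T b)) \<cdot> \<iota> i) \<cdot> a i = b \<cdot> (shm T ?e \<cdot> (inv_mor T b \<cdot> (\<iota> i \<cdot> a i)))"
      using b' e ai s i by simp
    also have "\<dots> = b \<cdot> shm T (?e \<cdot> k i)"
      unfolding 1 using shm_after_arr[of "k i" ?e] k(1)[OF i] e by (simp add: homset_iff)
    also have "\<dots> = (if i \<in> F then \<iota> i else zero_mor T (X i) S) \<cdot> a i"
      using coproj_inj[OF cop' i, of F] k(2)[OF i] isos_cancel(2)[OF b, of "\<iota> i \<cdot> a i"] s i ai b'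
        X'[OF i] S' by simp
    finally have *: "((b \<cdot> (shm T ?e \<cdot> inv_mor T b)) \<cdot> \<iota> i) \<cdot> a i
        = (if i \<in> F then \<iota> i else zero_mor T (X i) S) \<cdot> a i" .
    show "(b \<cdot> (shm T ?e \<cdot> inv_mor T b)) \<cdot> \<iota> i
        = (if i \<in> F then \<iota> i else zero_mor T (X i) S)"
      by (rule isos_epi[OF a[OF i] _ _ _ _ *]) (simp_all add: b' e ai s i X'[OF i])
  qed
  have "coproj I X S \<iota> F \<cdot> m = b \<cdot> (shm T ?e \<cdot> (inv_mor T b \<cdot> m))"
    unfolding eq[symmetric] using b' e m by (simp add: homset_iff)
  also have "\<dots> = b \<cdot> shm T (?e \<cdot> m')"
    unfolding m'(2)[symmetric] using shm_after_arr[of m' ?e] e m'(1) by (simp add: homset_iff)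
  also have "\<dots> = m"
    using F(3) m'(2) isos_cancel(2)[OF b, of m] m by (simp add: homset_iff)
  finally show "\<exists>F. finite F \<and> F \<subseteq> I \<and> coproj I X S \<iota> F \<cdot> m = m" using F by blast
qed

text \<open>A finite support for \<open>m \<cdot> g\<close> leaves an error term that vanishes on
  \<open>g\<close>, so this error comes from the compact object \<open>sh T X\<close> and has a
  finite support of its own. The union of both supports fixes \<open>m\<close>.\<close>

lemma compact_cone:
  assumes t: "exact_triangle T X Y Z f g h" and X: "X \<in> compact_objs \<kappa> T"
    and Y: "Y \<in> compact_objs \<kappa> T"
  shows "Z \<in> compact_objs \<kappa> T"
proof (rule compactI)
  note a = exact_arr[OF t]
  show "Z \<in> obj T" using a by simp
  fix I V S \<iota> m
  assume sm: "small_index \<kappa> I" and cop: "is_coproduct T I V S \<iota>" and m: "m \<in> homset T Z S"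
  let ?e = "coproj I V S \<iota>"
  note e = coproj_arr[OF cop]
  have mg: "m \<cdot> g \<in> homset T Y S" using m a by (simp add: homset_iff)
  obtain F where F: "finite F" "F \<subseteq> I" "?e F \<cdot> (m \<cdot> g) = m \<cdot> g"
    by (rule compact_factors[OF Y sm cop mg])
  let ?d = "m \<boxplus> neg_mor T (?e F \<cdot> m)"
  have d: "?d \<in> homset T Z S" using m e by (simp add: homset_iff)
  have eFm: "?e F \<cdot> m \<in> homset T Z S" using m e by (simp add: homset_iff)
  have "?d \<cdot> g = (m \<cdot> g) \<boxplus> neg_mor T ((?e F \<cdot> m) \<cdot> g)"
    by (simp add: plus_after_arr neg_after m[unfolded homset_iff] e a)
  also have "(?e F \<cdot> m) \<cdot> g = m \<cdot> g" using F(3) m e a by (simp add: homset_iff)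
  also have "(m \<cdot> g) \<boxplus> neg_mor T (m \<cdot> g) = zero_mor T Y S" using m a by (simp add: homset_iff)
  finally have "?d \<cdot> g = zero_mor T Y S" .
  then obtain n where n: "n \<in> homset T (sh T X) S" "?d = n \<cdot> h"
    using factor_last[OF rotate[OF t] d] by blast
  obtain G where G: "finite G" "G \<subseteq> I" "?e G \<cdot> n = n"
    by (rule compact_factors[OF compact_suspend[OF X] sm cop n(1)])
  let ?H = "F \<union> G"
  have "?e ?H \<cdot> n = n" using coproj_mono[OF cop n(1) G(3)] by blast
  then have "?e ?H \<cdot> (n \<cdot> h) = n \<cdot> h"
    using after_assoc_arr[of h n "?e ?H"] n(1) a e by (simp add: homset_iff)
  then have dH: "?e ?H \<cdot> ?d = ?d" using n(2) by simp
  have "?e ?H \<cdot> (?e F \<cdot> m) = (?e ?H \<cdot> ?e F) \<cdot> m" using m e by (simp add: homset_iff)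
  also have "\<dots> = ?e F \<cdot> m" using coproj_after[OF cop, of ?H F] by (simp add: Int_absorb1)
  finally have fH: "?e ?H \<cdot> (?e F \<cdot> m) = ?e F \<cdot> m" .
  have m_eq: "m = ?d \<boxplus> (?e F \<cdot> m)" using diff_plus[OF m eFm] by simp
  have "?e ?H \<cdot> m = ?e ?H \<cdot> (?d \<boxplus> (?e F \<cdot> m))" using m_eq by simp
  also have "\<dots> = (?e ?H \<cdot> ?d) \<boxplus> (?e ?H \<cdot> (?e F \<cdot> m))"
    by (rule after_plus_arr) (use d eFm e in \<open>simp_all add: homset_iff\<close>)
  also have "\<dots> = m" using dH fH m_eq by simp
  finally show "\<exists>F. finite F \<and> F \<subseteq> I \<and> ?e F \<cdot> m = m"
    using F G by (intro exI[of _ ?H]) auto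
qed

lemma compact_fibre:
  assumes "exact_triangle T X Y Z f g h" "Y \<in> compact_objs \<kappa> T" "Z \<in> compact_objs \<kappa> T"
  shows "X \<in> compact_objs \<kappa> T"
  using compact_desuspend[OF compact_cone[OF rotate[OF assms(1)] assms(2,3)]] exact_arr[OF assms(1)]
  by simp

end

section \<open>Monoidal coherence\<close>

context category
begin

text \<open>Simplification nests composites to the right, so an equation between two-fold composites
  rarely matches a subterm. This form applies it in front of an arbitrary tail
  \<open>x\<close>.\<close>

lemma comp_tail:
  assumes "g \<cdot> f = k \<cdot> h" "f \<in> arr T" "g \<in> arr T" "src T g = tgt T f" "h \<in> arr T" "k \<in> arr T"
    "src T k = tgt T h" "src T h = src T f" "x \<in> arr T" "tgt T x = src T f"
  shows "g \<cdot> (f \<cdot> x) = k \<cdot> (h \<cdot> x)"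
proof -
  have "g \<cdot> (f \<cdot> x) = (g \<cdot> f) \<cdot> x" using assms(2-) by simp
  also have "\<dots> = k \<cdot> (h \<cdot> x)" unfolding assms(1) using assms(2-) by simp
  finally show ?thesis .
qed

lemma comp_tail1:
  assumes "g \<cdot> f = h" "f \<in> arr T" "g \<in> arr T" "src T g = tgt T f" "x \<in> arr T" "tgt T x = src T f"
  shows "g \<cdot> (f \<cdot> x) = h \<cdot> x"
proof -
  have "g \<cdot> (f \<cdot> x) = (g \<cdot> f) \<cdot> x" using assms(2-) by simp
  then show ?thesis using assms(1) by simp
qed

end

section \<open>Whiskering, naturality and unit coherence\<close>

context symmetric_monoidal_category
begin

abbreviation whisker_right :: "'m \<Rightarrow> 'o \<Rightarrow> 'm"  (infixl "\<rtimes>" 75) where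
  "f \<rtimes> W \<equiv> f \<boxtimes>\<^sub>m ident T W"

abbreviation whisker_left :: "'o \<Rightarrow> 'm \<Rightarrow> 'm"  (infixl "\<ltimes>" 75) where
  "W \<ltimes> f \<equiv> ident T W \<boxtimes>\<^sub>m f"

lemma unit_in [simp]: "unit_obj T \<in> obj T"
  by (rule unit_obj)

lemma tensor_in [simp]: "\<lbrakk>X \<in> obj T; Y \<in> obj T\<rbrakk> \<Longrightarrow> X \<boxtimes> Y \<in> obj T"
  by (rule tensor_obj)

lemma tensorm_arr [simp]:
  assumes "f \<in> arr T" "g \<in> arr T"
  shows "f \<boxtimes>\<^sub>m g \<in> arr T" "src T (f \<boxtimes>\<^sub>m g) = src T f \<boxtimes> src T g"
    "tgt T (f \<boxtimes>\<^sub>m g) = tgt T f \<boxtimes> tgt T g"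
  using tensorm_hom[of f "src T f" "tgt T f" g "src T g" "tgt T g"] assms
  by (simp_all add: homset_iff)

lemma tensorm_ident_arr [simp]:
  "\<lbrakk>X \<in> obj T; Y \<in> obj T\<rbrakk> \<Longrightarrow> ident T X \<rtimes> Y = ident T (X \<boxtimes> Y)"
  by (rule tensorm_ident)

lemma interchange:
  "\<lbrakk>f \<in> arr T; f' \<in> arr T; g \<in> arr T; g' \<in> arr T; src T f' = tgt T f; src T g' = tgt T g\<rbrakk>
    \<Longrightarrow> (f' \<boxtimes>\<^sub>m g') \<cdot> (f \<boxtimes>\<^sub>m g) = (f' \<cdot> f) \<boxtimes>\<^sub>m (g' \<cdot> g)"
  using tensorm_after[of f "src T f" "tgt T f" f' "tgt T f'" g "src T g" "tgt T g" g' "tgt T g'"]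
  by (simp add: homset_iff)

lemma interchange_tail:
  "\<lbrakk>f \<in> arr T; f' \<in> arr T; g \<in> arr T; g' \<in> arr T; src T f' = tgt T f; src T g' = tgt T g;
    k \<in> arr T; tgt T k = src T f \<boxtimes> src T g\<rbrakk>
    \<Longrightarrow> (f' \<boxtimes>\<^sub>m g') \<cdot> ((f \<boxtimes>\<^sub>m g) \<cdot> k) = ((f' \<cdot> f) \<boxtimes>\<^sub>m (g' \<cdot> g)) \<cdot> k"
  by (rule comp_tail1[OF interchange]) simp_all

lemma assoc_isos [simp]:
  "\<lbrakk>X \<in> obj T; Y \<in> obj T; Z \<in> obj T\<rbrakk> \<Longrightarrow> assoc T X Y Z \<in> isos T ((X \<boxtimes> Y) \<boxtimes> Z) (X \<boxtimes> (Y \<boxtimes> Z))"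
  by (rule assoc_iso)

lemma lunit_isos [simp]: "X \<in> obj T \<Longrightarrow> lunit T X \<in> isos T (unit_obj T \<boxtimes> X) X"
  by (rule lunit_iso)

lemma runit_isos [simp]: "X \<in> obj T \<Longrightarrow> runit T X \<in> isos T (X \<boxtimes> unit_obj T) X"
  by (rule runit_iso)

lemma braid_isos [simp]: "\<lbrakk>X \<in> obj T; Y \<in> obj T\<rbrakk> \<Longrightarrow> braid T X Y \<in> isos T (X \<boxtimes> Y) (Y \<boxtimes> X)"
  by (rule braid_iso)

lemmas assoc_arr [simp] = isos_arr[OF assoc_iso] isos_cancel[OF assoc_iso]
lemmas lunit_arr [simp] = isos_arr[OF lunit_iso] isos_cancel[OF lunit_iso]
lemmas runit_arr [simp] = isos_arr[OF runit_iso] isos_cancel[OF runit_iso]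
lemmas braid_arr [simp] = isos_arr[OF braid_iso] isos_cancel[OF braid_iso]

lemma assoc_nat:
  assumes "f \<in> arr T" "g \<in> arr T" "h \<in> arr T" "src T f = X" "src T g = Y" "src T h = Z"
    "tgt T f = X'" "tgt T g = Y'" "tgt T h = Z'"
  shows "assoc T X' Y' Z' \<cdot> ((f \<boxtimes>\<^sub>m g) \<boxtimes>\<^sub>m h) = (f \<boxtimes>\<^sub>m (g \<boxtimes>\<^sub>m h)) \<cdot> assoc T X Y Z"
  using assoc_natural[of f X X' g Y Y' h Z Z'] assms by (simp add: homset_iff)

lemma assoc_inv_nat:
  assumes "f \<in> arr T" "g \<in> arr T" "h \<in> arr T" "src T f = X" "src T g = Y" "src T h = Z"
    "tgt T f = X'" "tgt T g = Y'" "tgt T h = Z'"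
  shows "inv_mor T (assoc T X' Y' Z') \<cdot> (f \<boxtimes>\<^sub>m (g \<boxtimes>\<^sub>m h))
    = ((f \<boxtimes>\<^sub>m g) \<boxtimes>\<^sub>m h) \<cdot> inv_mor T (assoc T X Y Z)"
proof -
  have o: "X \<in> obj T" "Y \<in> obj T" "Z \<in> obj T" "X' \<in> obj T" "Y' \<in> obj T" "Z' \<in> obj T"
    using assms by auto
  let ?a = "assoc T X Y Z" and ?a' = "assoc T X' Y' Z'"
  have "inv_mor T ?a' \<cdot> (f \<boxtimes>\<^sub>m (g \<boxtimes>\<^sub>m h))
      = inv_mor T ?a' \<cdot> (((f \<boxtimes>\<^sub>m (g \<boxtimes>\<^sub>m h)) \<cdot> ?a) \<cdot> inv_mor T ?a)"
    by (simp add: assms o)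
  also have "\<dots> = inv_mor T ?a' \<cdot> ((?a' \<cdot> ((f \<boxtimes>\<^sub>m g) \<boxtimes>\<^sub>m h)) \<cdot> inv_mor T ?a)"
    by (simp only: assoc_nat[OF assms])
  also have "\<dots> = ((f \<boxtimes>\<^sub>m g) \<boxtimes>\<^sub>m h) \<cdot> inv_mor T ?a" by (simp add: assms o)
  finally show ?thesis .
qed

lemma lunit_nat:
  "\<lbrakk>f \<in> arr T; src T f = X; tgt T f = Y\<rbrakk>
    \<Longrightarrow> lunit T Y \<cdot> ((unit_obj T) \<ltimes> f) = f \<cdot> lunit T X"
  using lunit_natural[of f X Y] by (simp add: homset_iff)

lemma lunit_inv_nat:
  assumes "f \<in> arr T" "src T f = X" "tgt T f = Y"
  shows "inv_mor T (lunit T Y) \<cdot> f = ((unit_obj T) \<ltimes> f) \<cdot> inv_mor T (lunit T X)"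
proof -
  have o: "X \<in> obj T" "Y \<in> obj T" using assms by auto
  have "inv_mor T (lunit T Y) \<cdot> f = inv_mor T (lunit T Y) \<cdot> ((f \<cdot> lunit T X) \<cdot> inv_mor T (lunit T X))"
    by (simp add: assms o)
  also have "\<dots> = ((unit_obj T) \<ltimes> f) \<cdot> inv_mor T (lunit T X)"
    unfolding lunit_nat[OF assms, symmetric] by (simp add: assms o)
  finally show ?thesis .
qed

lemma runit_nat:
  "\<lbrakk>f \<in> arr T; src T f = X; tgt T f = Y\<rbrakk>
    \<Longrightarrow> runit T Y \<cdot> (f \<rtimes> (unit_obj T)) = f \<cdot> runit T X"
  using runit_natural[of f X Y] by (simp add: homset_iff)

lemma braid_nat:
  "\<lbrakk>f \<in> arr T; g \<in> arr T; src T f = X; tgt T f = X'; src T g = Y; tgt T g = Y'\<rbrakk>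
    \<Longrightarrow> braid T X' Y' \<cdot> (f \<boxtimes>\<^sub>m g) = (g \<boxtimes>\<^sub>m f) \<cdot> braid T X Y"
  using braid_natural[of f X X' g Y Y'] by (simp add: homset_iff)

lemma braid_braid [simp]:
  "\<lbrakk>X \<in> obj T; Y \<in> obj T\<rbrakk> \<Longrightarrow> braid T Y X \<cdot> braid T X Y = ident T (X \<boxtimes> Y)"
  by (rule braid_symmetric)

lemma braid_braid_after [simp]:
  "\<lbrakk>X \<in> obj T; Y \<in> obj T; f \<in> arr T; tgt T f = X \<boxtimes> Y\<rbrakk> \<Longrightarrow> braid T Y X \<cdot> (braid T X Y \<cdot> f) = f"
  using comp_tail1[OF braid_braid, of X Y f] by simp

text \<open>Tensoring with the unit is naturally isomorphic to the identity functor, hence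
  faithful.\<close>

lemma lunit_cancel:
  assumes "(unit_obj T) \<ltimes> f = (unit_obj T) \<ltimes> g" "f \<in> homset T X Y" "g \<in> homset T X Y"
  shows "f = g"
  by (rule isos_epi[OF lunit_iso, of X])
    (use assms lunit_nat[of f X Y] lunit_nat[of g X Y] in \<open>auto simp: homset_iff\<close>)

lemma runit_cancel:
  assumes "f \<rtimes> (unit_obj T) = g \<rtimes> (unit_obj T)" "f \<in> homset T X Y" "g \<in> homset T X Y"
  shows "f = g"
  by (rule isos_epi[OF runit_iso, of X])
    (use assms runit_nat[of f X Y] runit_nat[of g X Y] in \<open>auto simp: homset_iff\<close>)

lemma tensor_isos:
  assumes "f \<in> isos T X X'" "g \<in> isos T Y Y'"
  shows "f \<boxtimes>\<^sub>m g \<in> isos T (X \<boxtimes> Y) (X' \<boxtimes> Y')"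
proof (rule isosI[where g = "inv_mor T f \<boxtimes>\<^sub>m inv_mor T g"])
  note a = isos_arr[OF assms(1)] isos_arr[OF assms(2)]
  have o: "X \<in> obj T" "Y \<in> obj T" "X' \<in> obj T" "Y' \<in> obj T" using a by auto
  show "f \<boxtimes>\<^sub>m g \<in> homset T (X \<boxtimes> Y) (X' \<boxtimes> Y')"
    "inv_mor T f \<boxtimes>\<^sub>m inv_mor T g \<in> homset T (X' \<boxtimes> Y') (X \<boxtimes> Y)"
    by (simp_all add: homset_iff a)
  show "(inv_mor T f \<boxtimes>\<^sub>m inv_mor T g) \<cdot> (f \<boxtimes>\<^sub>m g) = ident T (X \<boxtimes> Y)"
    "(f \<boxtimes>\<^sub>m g) \<cdot> (inv_mor T f \<boxtimes>\<^sub>m inv_mor T g) = ident T (X' \<boxtimes> Y')"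
    by (simp_all add: interchange a o)
qed

text \<open>Kelly: these two unit coherences follow from the pentagon and triangle axioms.\<close>

lemma lunit_tensor:
  assumes [simp]: "X \<in> obj T" "Y \<in> obj T"
  shows "lunit T (X \<boxtimes> Y) \<cdot> assoc T (unit_obj T) X Y = lunit T X \<rtimes> Y"
proof (rule lunit_cancel)
  let ?I = "unit_obj T"
  let ?A = "assoc T ?I (?I \<boxtimes> X) Y \<cdot> (assoc T ?I ?I X \<rtimes> Y)"
  let ?l = "?I \<ltimes> (lunit T (X \<boxtimes> Y) \<cdot> assoc T ?I X Y)"
  let ?r = "?I \<ltimes> (lunit T X \<rtimes> Y)"
  show "lunit T (X \<boxtimes> Y) \<cdot> assoc T ?I X Y \<in> homset T ((?I \<boxtimes> X) \<boxtimes> Y) (X \<boxtimes> Y)"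
    "lunit T X \<rtimes> Y \<in> homset T ((?I \<boxtimes> X) \<boxtimes> Y) (X \<boxtimes> Y)"
    by (simp_all add: homset_iff)
  \<comment> \<open>As \<open>?A\<close> is invertible, the two maps may be compared after
    precomposition with it, where the pentagon applies.\<close>
  have A: "?A \<in> isos T (((?I \<boxtimes> ?I) \<boxtimes> X) \<boxtimes> Y) (?I \<boxtimes> ((?I \<boxtimes> X) \<boxtimes> Y))"
    by (rule isos_after[OF tensor_isos[OF assoc_iso isos_ident] assoc_iso]) simp_all
  have "?l = (?I \<ltimes> lunit T (X \<boxtimes> Y)) \<cdot> (?I \<ltimes> assoc T ?I X Y)"
    by (simp add: interchange)
  then have "?l \<cdot> ?A = (?I \<ltimes> lunit T (X \<boxtimes> Y)) \<cdot> ((?I \<ltimes> assoc T ?I X Y) \<cdot> ?A)"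
    by simp
  also have "\<dots> = (?I \<ltimes> lunit T (X \<boxtimes> Y)) \<cdot> (assoc T ?I ?I (X \<boxtimes> Y) \<cdot> assoc T (?I \<boxtimes> ?I) X Y)"
    by (simp only: pentagon[of ?I ?I X Y, OF unit_in unit_in assms])
  also have "\<dots> = (runit T ?I \<rtimes> (X \<boxtimes> Y)) \<cdot> assoc T (?I \<boxtimes> ?I) X Y"
    by (rule comp_tail1[OF triangle]) simp_all
  also have "\<dots> = assoc T ?I X Y \<cdot> ((runit T ?I \<rtimes> X) \<rtimes> Y)"
    by (subst assoc_nat[where X = "?I \<boxtimes> ?I" and Y = X and Z = Y]) simp_all
  also have "runit T ?I \<rtimes> X = (?I \<ltimes> lunit T X) \<cdot> assoc T ?I ?I X"
    by (simp add: triangle)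
  also have "((?I \<ltimes> lunit T X) \<cdot> assoc T ?I ?I X) \<rtimes> Y
      = ((?I \<ltimes> lunit T X) \<rtimes> Y) \<cdot> (assoc T ?I ?I X \<rtimes> Y)"
    by (simp add: interchange)
  also have "assoc T ?I X Y \<cdot> (((?I \<ltimes> lunit T X) \<rtimes> Y) \<cdot> (assoc T ?I ?I X \<rtimes> Y))
      = ?r \<cdot> ?A"
    by (rule comp_tail[OF assoc_nat]) simp_all
  finally show "?l = ?r" by (rule isos_epi[OF A, rotated 4]) simp_all
qed

lemma runit_tensor:
  assumes [simp]: "X \<in> obj T" "Y \<in> obj T"
  shows "(X \<ltimes> runit T Y) \<cdot> assoc T X Y (unit_obj T) = runit T (X \<boxtimes> Y)"
proof (rule runit_cancel)
  let ?I = "unit_obj T"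
  let ?l = "((X \<ltimes> runit T Y) \<cdot> assoc T X Y ?I) \<rtimes> ?I"
  let ?r = "runit T (X \<boxtimes> Y) \<rtimes> ?I"
  show "(X \<ltimes> runit T Y) \<cdot> assoc T X Y ?I \<in> homset T ((X \<boxtimes> Y) \<boxtimes> ?I) (X \<boxtimes> Y)"
    "runit T (X \<boxtimes> Y) \<in> homset T ((X \<boxtimes> Y) \<boxtimes> ?I) (X \<boxtimes> Y)"
    by (simp_all add: homset_iff)
  have "?l = ((X \<ltimes> runit T Y) \<rtimes> ?I) \<cdot> (assoc T X Y ?I \<rtimes> ?I)"
    by (simp add: interchange)
  \<comment> \<open>Here the pentagon is reached by postcomposing with an associator, which is
    cancelled at the end.\<close>
  then have "assoc T X Y ?I \<cdot> ?l = assoc T X Y ?I \<cdot>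
      (((X \<ltimes> runit T Y) \<rtimes> ?I) \<cdot> (assoc T X Y ?I \<rtimes> ?I))"
    by (rule arg_cong)
  also have "\<dots> =
      (X \<ltimes> (runit T Y \<rtimes> ?I)) \<cdot> (assoc T X (Y \<boxtimes> ?I) ?I \<cdot> (assoc T X Y ?I \<rtimes> ?I))"
    by (rule comp_tail[OF assoc_nat]) simp_all
  also have "runit T Y \<rtimes> ?I = (Y \<ltimes> lunit T ?I) \<cdot> assoc T Y ?I ?I"
    by (simp add: triangle)
  also have "X \<ltimes> ((Y \<ltimes> lunit T ?I) \<cdot> assoc T Y ?I ?I)
      = (X \<ltimes> (Y \<ltimes> lunit T ?I)) \<cdot> (X \<ltimes> assoc T Y ?I ?I)"
    by (simp add: interchange)
  also have "((X \<ltimes> (Y \<ltimes> lunit T ?I)) \<cdot> (X \<ltimes> assoc T Y ?I ?I)) \<cdot>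
        (assoc T X (Y \<boxtimes> ?I) ?I \<cdot> (assoc T X Y ?I \<rtimes> ?I))
      = (X \<ltimes> (Y \<ltimes> lunit T ?I)) \<cdot> ((X \<ltimes> assoc T Y ?I ?I) \<cdot>
        assoc T X (Y \<boxtimes> ?I) ?I \<cdot> (assoc T X Y ?I \<rtimes> ?I))"
    by simp
  also have "\<dots> = (X \<ltimes> (Y \<ltimes> lunit T ?I)) \<cdot>
      (assoc T X Y (?I \<boxtimes> ?I) \<cdot> assoc T (X \<boxtimes> Y) ?I ?I)"
    by (simp only: pentagon[of X Y ?I ?I, OF assms unit_in unit_in])
  also have "\<dots> = assoc T X Y ?I \<cdot> (((ident T X \<rtimes> Y) \<boxtimes>\<^sub>m lunit T ?I) \<cdot> assoc T (X \<boxtimes> Y) ?I ?I)"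
    by (rule comp_tail[OF assoc_nat[symmetric]]) simp_all
  also have "\<dots> = assoc T X Y ?I \<cdot> ?r" by (simp add: triangle)
  finally show "?l = ?r" by (rule isos_mono[OF assoc_iso, rotated -1]) simp_all
qed

text \<open>Naturality of \<open>lunit\<close> at \<open>lunit T ?I\<close> itself identifies
  \<open>lunit T (?I \<boxtimes> ?I)\<close> with the left whiskering of \<open>lunit T ?I\<close>;
  then \<open>lunit_tensor\<close> and the triangle axiom give both unit isomorphisms the same right
  whiskering.\<close>

lemma lunit_unit: "lunit T (unit_obj T) = runit T (unit_obj T)"
proof (rule runit_cancel)
  let ?I = "unit_obj T"
  show "lunit T ?I \<in> homset T (?I \<boxtimes> ?I) ?I" "runit T ?I \<in> homset T (?I \<boxtimes> ?I) ?I"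
    by (simp_all add: homset_iff)
  have "lunit T (?I \<boxtimes> ?I) = ?I \<ltimes> lunit T ?I"
    by (rule isos_mono[OF lunit_iso[of ?I]]) (use lunit_nat[of "lunit T ?I" "?I \<boxtimes> ?I" ?I] in simp_all)
  then show "lunit T ?I \<rtimes> ?I = runit T ?I \<rtimes> ?I"
    using lunit_tensor[of ?I ?I] triangle[of ?I ?I] by simp
qed

text \<open>The unit is its own dual, with \<open>runit\<close> as evaluation and its inverse as
  coevaluation. Together with \<open>compact_eq_rigid\<close> this makes the unit compact.\<close>

lemma unit_rigid: "unit_obj T \<in> rigid_objs T"
proof -
  let ?I = "unit_obj T"
  note [simp] = lunit_unit
  have t: "(?I \<ltimes> runit T ?I) \<cdot> assoc T ?I ?I ?I = runit T ?I \<rtimes> ?I"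
    using triangle[of ?I ?I] by simp
  have 1: "runit T ?I \<cdot> (?I \<ltimes> runit T ?I) \<cdot> assoc T ?I ?I ?I \<cdot>
      (inv_mor T (runit T ?I) \<rtimes> ?I) = runit T ?I"
    using comp_tail1[OF t, of "inv_mor T (runit T ?I) \<rtimes> ?I"] by (simp add: interchange)
  have 2: "runit T ?I \<cdot> (runit T ?I \<rtimes> ?I) \<cdot> inv_mor T (assoc T ?I ?I ?I) \<cdot>
      (?I \<ltimes> inv_mor T (runit T ?I)) = runit T ?I"
    unfolding t[symmetric] by (simp add: interchange)
  have "is_dual T ?I ?I"
    unfolding is_dual_def
    by (intro conjI bexI[of _ "runit T ?I"] bexI[of _ "inv_mor T (runit T ?I)"])
      (use 1 2 in \<open>simp_all add: homset_iff\<close>)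
  then show ?thesis by (auto simp: rigid_objs_def)
qed

end

section \<open>Duality\<close>

context symmetric_monoidal_category
begin

lemma lunit_inv_tensor:
  assumes [simp]: "X \<in> obj T" "Y \<in> obj T"
  shows "inv_mor T (lunit T (X \<boxtimes> Y))
    = assoc T (unit_obj T) X Y \<cdot> (inv_mor T (lunit T X) \<rtimes> Y)"
proof (rule isos_mono[OF lunit_iso[of "X \<boxtimes> Y"]])
  show "lunit T (X \<boxtimes> Y) \<cdot> inv_mor T (lunit T (X \<boxtimes> Y)) = lunit T (X \<boxtimes> Y) \<cdot>
      (assoc T (unit_obj T) X Y \<cdot> (inv_mor T (lunit T X) \<rtimes> Y))"
    using comp_tail1[OF lunit_tensor[OF assms], of "inv_mor T (lunit T X) \<rtimes> Y"]
    by (simp add: interchange)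
qed simp_all

lemma tensor_inv:
  assumes "f \<in> isos T X X'" "Y \<in> obj T"
  shows "(inv_mor T f \<rtimes> Y) \<cdot> (f \<rtimes> Y) = ident T (X \<boxtimes> Y)"
    "(f \<rtimes> Y) \<cdot> (inv_mor T f \<rtimes> Y) = ident T (X' \<boxtimes> Y)"
    "(Y \<ltimes> inv_mor T f) \<cdot> (Y \<ltimes> f) = ident T (Y \<boxtimes> X)"
    "(Y \<ltimes> f) \<cdot> (Y \<ltimes> inv_mor T f) = ident T (Y \<boxtimes> X')"
proof -
  note a = isos_arr[OF assms(1)]
  have o: "X \<in> obj T" "X' \<in> obj T" using a by auto
  show "(inv_mor T f \<rtimes> Y) \<cdot> (f \<rtimes> Y) = ident T (X \<boxtimes> Y)"
    "(f \<rtimes> Y) \<cdot> (inv_mor T f \<rtimes> Y) = ident T (X' \<boxtimes> Y)"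
    "(Y \<ltimes> inv_mor T f) \<cdot> (Y \<ltimes> f) = ident T (Y \<boxtimes> X)"
    "(Y \<ltimes> f) \<cdot> (Y \<ltimes> inv_mor T f) = ident T (Y \<boxtimes> X')"
    by (simp_all add: interchange a o assms(2))
qed

text \<open>Naturality and the pentagon move \<open>d\<close> to the outside, until the composite is
  the zig-zag identity \<open>zz\<close> tensored with \<open>d\<close>.\<close>

lemma zigzag_left1:
  assumes [simp]: "X \<in> obj T" "D \<in> obj T" "d \<in> obj T"
    and ev: "ev \<in> homset T (D \<boxtimes> X) (unit_obj T)" and coev: "coev \<in> homset T (unit_obj T) (X \<boxtimes> D)"
    and zz: "runit T X \<cdot> (X \<ltimes> ev) \<cdot> assoc T X D X \<cdot> (coev \<rtimes> X) = lunit T X"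
  shows "(X \<ltimes> (lunit T d \<cdot> (ev \<rtimes> d) \<cdot> inv_mor T (assoc T D X d))) \<cdot>
    (assoc T X D (X \<boxtimes> d) \<cdot> (coev \<rtimes> (X \<boxtimes> d)) \<cdot> inv_mor T (lunit T (X \<boxtimes> d)))
    = ident T (X \<boxtimes> d)"
proof -
  let ?I = "unit_obj T"
  have [simp]: "ev \<in> arr T" "src T ev = D \<boxtimes> X" "tgt T ev = ?I"
    "coev \<in> arr T" "src T coev = ?I" "tgt T coev = X \<boxtimes> D"
    using ev coev by (simp_all add: homset_iff)
  let ?l = "inv_mor T (lunit T X) \<rtimes> d"
  let ?c = "(coev \<rtimes> X) \<rtimes> d"
  let ?a = "assoc T X D X \<rtimes> d"
  let ?e = "(X \<ltimes> ev) \<rtimes> d"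
  have n1: "(coev \<rtimes> (X \<boxtimes> d)) \<cdot> assoc T ?I X d = assoc T (X \<boxtimes> D) X d \<cdot> ?c"
    using assoc_nat[of coev "ident T X" "ident T d"] by simp
  have n2: "(X \<ltimes> (ev \<rtimes> d)) \<cdot> assoc T X (D \<boxtimes> X) d = assoc T X ?I d \<cdot> ?e"
    using assoc_nat[of "ident T X" ev "ident T d"] by simp
  have p: "assoc T X D (X \<boxtimes> d) \<cdot> assoc T (X \<boxtimes> D) X d
    = (X \<ltimes> assoc T D X d) \<cdot> (assoc T X (D \<boxtimes> X) d \<cdot> ?a)"
    using pentagon[of X D X d] by simp
  have "assoc T X D (X \<boxtimes> d) \<cdot> (coev \<rtimes> (X \<boxtimes> d)) \<cdot> inv_mor T (lunit T (X \<boxtimes> d))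
      = assoc T X D (X \<boxtimes> d) \<cdot> ((coev \<rtimes> (X \<boxtimes> d)) \<cdot> (assoc T ?I X d \<cdot> ?l))"
    by (simp add: lunit_inv_tensor)
  also have "(coev \<rtimes> (X \<boxtimes> d)) \<cdot> (assoc T ?I X d \<cdot> ?l) = assoc T (X \<boxtimes> D) X d \<cdot> (?c \<cdot> ?l)"
    by (rule comp_tail[OF n1]) simp_all
  also have "assoc T X D (X \<boxtimes> d) \<cdot> (assoc T (X \<boxtimes> D) X d \<cdot> (?c \<cdot> ?l))
      = (X \<ltimes> assoc T D X d) \<cdot> ((assoc T X (D \<boxtimes> X) d \<cdot> ?a) \<cdot> (?c \<cdot> ?l))"
    by (rule comp_tail[OF p]) simp_all
  finally have R: "assoc T X D (X \<boxtimes> d) \<cdot> (coev \<rtimes> (X \<boxtimes> d)) \<cdot> inv_mor T (lunit T (X \<boxtimes> d))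
      = (X \<ltimes> assoc T D X d) \<cdot> (assoc T X (D \<boxtimes> X) d \<cdot> (?a \<cdot> (?c \<cdot> ?l)))"
    by simp
  have "(X \<ltimes> (lunit T d \<cdot> (ev \<rtimes> d) \<cdot> inv_mor T (assoc T D X d))) \<cdot>
      ((X \<ltimes> assoc T D X d) \<cdot> (assoc T X (D \<boxtimes> X) d \<cdot> (?a \<cdot> (?c \<cdot> ?l))))
      = (X \<ltimes> (lunit T d \<cdot> (ev \<rtimes> d))) \<cdot> (assoc T X (D \<boxtimes> X) d \<cdot> (?a \<cdot> (?c \<cdot> ?l)))"
    by (subst interchange_tail) simp_all
  also have "X \<ltimes> (lunit T d \<cdot> (ev \<rtimes> d))
      = (X \<ltimes> lunit T d) \<cdot> (X \<ltimes> (ev \<rtimes> d))"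
    by (simp add: interchange)
  also have "((X \<ltimes> lunit T d) \<cdot> (X \<ltimes> (ev \<rtimes> d))) \<cdot>
      (assoc T X (D \<boxtimes> X) d \<cdot> (?a \<cdot> (?c \<cdot> ?l)))
      = (X \<ltimes> lunit T d) \<cdot> ((X \<ltimes> (ev \<rtimes> d)) \<cdot>
      (assoc T X (D \<boxtimes> X) d \<cdot> (?a \<cdot> (?c \<cdot> ?l))))"
    by simp
  also have "(X \<ltimes> (ev \<rtimes> d)) \<cdot> (assoc T X (D \<boxtimes> X) d \<cdot> (?a \<cdot> (?c \<cdot> ?l)))
      = assoc T X ?I d \<cdot> (?e \<cdot> (?a \<cdot> (?c \<cdot> ?l)))"
    by (rule comp_tail[OF n2]) simp_all
  also have "(X \<ltimes> lunit T d) \<cdot> (assoc T X ?I d \<cdot> (?e \<cdot> (?a \<cdot> (?c \<cdot> ?l))))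
      = (runit T X \<rtimes> d) \<cdot> (?e \<cdot> (?a \<cdot> (?c \<cdot> ?l)))"
    by (rule comp_tail1[OF triangle]) simp_all
  \<comment> \<open>Every factor now carries \<open>d\<close> on the right, so interchange collapses
    the chain to the left side of \<open>zz\<close> composed with the inverse of
    \<open>lunit T X\<close>.\<close>
  also have "\<dots> = ((runit T X \<cdot> (X \<ltimes> ev) \<cdot> assoc T X D X \<cdot> (coev \<rtimes> X))
      \<cdot> inv_mor T (lunit T X)) \<rtimes> d"
    by (simp add: interchange)
  also have "\<dots> = ident T (X \<boxtimes> d)" unfolding zz by simp
  finally show ?thesis unfolding R .
qed

text \<open>As for the first identity, except that inverse associators call for inverted forms of
  the pentagon and of the triangle axiom (\<open>p\<close> and \<open>tr\<close>), and that
  \<open>lunit_tensor\<close> splits the leading unit isomorphism.\<close>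

lemma zigzag_left2:
  assumes [simp]: "X \<in> obj T" "D \<in> obj T" "d \<in> obj T"
    and ev: "ev \<in> homset T (D \<boxtimes> X) (unit_obj T)" and coev: "coev \<in> homset T (unit_obj T) (X \<boxtimes> D)"
    and zz: "lunit T D \<cdot> (ev \<rtimes> D) \<cdot> inv_mor T (assoc T D X D) \<cdot> (D \<ltimes> coev) = runit T D"
  shows "(lunit T (D \<boxtimes> d) \<cdot> (ev \<rtimes> (D \<boxtimes> d)) \<cdot> inv_mor T (assoc T D X (D \<boxtimes> d))) \<cdot>
    (D \<ltimes> (assoc T X D d \<cdot> (coev \<rtimes> d) \<cdot> inv_mor T (lunit T d)))
    = ident T (D \<boxtimes> d)"
proof -
  let ?I = "unit_obj T"
  have [simp]: "ev \<in> arr T" "src T ev = D \<boxtimes> X" "tgt T ev = ?I"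
    "coev \<in> arr T" "src T coev = ?I" "tgt T coev = X \<boxtimes> D"
    using ev coev by (simp_all add: homset_iff)
  let ?ia = "inv_mor T (assoc T D X D) \<rtimes> d"
  let ?r = "inv_mor T (runit T D) \<rtimes> d"
  let ?c = "(D \<ltimes> coev) \<rtimes> d"
  let ?e = "(ev \<rtimes> D) \<rtimes> d"
  have p: "inv_mor T (assoc T D X (D \<boxtimes> d)) \<cdot> (D \<ltimes> assoc T X D d)
      = assoc T (D \<boxtimes> X) D d \<cdot> (?ia \<cdot> inv_mor T (assoc T D (X \<boxtimes> D) d))"
  proof (rule isos_mono[OF assoc_iso[of D X "D \<boxtimes> d"]])
    have *: "assoc T D X (D \<boxtimes> d) \<cdot> assoc T (D \<boxtimes> X) D d = (D \<ltimes> assoc T X D d) \<cdot>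
        (assoc T D (X \<boxtimes> D) d \<cdot> (assoc T D X D \<rtimes> d))"
      using pentagon[of D X D d] by simp
    have "assoc T D X (D \<boxtimes> d) \<cdot> (assoc T (D \<boxtimes> X) D d \<cdot> (?ia \<cdot> inv_mor T (assoc T D (X \<boxtimes> D) d)))
      = (D \<ltimes> assoc T X D d) \<cdot>
        ((assoc T D (X \<boxtimes> D) d \<cdot> (assoc T D X D \<rtimes> d)) \<cdot> (?ia \<cdot> inv_mor T (assoc T D (X \<boxtimes> D) d)))"
      by (rule comp_tail[OF *]) simp_all
    then show "assoc T D X (D \<boxtimes> d) \<cdot> (inv_mor T (assoc T D X (D \<boxtimes> d)) \<cdot> (D \<ltimes> assoc T X D d))
      = assoc T D X (D \<boxtimes> d) \<cdot> (assoc T (D \<boxtimes> X) D d \<cdot> (?ia \<cdot> inv_mor T (assoc T D (X \<boxtimes> D) d)))"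
      using comp_tail1[OF tensor_inv(2)[OF assoc_iso[of D X D], of d],
          of "inv_mor T (assoc T D (X \<boxtimes> D) d)"] by simp
  qed simp_all
  have n1: "inv_mor T (assoc T D (X \<boxtimes> D) d) \<cdot> (D \<ltimes> (coev \<rtimes> d))
      = ?c \<cdot> inv_mor T (assoc T D ?I d)"
    using assoc_inv_nat[of "ident T D" coev "ident T d"] by simp
  have n2: "(ev \<rtimes> (D \<boxtimes> d)) \<cdot> assoc T (D \<boxtimes> X) D d = assoc T ?I D d \<cdot> ?e"
    using assoc_nat[of ev "ident T D" "ident T d"] by simp
  have tr: "inv_mor T (assoc T D ?I d) \<cdot> (D \<ltimes> inv_mor T (lunit T d)) = ?r"
  proof (rule isos_mono[OF tensor_isos[OF runit_iso isos_ident, of D d]])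
    have "(runit T D \<rtimes> d) \<cdot> (inv_mor T (assoc T D ?I d) \<cdot> (D \<ltimes> inv_mor T (lunit T d)))
      = (D \<ltimes> lunit T d) \<cdot> (D \<ltimes> inv_mor T (lunit T d))"
      unfolding triangle[OF assms(2,3), symmetric] by simp
    then show "(runit T D \<rtimes> d) \<cdot> (inv_mor T (assoc T D ?I d) \<cdot> (D \<ltimes> inv_mor T (lunit T d)))
      = (runit T D \<rtimes> d) \<cdot> ?r"
      using tensor_inv(4)[OF lunit_iso[of d], of D] tensor_inv(2)[OF runit_iso[of D], of d] by simp
  qed simp_all
  have "inv_mor T (assoc T D X (D \<boxtimes> d)) \<cdot>
      (D \<ltimes> (assoc T X D d \<cdot> (coev \<rtimes> d) \<cdot> inv_mor T (lunit T d)))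
      = inv_mor T (assoc T D X (D \<boxtimes> d)) \<cdot> ((D \<ltimes> assoc T X D d) \<cdot>
        ((D \<ltimes> (coev \<rtimes> d)) \<cdot> (D \<ltimes> inv_mor T (lunit T d))))"
    by (simp add: interchange)
  also have "\<dots> = assoc T (D \<boxtimes> X) D d \<cdot> ((?ia \<cdot> inv_mor T (assoc T D (X \<boxtimes> D) d)) \<cdot>
        ((D \<ltimes> (coev \<rtimes> d)) \<cdot> (D \<ltimes> inv_mor T (lunit T d))))"
    by (rule comp_tail[OF p]) simp_all
  also have "\<dots> = assoc T (D \<boxtimes> X) D d \<cdot> (?ia \<cdot> (inv_mor T (assoc T D (X \<boxtimes> D) d) \<cdot>
        ((D \<ltimes> (coev \<rtimes> d)) \<cdot> (D \<ltimes> inv_mor T (lunit T d)))))"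
    by simp
  also have "inv_mor T (assoc T D (X \<boxtimes> D) d) \<cdot>
        ((D \<ltimes> (coev \<rtimes> d)) \<cdot> (D \<ltimes> inv_mor T (lunit T d)))
      = ?c \<cdot> (inv_mor T (assoc T D ?I d) \<cdot> (D \<ltimes> inv_mor T (lunit T d)))"
    by (rule comp_tail[OF n1]) simp_all
  also have "\<dots> = ?c \<cdot> ?r" unfolding tr ..
  finally have R: "inv_mor T (assoc T D X (D \<boxtimes> d)) \<cdot>
      (D \<ltimes> (assoc T X D d \<cdot> (coev \<rtimes> d) \<cdot> inv_mor T (lunit T d)))
      = assoc T (D \<boxtimes> X) D d \<cdot> (?ia \<cdot> (?c \<cdot> ?r))" .
  have "(lunit T (D \<boxtimes> d) \<cdot> (ev \<rtimes> (D \<boxtimes> d)) \<cdot> inv_mor T (assoc T D X (D \<boxtimes> d))) \<cdot>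
      (D \<ltimes> (assoc T X D d \<cdot> (coev \<rtimes> d) \<cdot> inv_mor T (lunit T d)))
      = lunit T (D \<boxtimes> d) \<cdot> ((ev \<rtimes> (D \<boxtimes> d)) \<cdot> (inv_mor T (assoc T D X (D \<boxtimes> d)) \<cdot>
      (D \<ltimes> (assoc T X D d \<cdot> (coev \<rtimes> d) \<cdot> inv_mor T (lunit T d)))))"
    by simp
  also have "\<dots> = lunit T (D \<boxtimes> d) \<cdot> ((ev \<rtimes> (D \<boxtimes> d)) \<cdot> (assoc T (D \<boxtimes> X) D d \<cdot> (?ia \<cdot> (?c \<cdot> ?r))))"
    unfolding R ..
  also have "(ev \<rtimes> (D \<boxtimes> d)) \<cdot> (assoc T (D \<boxtimes> X) D d \<cdot> (?ia \<cdot> (?c \<cdot> ?r)))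
      = assoc T ?I D d \<cdot> (?e \<cdot> (?ia \<cdot> (?c \<cdot> ?r)))"
    by (rule comp_tail[OF n2]) simp_all
  also have "lunit T (D \<boxtimes> d) \<cdot> (assoc T ?I D d \<cdot> (?e \<cdot> (?ia \<cdot> (?c \<cdot> ?r))))
      = (lunit T D \<rtimes> d) \<cdot> (?e \<cdot> (?ia \<cdot> (?c \<cdot> ?r)))"
    by (rule comp_tail1[OF lunit_tensor]) simp_all
  also have "\<dots> = ((lunit T D \<cdot> (ev \<rtimes> D) \<cdot> inv_mor T (assoc T D X D) \<cdot> (D \<ltimes> coev))
      \<cdot> inv_mor T (runit T D)) \<rtimes> d"
    by (simp add: interchange)
  also have "\<dots> = ident T (D \<boxtimes> d)" unfolding zz by simp
  finally show ?thesis .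
qed

text \<open>The mirror image: \<open>d\<close> stands on the left, and \<open>runit_tensor\<close>
  takes the place of \<open>lunit_tensor\<close>.\<close>

lemma zigzag_right:
  assumes [simp]: "X \<in> obj T" "D \<in> obj T" "d \<in> obj T"
    and ev: "ev \<in> homset T (D \<boxtimes> X) (unit_obj T)" and coev: "coev \<in> homset T (unit_obj T) (X \<boxtimes> D)"
    and zz: "runit T X \<cdot> (X \<ltimes> ev) \<cdot> assoc T X D X \<cdot> (coev \<rtimes> X) = lunit T X"
  shows "(runit T (d \<boxtimes> X) \<cdot> ((d \<boxtimes> X) \<ltimes> ev) \<cdot> assoc T (d \<boxtimes> X) D X) \<cdot>
    ((inv_mor T (assoc T d X D) \<cdot> (d \<ltimes> coev) \<cdot> inv_mor T (runit T d)) \<rtimes> X)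
    = ident T (d \<boxtimes> X)"
proof -
  let ?I = "unit_obj T"
  have [simp]: "ev \<in> arr T" "src T ev = D \<boxtimes> X" "tgt T ev = ?I"
    "coev \<in> arr T" "src T coev = ?I" "tgt T coev = X \<boxtimes> D"
    using ev coev by (simp_all add: homset_iff)
  let ?a = "d \<ltimes> assoc T X D X"
  let ?c = "d \<ltimes> (coev \<rtimes> X)"
  let ?e = "d \<ltimes> (X \<ltimes> ev)"
  let ?l = "d \<ltimes> inv_mor T (lunit T X)"
  have p: "assoc T (d \<boxtimes> X) D X \<cdot> (inv_mor T (assoc T d X D) \<rtimes> X)
      = inv_mor T (assoc T d X (D \<boxtimes> X)) \<cdot> (?a \<cdot> assoc T d (X \<boxtimes> D) X)"
  proof (rule isos_mono[OF assoc_iso[of d X "D \<boxtimes> X"]])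
    have *: "assoc T d X (D \<boxtimes> X) \<cdot> assoc T (d \<boxtimes> X) D X
        = ?a \<cdot> (assoc T d (X \<boxtimes> D) X \<cdot> (assoc T d X D \<rtimes> X))"
      using pentagon[of d X D X] by simp
    have "assoc T d X (D \<boxtimes> X) \<cdot> (assoc T (d \<boxtimes> X) D X \<cdot> (inv_mor T (assoc T d X D) \<rtimes> X))
      = ?a \<cdot> ((assoc T d (X \<boxtimes> D) X \<cdot> (assoc T d X D \<rtimes> X)) \<cdot> (inv_mor T (assoc T d X D) \<rtimes> X))"
      by (rule comp_tail[OF *]) simp_all
    then show "assoc T d X (D \<boxtimes> X) \<cdot> (assoc T (d \<boxtimes> X) D X \<cdot> (inv_mor T (assoc T d X D) \<rtimes> X))
      = assoc T d X (D \<boxtimes> X) \<cdot> (inv_mor T (assoc T d X (D \<boxtimes> X)) \<cdot> (?a \<cdot> assoc T d (X \<boxtimes> D) X))"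
      using tensor_inv(2)[OF assoc_iso[of d X D], of X] by simp
  qed simp_all
  have n1: "assoc T d (X \<boxtimes> D) X \<cdot> ((d \<ltimes> coev) \<rtimes> X) = ?c \<cdot> assoc T d ?I X"
    using assoc_nat[of "ident T d" coev "ident T X"] by simp
  have n2: "((d \<boxtimes> X) \<ltimes> ev) \<cdot> inv_mor T (assoc T d X (D \<boxtimes> X)) = inv_mor T (assoc T d X ?I) \<cdot> ?e"
    using assoc_inv_nat[of "ident T d" "ident T X" ev] by simp
  have tr: "assoc T d ?I X \<cdot> (inv_mor T (runit T d) \<rtimes> X) = ?l"
  proof (rule isos_mono[OF tensor_isos[OF isos_ident lunit_iso, of d X]])
    have "(d \<ltimes> lunit T X) \<cdot> (assoc T d ?I X \<cdot> (inv_mor T (runit T d) \<rtimes> X))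
      = (runit T d \<rtimes> X) \<cdot> (inv_mor T (runit T d) \<rtimes> X)"
      by (rule comp_tail1[OF triangle]) simp_all
    then show "(d \<ltimes> lunit T X) \<cdot> (assoc T d ?I X \<cdot> (inv_mor T (runit T d) \<rtimes> X))
      = (d \<ltimes> lunit T X) \<cdot> ?l"
      using tensor_inv(4)[OF lunit_iso[of X], of d] tensor_inv(2)[OF runit_iso[of d], of X] by simp
  qed simp_all
  have k: "runit T (d \<boxtimes> X) \<cdot> inv_mor T (assoc T d X ?I) = d \<ltimes> runit T X"
    unfolding runit_tensor[OF assms(3,1), symmetric] by simp
  have "assoc T (d \<boxtimes> X) D X \<cdot>
      ((inv_mor T (assoc T d X D) \<cdot> (d \<ltimes> coev) \<cdot> inv_mor T (runit T d)) \<rtimes> X)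
      = assoc T (d \<boxtimes> X) D X \<cdot> ((inv_mor T (assoc T d X D) \<rtimes> X) \<cdot>
        (((d \<ltimes> coev) \<rtimes> X) \<cdot> (inv_mor T (runit T d) \<rtimes> X)))"
    by (simp add: interchange)
  also have "\<dots> = inv_mor T (assoc T d X (D \<boxtimes> X)) \<cdot> ((?a \<cdot> assoc T d (X \<boxtimes> D) X) \<cdot>
        (((d \<ltimes> coev) \<rtimes> X) \<cdot> (inv_mor T (runit T d) \<rtimes> X)))"
    by (rule comp_tail[OF p]) simp_all
  also have "\<dots> = inv_mor T (assoc T d X (D \<boxtimes> X)) \<cdot> (?a \<cdot> (assoc T d (X \<boxtimes> D) X \<cdot>
        (((d \<ltimes> coev) \<rtimes> X) \<cdot> (inv_mor T (runit T d) \<rtimes> X))))"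
    by simp
  also have "assoc T d (X \<boxtimes> D) X \<cdot>
        (((d \<ltimes> coev) \<rtimes> X) \<cdot> (inv_mor T (runit T d) \<rtimes> X))
      = ?c \<cdot> (assoc T d ?I X \<cdot> (inv_mor T (runit T d) \<rtimes> X))"
    by (rule comp_tail[OF n1]) simp_all
  also have "\<dots> = ?c \<cdot> ?l" unfolding tr ..
  finally have R: "assoc T (d \<boxtimes> X) D X \<cdot>
      ((inv_mor T (assoc T d X D) \<cdot> (d \<ltimes> coev) \<cdot> inv_mor T (runit T d)) \<rtimes> X)
      = inv_mor T (assoc T d X (D \<boxtimes> X)) \<cdot> (?a \<cdot> (?c \<cdot> ?l))" .
  have "(runit T (d \<boxtimes> X) \<cdot> ((d \<boxtimes> X) \<ltimes> ev) \<cdot> assoc T (d \<boxtimes> X) D X) \<cdot>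
      ((inv_mor T (assoc T d X D) \<cdot> (d \<ltimes> coev) \<cdot> inv_mor T (runit T d)) \<rtimes> X)
      = runit T (d \<boxtimes> X) \<cdot> (((d \<boxtimes> X) \<ltimes> ev) \<cdot> (assoc T (d \<boxtimes> X) D X \<cdot>
      ((inv_mor T (assoc T d X D) \<cdot> (d \<ltimes> coev) \<cdot> inv_mor T (runit T d)) \<rtimes> X)))"
    by simp
  also have "\<dots> = runit T (d \<boxtimes> X) \<cdot> (((d \<boxtimes> X) \<ltimes> ev) \<cdot>
      (inv_mor T (assoc T d X (D \<boxtimes> X)) \<cdot> (?a \<cdot> (?c \<cdot> ?l))))"
    unfolding R ..
  also have "((d \<boxtimes> X) \<ltimes> ev) \<cdot> (inv_mor T (assoc T d X (D \<boxtimes> X)) \<cdot> (?a \<cdot> (?c \<cdot> ?l)))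
      = inv_mor T (assoc T d X ?I) \<cdot> (?e \<cdot> (?a \<cdot> (?c \<cdot> ?l)))"
    by (rule comp_tail[OF n2]) simp_all
  also have "runit T (d \<boxtimes> X) \<cdot> (inv_mor T (assoc T d X ?I) \<cdot> (?e \<cdot> (?a \<cdot> (?c \<cdot> ?l))))
      = (d \<ltimes> runit T X) \<cdot> (?e \<cdot> (?a \<cdot> (?c \<cdot> ?l)))"
    by (rule comp_tail1[OF k]) simp_all
  also have "\<dots> = d \<ltimes> ((runit T X \<cdot> (X \<ltimes> ev) \<cdot> assoc T X D X \<cdot> (coev \<rtimes> X))
      \<cdot> inv_mor T (lunit T X))"
    by (simp add: interchange)
  also have "\<dots> = ident T (d \<boxtimes> X)" unfolding zz by simp
  finally show ?thesis .
qed

text \<open>\<open>\<eta>\<close> and \<open>\<epsilon>\<close> are the unit and counit of \<open>D \<otimes> - \<stileturn> X \<otimes> -\<close>, and below of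
  \<open>- \<otimes> X \<stileturn> - \<otimes> D\<close>.\<close>

lemma dual_left_adjoint:
  assumes "is_dual T X D"
  obtains \<eta> \<epsilon> where
    "\<forall>E\<in>obj T. \<eta> E \<in> homset T E (X \<boxtimes> (D \<boxtimes> E))"
    "\<forall>E\<in>obj T. \<epsilon> E \<in> homset T (D \<boxtimes> (X \<boxtimes> E)) E"
    "\<forall>f E E'. f \<in> homset T E E' \<longrightarrow> \<eta> E' \<cdot> f = (X \<ltimes> (D \<ltimes> f)) \<cdot> \<eta> E"
    "\<forall>f E E'. f \<in> homset T E E' \<longrightarrow> \<epsilon> E' \<cdot> (D \<ltimes> (X \<ltimes> f)) = f \<cdot> \<epsilon> E"
    "\<forall>E\<in>obj T. (X \<ltimes> \<epsilon> E) \<cdot> \<eta> (X \<boxtimes> E) = ident T (X \<boxtimes> E)"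
    "\<forall>E\<in>obj T. \<epsilon> (D \<boxtimes> E) \<cdot> (D \<ltimes> \<eta> E) = ident T (D \<boxtimes> E)"
proof -
  let ?I = "unit_obj T"
  obtain ev coev where o [simp]: "X \<in> obj T" "D \<in> obj T"
    and ev: "ev \<in> homset T (D \<boxtimes> X) ?I" and coev: "coev \<in> homset T ?I (X \<boxtimes> D)"
    and zz1: "runit T X \<cdot> (X \<ltimes> ev) \<cdot> assoc T X D X \<cdot> (coev \<rtimes> X) = lunit T X"
    and zz2: "lunit T D \<cdot> (ev \<rtimes> D) \<cdot> inv_mor T (assoc T D X D) \<cdot> (D \<ltimes> coev) = runit T D"
    using assms unfolding is_dual_def by blast
  have [simp]: "ev \<in> arr T" "src T ev = D \<boxtimes> X" "tgt T ev = ?I"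
    "coev \<in> arr T" "src T coev = ?I" "tgt T coev = X \<boxtimes> D"
    using ev coev by (simp_all add: homset_iff)
  let ?\<eta> = "\<lambda>E. assoc T X D E \<cdot> (coev \<rtimes> E) \<cdot> inv_mor T (lunit T E)"
  let ?\<epsilon> = "\<lambda>E. lunit T E \<cdot> (ev \<rtimes> E) \<cdot> inv_mor T (assoc T D X E)"
  show ?thesis
  proof (rule that[of ?\<eta> ?\<epsilon>]; intro ballI allI impI)
    show "?\<eta> E \<in> homset T E (X \<boxtimes> (D \<boxtimes> E))" "?\<epsilon> E \<in> homset T (D \<boxtimes> (X \<boxtimes> E)) E" if "E \<in> obj T" for E
      using that by (simp_all add: homset_iff)
    show "(X \<ltimes> ?\<epsilon> E) \<cdot> ?\<eta> (X \<boxtimes> E) = ident T (X \<boxtimes> E)" if "E \<in> obj T" for E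
      by (rule zigzag_left1[OF o that ev coev zz1])
    show "?\<epsilon> (D \<boxtimes> E) \<cdot> (D \<ltimes> ?\<eta> E) = ident T (D \<boxtimes> E)" if "E \<in> obj T" for E
      by (rule zigzag_left2[OF o that ev coev zz2])
    fix f E E' assume "f \<in> homset T E E'"
    then have [simp]: "f \<in> arr T" "src T f = E" "tgt T f = E'" "E \<in> obj T" "E' \<in> obj T"
      using homset_objs by (auto simp: homset_iff)
    have "?\<eta> E' \<cdot> f = assoc T X D E' \<cdot> ((coev \<rtimes> E') \<cdot> (inv_mor T (lunit T E') \<cdot> f))"
      by simp
    also have "inv_mor T (lunit T E') \<cdot> f = (?I \<ltimes> f) \<cdot> inv_mor T (lunit T E)"
      by (rule lunit_inv_nat) simp_all
    also have "(coev \<rtimes> E') \<cdot> ((?I \<ltimes> f) \<cdot> inv_mor T (lunit T E))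
        = ((ident T X \<rtimes> D) \<boxtimes>\<^sub>m f) \<cdot> ((coev \<rtimes> E) \<cdot> inv_mor T (lunit T E))"
      by (simp add: interchange_tail)
    also have "assoc T X D E' \<cdot> (((ident T X \<rtimes> D) \<boxtimes>\<^sub>m f) \<cdot> ((coev \<rtimes> E) \<cdot> inv_mor T (lunit T E)))
        = (X \<ltimes> (D \<ltimes> f)) \<cdot> ?\<eta> E"
      by (rule comp_tail[OF assoc_nat]) simp_all
    finally show "?\<eta> E' \<cdot> f = (X \<ltimes> (D \<ltimes> f)) \<cdot> ?\<eta> E" .
    have "?\<epsilon> E' \<cdot> (D \<ltimes> (X \<ltimes> f))
        = lunit T E' \<cdot> ((ev \<rtimes> E') \<cdot> (inv_mor T (assoc T D X E') \<cdot> (D \<ltimes> (X \<ltimes> f))))"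
      by simp
    also have "inv_mor T (assoc T D X E') \<cdot> (D \<ltimes> (X \<ltimes> f))
        = ((ident T D \<rtimes> X) \<boxtimes>\<^sub>m f) \<cdot> inv_mor T (assoc T D X E)"
      by (rule assoc_inv_nat) simp_all
    also have "(ev \<rtimes> E') \<cdot> (((ident T D \<rtimes> X) \<boxtimes>\<^sub>m f) \<cdot> inv_mor T (assoc T D X E))
        = (?I \<ltimes> f) \<cdot> ((ev \<rtimes> E) \<cdot> inv_mor T (assoc T D X E))"
      by (simp add: interchange_tail)
    also have "lunit T E' \<cdot> ((?I \<ltimes> f) \<cdot> ((ev \<rtimes> E) \<cdot> inv_mor T (assoc T D X E))) = f \<cdot> ?\<epsilon> E"
      by (rule comp_tail[OF lunit_nat]) simp_all
    finally show "?\<epsilon> E' \<cdot> (D \<ltimes> (X \<ltimes> f)) = f \<cdot> ?\<epsilon> E" .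
  qed
qed

lemma dual_right_adjoint:
  assumes "is_dual T X D"
  obtains \<eta> \<epsilon> where
    "\<forall>E\<in>obj T. \<eta> E \<in> homset T E ((E \<boxtimes> X) \<boxtimes> D)"
    "\<forall>E\<in>obj T. \<epsilon> E \<in> homset T ((E \<boxtimes> D) \<boxtimes> X) E"
    "\<forall>f E E'. f \<in> homset T E E' \<longrightarrow> \<epsilon> E' \<cdot> ((f \<rtimes> D) \<rtimes> X) = f \<cdot> \<epsilon> E"
    "\<forall>E\<in>obj T. \<epsilon> (E \<boxtimes> X) \<cdot> (\<eta> E \<rtimes> X) = ident T (E \<boxtimes> X)"
proof -
  let ?I = "unit_obj T"
  obtain ev coev where o [simp]: "X \<in> obj T" "D \<in> obj T"
    and ev: "ev \<in> homset T (D \<boxtimes> X) ?I" and coev: "coev \<in> homset T ?I (X \<boxtimes> D)"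
    and zz1: "runit T X \<cdot> (X \<ltimes> ev) \<cdot> assoc T X D X \<cdot> (coev \<rtimes> X) = lunit T X"
    using assms unfolding is_dual_def by blast
  have [simp]: "ev \<in> arr T" "src T ev = D \<boxtimes> X" "tgt T ev = ?I"
    "coev \<in> arr T" "src T coev = ?I" "tgt T coev = X \<boxtimes> D"
    using ev coev by (simp_all add: homset_iff)
  let ?\<eta> = "\<lambda>E. inv_mor T (assoc T E X D) \<cdot> (E \<ltimes> coev) \<cdot> inv_mor T (runit T E)"
  let ?\<epsilon> = "\<lambda>E. runit T E \<cdot> (E \<ltimes> ev) \<cdot> assoc T E D X"
  show ?thesis
  proof (rule that[of ?\<eta> ?\<epsilon>]; intro ballI allI impI)
    show "?\<eta> E \<in> homset T E ((E \<boxtimes> X) \<boxtimes> D)" "?\<epsilon> E \<in> homset T ((E \<boxtimes> D) \<boxtimes> X) E" if "E \<in> obj T" for E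
      using that by (simp_all add: homset_iff)
    show "?\<epsilon> (E \<boxtimes> X) \<cdot> (?\<eta> E \<rtimes> X) = ident T (E \<boxtimes> X)" if "E \<in> obj T" for E
      by (rule zigzag_right[OF o that ev coev zz1])
    fix f E E' assume "f \<in> homset T E E'"
    then have [simp]: "f \<in> arr T" "src T f = E" "tgt T f = E'" "E \<in> obj T" "E' \<in> obj T"
      using homset_objs by (auto simp: homset_iff)
    have "?\<epsilon> E' \<cdot> ((f \<rtimes> D) \<rtimes> X)
        = runit T E' \<cdot> ((E' \<ltimes> ev) \<cdot> (assoc T E' D X \<cdot> ((f \<rtimes> D) \<rtimes> X)))"
      by simp
    also have "assoc T E' D X \<cdot> ((f \<rtimes> D) \<rtimes> X)
        = (f \<boxtimes>\<^sub>m (ident T D \<rtimes> X)) \<cdot> assoc T E D X"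
      by (rule assoc_nat) simp_all
    also have "(E' \<ltimes> ev) \<cdot> ((f \<boxtimes>\<^sub>m (ident T D \<rtimes> X)) \<cdot> assoc T E D X)
        = (f \<rtimes> ?I) \<cdot> ((E \<ltimes> ev) \<cdot> assoc T E D X)"
      by (simp add: interchange_tail)
    also have "runit T E' \<cdot> ((f \<rtimes> ?I) \<cdot> ((E \<ltimes> ev) \<cdot> assoc T E D X)) = f \<cdot> ?\<epsilon> E"
      by (rule comp_tail[OF runit_nat]) simp_all
    finally show "?\<epsilon> E' \<cdot> ((f \<rtimes> D) \<rtimes> X) = f \<cdot> ?\<epsilon> E" .
  qed
qed

end

section \<open>Tensor products of coproducts\<close>

context closed_symmetric_monoidal_category
begin

text \<open>Closedness makes \<open>- \<otimes> W\<close> a left adjoint: maps out of the objects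
  \<open>X i \<boxtimes> W\<close> are transposed to maps into an internal hom and assembled
  there.\<close>

lemma coproduct_tensor:
  assumes "is_coproduct T I X S \<iota>" and W [simp]: "W \<in> obj T"
  shows "is_coproduct T I (\<lambda>i. X i \<boxtimes> W) (S \<boxtimes> W) (\<lambda>i. \<iota> i \<rtimes> W)"
proof (rule coproductI)
  note a = coproduct_arr[OF assms(1)]
  show "S \<boxtimes> W \<in> obj T" using a by simp
  show "\<iota> i \<rtimes> W \<in> homset T (X i \<boxtimes> W) (S \<boxtimes> W)" if "i \<in> I" for i
    using a that by (simp add: homset_iff)
next
  note a = coproduct_arr[OF assms(1)]
  fix Y f assume Y: "Y \<in> obj T" and f: "\<And>i. i \<in> I \<Longrightarrow> f i \<in> homset T (X i \<boxtimes> W) Y"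
  obtain H ev where H: "is_internal_hom T W Y H ev" using internal_hom_exists[OF W Y] by blast
  then have ev: "H \<in> obj T" "ev \<in> arr T" "src T ev = H \<boxtimes> W" "tgt T ev = Y"
    by (auto simp: is_internal_hom_def homset_iff)
  have "\<exists>g. g \<in> homset T (X i) H \<and> ev \<cdot> (g \<rtimes> W) = f i" if "i \<in> I" for i
    using H a(5)[OF that] f[OF that] unfolding is_internal_hom_def by blast
  then obtain g where g: "\<And>i. i \<in> I \<Longrightarrow> g i \<in> homset T (X i) H"
    "\<And>i. i \<in> I \<Longrightarrow> ev \<cdot> (g i \<rtimes> W) = f i" by metis
  obtain k where k: "k \<in> homset T S H" "\<And>i. i \<in> I \<Longrightarrow> k \<cdot> \<iota> i = g i"
    using coproduct_ex[OF assms(1) ev(1), of g] g(1) by blast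
  note k' = k(1)[unfolded homset_iff]
  have "(ev \<cdot> (k \<rtimes> W)) \<cdot> (\<iota> i \<rtimes> W) = f i" if i: "i \<in> I" for i
    using k(2)[OF i] g(2)[OF i] by (simp add: k' ev a i interchange)
  moreover have "ev \<cdot> (k \<rtimes> W) \<in> homset T (S \<boxtimes> W) Y" by (simp add: homset_iff k' ev)
  ultimately show "\<exists>g. g \<in> homset T (S \<boxtimes> W) Y \<and> (\<forall>i\<in>I. g \<cdot> (\<iota> i \<rtimes> W) = f i)" by blast
next
  note a = coproduct_arr[OF assms(1)]
  fix Y g h assume g: "g \<in> homset T (S \<boxtimes> W) Y" and h: "h \<in> homset T (S \<boxtimes> W) Y"
    and eq: "\<And>i. i \<in> I \<Longrightarrow> g \<cdot> (\<iota> i \<rtimes> W) = h \<cdot> (\<iota> i \<rtimes> W)"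
  have Y: "Y \<in> obj T" using homset_objs[OF g] by simp
  obtain H ev where H: "is_internal_hom T W Y H ev" using internal_hom_exists[OF W Y] by blast
  then have ev: "H \<in> obj T" "ev \<in> arr T" "src T ev = H \<boxtimes> W" "tgt T ev = Y"
    by (auto simp: is_internal_hom_def homset_iff)
  obtain g' where g': "g' \<in> homset T S H" "ev \<cdot> (g' \<rtimes> W) = g"
    using H a(1) g unfolding is_internal_hom_def by blast
  obtain h' where h': "h' \<in> homset T S H" "ev \<cdot> (h' \<rtimes> W) = h"
    using H a(1) h unfolding is_internal_hom_def by blast
  have *: "ev \<cdot> ((k' \<cdot> \<iota> i) \<rtimes> W) = k \<cdot> (\<iota> i \<rtimes> W)"
    if "k' \<in> homset T S H" "ev \<cdot> (k' \<rtimes> W) = k" and i: "i \<in> I" for k k' i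
    unfolding that(2)[symmetric] by (simp add: that(1)[unfolded homset_iff] ev a i interchange)
  have "g' = h'"
  proof (rule coproduct_eq[OF assms(1) g'(1) h'(1)])
    fix i assume i: "i \<in> I"
    have gi: "g' \<cdot> \<iota> i \<in> homset T (X i) H" "h' \<cdot> \<iota> i \<in> homset T (X i) H"
      using g'(1) h'(1) a i by (simp_all add: homset_iff)
    have hi: "h \<cdot> (\<iota> i \<rtimes> W) \<in> homset T (X i \<boxtimes> W) Y"
      using h a i by (simp add: homset_iff)
    have "\<exists>!k. k \<in> homset T (X i) H \<and> ev \<cdot> (k \<rtimes> W) = h \<cdot> (\<iota> i \<rtimes> W)"
      using H a(5)[OF i] hi unfolding is_internal_hom_def by blast
    then show "g' \<cdot> \<iota> i = h' \<cdot> \<iota> i"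
      using *[OF g' i] *[OF h' i] eq[OF i] gi by metis
  qed
  then show "g = h" using g' h' by simp
qed

lemma coproduct_tensor_left:
  assumes "is_coproduct T I X S \<iota>" and [simp]: "W \<in> obj T"
  shows "is_coproduct T I (\<lambda>i. W \<boxtimes> X i) (W \<boxtimes> S) (\<lambda>i. W \<ltimes> \<iota> i)"
proof -
  note a = coproduct_arr[OF assms(1)]
  have "is_coproduct T I (\<lambda>i. W \<boxtimes> X i) (W \<boxtimes> S)
      (\<lambda>i. braid T S W \<cdot> ((\<iota> i \<rtimes> W) \<cdot> braid T W (X i)))"
    by (rule coproduct_iso[OF coproduct_tensor[OF assms]]) (simp_all add: a)
  then show ?thesis
  proof (rule coproduct_cong)
    fix i assume i: "i \<in> I"
    have "(\<iota> i \<rtimes> W) \<cdot> braid T W (X i) = braid T W S \<cdot> (W \<ltimes> \<iota> i)"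
      by (rule braid_nat[symmetric]) (simp_all add: a i)
    then show "W \<ltimes> \<iota> i = braid T S W \<cdot> ((\<iota> i \<rtimes> W) \<cdot> braid T W (X i))"
      by (simp add: a i)
  qed
qed

end

section \<open>Exact tensoring and compactness of tensor products\<close>

context closed_tt_category
begin

lemma plus_tensor:
  "\<lbrakk>f \<in> arr T; g \<in> arr T; src T f = src T g; tgt T f = tgt T g; W \<in> obj T\<rbrakk>
    \<Longrightarrow> (f \<boxplus> g) \<rtimes> W = (f \<rtimes> W) \<boxplus> (g \<rtimes> W)"
  using tensor_plus[of f "src T f" "tgt T f" g W] by (simp add: homset_iff)

lemma zero_tensor_ident [simp]:
  assumes [simp]: "X \<in> obj T" "Y \<in> obj T" "W \<in> obj T"
  shows "zero_mor T X Y \<rtimes> W = zero_mor T (X \<boxtimes> W) (Y \<boxtimes> W)"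
  by (rule zero_if_idem)
    (use plus_tensor[of "zero_mor T X Y" "zero_mor T X Y" W] in \<open>simp_all add: homset_iff\<close>)

text \<open>The additivity axiom concerns \<open>- \<otimes> W\<close>; conjugation with the
  braiding transfers its consequences to \<open>W \<otimes> -\<close>.\<close>

lemma ident_tensor_braid:
  assumes [simp]: "f \<in> arr T" "W \<in> obj T"
  shows "W \<ltimes> f = braid T (tgt T f) W \<cdot> ((f \<rtimes> W) \<cdot> braid T W (src T f))"
proof -
  have "(f \<rtimes> W) \<cdot> braid T W (src T f) = braid T W (tgt T f) \<cdot> (W \<ltimes> f)"
    by (rule braid_nat[symmetric]) simp_all
  then show ?thesis by simp
qed

lemma ident_tensor_zero [simp]:
  assumes [simp]: "X \<in> obj T" "Y \<in> obj T" "W \<in> obj T"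
  shows "W \<ltimes> zero_mor T X Y = zero_mor T (W \<boxtimes> X) (W \<boxtimes> Y)"
  by (simp add: ident_tensor_braid)

lemma zero_tensor [simp]:
  assumes [simp]: "X \<in> obj T" "Y \<in> obj T" "f \<in> arr T"
  shows "zero_mor T X Y \<boxtimes>\<^sub>m f = zero_mor T (X \<boxtimes> src T f) (Y \<boxtimes> tgt T f)"
    "f \<boxtimes>\<^sub>m zero_mor T X Y = zero_mor T (src T f \<boxtimes> X) (tgt T f \<boxtimes> Y)"
proof -
  have "zero_mor T X Y \<boxtimes>\<^sub>m f = (zero_mor T X Y \<rtimes> (tgt T f)) \<cdot> (X \<ltimes> f)"
    by (subst interchange) simp_all
  then show "zero_mor T X Y \<boxtimes>\<^sub>m f = zero_mor T (X \<boxtimes> src T f) (Y \<boxtimes> tgt T f)" by simp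
  have "f \<boxtimes>\<^sub>m zero_mor T X Y = (f \<rtimes> Y) \<cdot> ((src T f) \<ltimes> zero_mor T X Y)"
    by (subst interchange) simp_all
  then show "f \<boxtimes>\<^sub>m zero_mor T X Y = zero_mor T (src T f \<boxtimes> X) (tgt T f \<boxtimes> Y)" by simp
qed

lemma coproj_tensor:
  assumes "is_coproduct T I X S \<iota>" and [simp]: "W \<in> obj T"
  shows "coproj I (\<lambda>i. X i \<boxtimes> W) (S \<boxtimes> W) (\<lambda>i. \<iota> i \<rtimes> W) F = coproj I X S \<iota> F \<rtimes> W"
proof (rule coproj_unique[OF coproduct_tensor[OF assms], symmetric])
  note a = coproduct_arr[OF assms(1)] coproj_arr[OF assms(1)]
  show "coproj I X S \<iota> F \<rtimes> W \<in> homset T (S \<boxtimes> W) (S \<boxtimes> W)" by (simp add: homset_iff a)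
  show "(coproj I X S \<iota> F \<rtimes> W) \<cdot> (\<iota> i \<rtimes> W)
      = (if i \<in> F then \<iota> i \<rtimes> W else zero_mor T (X i \<boxtimes> W) (S \<boxtimes> W))" if i: "i \<in> I" for i
    by (simp add: interchange a i coproj_inj[OF assms(1) i])
qed

lemma coproj_tensor_left:
  assumes "is_coproduct T I X S \<iota>" and [simp]: "W \<in> obj T"
  shows "coproj I (\<lambda>i. W \<boxtimes> X i) (W \<boxtimes> S) (\<lambda>i. W \<ltimes> \<iota> i) F = W \<ltimes> coproj I X S \<iota> F"
proof (rule coproj_unique[OF coproduct_tensor_left[OF assms], symmetric])
  note a = coproduct_arr[OF assms(1)] coproj_arr[OF assms(1)]
  show "W \<ltimes> coproj I X S \<iota> F \<in> homset T (W \<boxtimes> S) (W \<boxtimes> S)" by (simp add: homset_iff a)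
  show "(W \<ltimes> coproj I X S \<iota> F) \<cdot> (W \<ltimes> \<iota> i)
      = (if i \<in> F then W \<ltimes> \<iota> i else zero_mor T (W \<boxtimes> X i) (W \<boxtimes> S))" if i: "i \<in> I" for i
    by (simp add: interchange a i coproj_inj[OF assms(1) i])
qed

lemma tensor_factor:
  assumes t: "exact_triangle T X Y Z f g h" and W: "W \<in> obj T"
    and u: "u \<in> homset T A (Y \<boxtimes> W)" "(g \<rtimes> W) \<cdot> u = zero_mor T A (Z \<boxtimes> W)"
  obtains v where "v \<in> homset T A (X \<boxtimes> W)" "u = (f \<rtimes> W) \<cdot> v"
  using factor_first[OF tensor_exact[OF t W] u] by blast

lemma tensor_factor_left:
  assumes t: "exact_triangle T X Y Z f g h" and W [simp]: "W \<in> obj T"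
    and u: "u \<in> homset T A (W \<boxtimes> Y)" "(W \<ltimes> g) \<cdot> u = zero_mor T A (W \<boxtimes> Z)"
  obtains v where "v \<in> homset T A (W \<boxtimes> X)" "u = (W \<ltimes> f) \<cdot> v"
proof -
  note a [simp] = exact_arr[OF t]
  have [simp]: "u \<in> arr T" "src T u = A" "tgt T u = W \<boxtimes> Y" "A \<in> obj T"
    using u(1) homset_objs by (auto simp: homset_iff)
  have "(g \<rtimes> W) \<cdot> (braid T W Y \<cdot> u) = braid T W Z \<cdot> ((W \<ltimes> g) \<cdot> u)"
    by (rule comp_tail[OF braid_nat[symmetric]]) simp_all
  then have "(g \<rtimes> W) \<cdot> (braid T W Y \<cdot> u) = zero_mor T A (Z \<boxtimes> W)" using u(2) by simp
  then obtain v where v: "v \<in> homset T A (X \<boxtimes> W)" "braid T W Y \<cdot> u = (f \<rtimes> W) \<cdot> v"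
    using tensor_factor[OF t W, of "braid T W Y \<cdot> u" A] by (auto simp: homset_iff)
  note v' = v(1)[unfolded homset_iff]
  have "u = braid T Y W \<cdot> ((f \<rtimes> W) \<cdot> v)"
    unfolding v(2)[symmetric] by simp
  also have "\<dots> = (W \<ltimes> f) \<cdot> (braid T X W \<cdot> v)"
    by (rule comp_tail[OF braid_nat]) (simp_all add: v')
  finally show ?thesis using that[of "braid T X W \<cdot> v"] by (simp add: homset_iff v')
qed

text \<open>\<open>t\<close> is the transpose of \<open>w\<close> under the adjunction between
  \<open>D \<otimes> -\<close> and \<open>X \<otimes> -\<close>, and \<open>n\<close> is the unit of
  that adjunction. Naturality of the counit turns the vanishing of
  \<open>(X \<ltimes> u) \<cdot> w\<close> into that of \<open>u \<cdot> t\<close>; this last clause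
  is the exactness that duality supplies.\<close>

lemma dual_factor:
  assumes "is_dual T X D" "w \<in> homset T E (X \<boxtimes> Y)" "Y \<in> obj T"
  obtains t n where "t \<in> homset T (D \<boxtimes> E) Y" "n \<in> homset T E (X \<boxtimes> (D \<boxtimes> E))"
    "w = (X \<ltimes> t) \<cdot> n"
    "\<And>u Z. u \<in> homset T Y Z \<Longrightarrow> (X \<ltimes> u) \<cdot> w = zero_mor T E (X \<boxtimes> Z)
      \<Longrightarrow> u \<cdot> t = zero_mor T (D \<boxtimes> E) Z"
proof -
  have o [simp]: "X \<in> obj T" "D \<in> obj T" "E \<in> obj T" "Y \<in> obj T"
    using assms homset_objs by (auto simp: is_dual_def)
  have [simp]: "w \<in> arr T" "src T w = E" "tgt T w = X \<boxtimes> Y" using assms(2) by (simp_all add: homset_iff)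
  obtain \<eta> \<epsilon> where adj:
    "\<forall>E\<in>obj T. \<eta> E \<in> homset T E (X \<boxtimes> (D \<boxtimes> E))"
    "\<forall>E\<in>obj T. \<epsilon> E \<in> homset T (D \<boxtimes> (X \<boxtimes> E)) E"
    "\<forall>f E E'. f \<in> homset T E E' \<longrightarrow> \<eta> E' \<cdot> f = (X \<ltimes> (D \<ltimes> f)) \<cdot> \<eta> E"
    "\<forall>f E E'. f \<in> homset T E E' \<longrightarrow> \<epsilon> E' \<cdot> (D \<ltimes> (X \<ltimes> f)) = f \<cdot> \<epsilon> E"
    "\<forall>E\<in>obj T. (X \<ltimes> \<epsilon> E) \<cdot> \<eta> (X \<boxtimes> E) = ident T (X \<boxtimes> E)"
    "\<forall>E\<in>obj T. \<epsilon> (D \<boxtimes> E) \<cdot> (D \<ltimes> \<eta> E) = ident T (D \<boxtimes> E)"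
    by (rule dual_left_adjoint[OF assms(1)])
  note \<eta> = adj(1)[rule_format]
    and \<epsilon> = adj(2)[rule_format]
    and n\<eta> = adj(3)[rule_format]
    and n\<epsilon> = adj(4)[rule_format]
    and z = adj(5)[rule_format]
  note a = \<eta>[OF o(3), unfolded homset_iff] \<epsilon>[OF o(4), unfolded homset_iff]
    \<eta>[OF tensor_in[OF o(1,4)], unfolded homset_iff]
  let ?t = "\<epsilon> Y \<cdot> (D \<ltimes> w)"
  show ?thesis
  proof (rule that[of ?t "\<eta> E"])
    show "?t \<in> homset T (D \<boxtimes> E) Y" by (simp add: homset_iff a)
    show "\<eta> E \<in> homset T E (X \<boxtimes> (D \<boxtimes> E))" using \<eta> by simp
    have "(X \<ltimes> ?t) \<cdot> \<eta> E
        = (X \<ltimes> \<epsilon> Y) \<cdot> ((X \<ltimes> (D \<ltimes> w)) \<cdot> \<eta> E)"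
      by (simp add: interchange_tail a)
    also have "\<dots> = (X \<ltimes> \<epsilon> Y) \<cdot> (\<eta> (X \<boxtimes> Y) \<cdot> w)" using n\<eta>[OF assms(2)] by simp
    also have "\<dots> = ident T (X \<boxtimes> Y) \<cdot> w" by (rule comp_tail1[OF z]) (simp_all add: a)
    finally show "w = (X \<ltimes> ?t) \<cdot> \<eta> E" by simp
    fix u Z assume u: "u \<in> homset T Y Z" and uw: "(X \<ltimes> u) \<cdot> w = zero_mor T E (X \<boxtimes> Z)"
    have [simp]: "u \<in> arr T" "src T u = Y" "tgt T u = Z" "Z \<in> obj T"
      using u homset_objs by (auto simp: homset_iff)
    note b = \<epsilon>[of Z, unfolded homset_iff]
    have "u \<cdot> ?t = \<epsilon> Z \<cdot> ((D \<ltimes> (X \<ltimes> u)) \<cdot> (D \<ltimes> w))"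
      by (rule comp_tail[OF n\<epsilon>[OF u, symmetric]]) (simp_all add: a b)
    also have "(D \<ltimes> (X \<ltimes> u)) \<cdot> (D \<ltimes> w) = zero_mor T (D \<boxtimes> E) (D \<boxtimes> (X \<boxtimes> Z))"
      by (simp add: interchange uw)
    finally show "u \<cdot> ?t = zero_mor T (D \<boxtimes> E) Z" by (simp add: b)
  qed
qed

text \<open>\<open>D \<otimes> -\<close> is left adjoint to \<open>X \<otimes> -\<close>, which
  preserves coproducts; a left adjoint of such a functor preserves compactness.\<close>

lemma compact_dual_tensor:
  assumes "is_dual T X D" "E \<in> compact_objs \<kappa> T"
  shows "D \<boxtimes> E \<in> compact_objs \<kappa> T"
proof (rule compactI)
  have o [simp]: "X \<in> obj T" "D \<in> obj T" "E \<in> obj T"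
    using assms by (auto simp: is_dual_def compact_objs_def)
  show "D \<boxtimes> E \<in> obj T" by simp
  obtain \<eta> \<epsilon> where adj:
    "\<forall>E\<in>obj T. \<eta> E \<in> homset T E (X \<boxtimes> (D \<boxtimes> E))"
    "\<forall>E\<in>obj T. \<epsilon> E \<in> homset T (D \<boxtimes> (X \<boxtimes> E)) E"
    "\<forall>f E E'. f \<in> homset T E E' \<longrightarrow> \<eta> E' \<cdot> f = (X \<ltimes> (D \<ltimes> f)) \<cdot> \<eta> E"
    "\<forall>f E E'. f \<in> homset T E E' \<longrightarrow> \<epsilon> E' \<cdot> (D \<ltimes> (X \<ltimes> f)) = f \<cdot> \<epsilon> E"
    "\<forall>E\<in>obj T. (X \<ltimes> \<epsilon> E) \<cdot> \<eta> (X \<boxtimes> E) = ident T (X \<boxtimes> E)"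
    "\<forall>E\<in>obj T. \<epsilon> (D \<boxtimes> E) \<cdot> (D \<ltimes> \<eta> E) = ident T (D \<boxtimes> E)"
    by (rule dual_left_adjoint[OF assms(1)])
  note \<eta> = adj(1)[rule_format]
    and \<epsilon> = adj(2)[rule_format]
    and n\<epsilon> = adj(4)[rule_format]
    and z = adj(6)[rule_format]
  note a = \<eta>[OF o(3), unfolded homset_iff] \<epsilon>[OF tensor_in[OF o(2,3)], unfolded homset_iff]
  fix I V S \<iota> m
  assume sm: "small_index \<kappa> I" and cop: "is_coproduct T I V S \<iota>" and m: "m \<in> homset T (D \<boxtimes> E) S"
  have [simp]: "m \<in> arr T" "src T m = D \<boxtimes> E" "tgt T m = S" "S \<in> obj T"
    using m homset_objs by (auto simp: homset_iff)
  note e = coproj_arr[OF cop] \<epsilon>[of S, unfolded homset_iff]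
  \<comment> \<open>A map out of \<open>D \<boxtimes> E\<close> is recovered from its transpose, so
    equality may be checked on transposes.\<close>
  have rec: "k = \<epsilon> S \<cdot> (D \<ltimes> ((X \<ltimes> k) \<cdot> \<eta> E))" if k: "k \<in> homset T (D \<boxtimes> E) S" for k
  proof -
    note k' = k[unfolded homset_iff]
    have "\<epsilon> S \<cdot> (D \<ltimes> ((X \<ltimes> k) \<cdot> \<eta> E))
        = \<epsilon> S \<cdot> ((D \<ltimes> (X \<ltimes> k)) \<cdot> (D \<ltimes> \<eta> E))"
      by (simp add: interchange a k')
    also have "\<dots> = k \<cdot> (\<epsilon> (D \<boxtimes> E) \<cdot> (D \<ltimes> \<eta> E))"
      by (rule comp_tail[OF n\<epsilon>[OF k]]) (simp_all add: a e k')
    finally show ?thesis using z[OF o(3)] k' by simp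
  qed
  let ?m = "(X \<ltimes> m) \<cdot> \<eta> E"
  have m': "?m \<in> homset T E (X \<boxtimes> S)" by (simp add: homset_iff a)
  obtain F where F: "finite F" "F \<subseteq> I" "(X \<ltimes> coproj I V S \<iota> F) \<cdot> ?m = ?m"
    using compact_factors[OF assms(2) sm coproduct_tensor_left[OF cop o(1)] m']
    unfolding coproj_tensor_left[OF cop o(1)] by blast
  have em: "coproj I V S \<iota> F \<cdot> m \<in> homset T (D \<boxtimes> E) S" by (simp add: homset_iff e)
  have "(X \<ltimes> (coproj I V S \<iota> F \<cdot> m)) \<cdot> \<eta> E = ?m"
    using F(3) by (simp add: interchange_tail e a)
  then have "coproj I V S \<iota> F \<cdot> m = m" using rec[OF em] rec[OF m] by simp
  with F show "\<exists>F. finite F \<and> F \<subseteq> I \<and> coproj I V S \<iota> F \<cdot> m = m" by blast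
qed

text \<open>The same argument for \<open>- \<otimes> X\<close>, which is left adjoint to the
  coproduct-preserving functor \<open>- \<otimes> D\<close>.\<close>

lemma compact_tensor_rigid:
  assumes "is_dual T X D" "E \<in> compact_objs \<kappa> T"
  shows "E \<boxtimes> X \<in> compact_objs \<kappa> T"
proof (rule compactI)
  have o [simp]: "X \<in> obj T" "D \<in> obj T" "E \<in> obj T"
    using assms by (auto simp: is_dual_def compact_objs_def)
  show "E \<boxtimes> X \<in> obj T" by simp
  obtain \<eta> \<epsilon> where adj:
    "\<forall>E\<in>obj T. \<eta> E \<in> homset T E ((E \<boxtimes> X) \<boxtimes> D)"
    "\<forall>E\<in>obj T. \<epsilon> E \<in> homset T ((E \<boxtimes> D) \<boxtimes> X) E"
    "\<forall>f E E'. f \<in> homset T E E' \<longrightarrow> \<epsilon> E' \<cdot> ((f \<rtimes> D) \<rtimes> X) = f \<cdot> \<epsilon> E"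
    "\<forall>E\<in>obj T. \<epsilon> (E \<boxtimes> X) \<cdot> (\<eta> E \<rtimes> X) = ident T (E \<boxtimes> X)"
    by (rule dual_right_adjoint[OF assms(1)])
  note \<eta> = adj(1)[rule_format]
    and \<epsilon> = adj(2)[rule_format]
    and n\<epsilon> = adj(3)[rule_format]
    and z = adj(4)[rule_format]
  note a = \<eta>[OF o(3), unfolded homset_iff] \<epsilon>[OF tensor_in[OF o(3,1)], unfolded homset_iff]
  fix I V S \<iota> m
  assume sm: "small_index \<kappa> I" and cop: "is_coproduct T I V S \<iota>" and m: "m \<in> homset T (E \<boxtimes> X) S"
  have [simp]: "m \<in> arr T" "src T m = E \<boxtimes> X" "tgt T m = S" "S \<in> obj T"
    using m homset_objs by (auto simp: homset_iff)
  note e = coproj_arr[OF cop] \<epsilon>[of S, unfolded homset_iff]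
  have rec: "k = \<epsilon> S \<cdot> (((k \<rtimes> D) \<cdot> \<eta> E) \<rtimes> X)" if k: "k \<in> homset T (E \<boxtimes> X) S" for k
  proof -
    note k' = k[unfolded homset_iff]
    have "\<epsilon> S \<cdot> (((k \<rtimes> D) \<cdot> \<eta> E) \<rtimes> X)
        = \<epsilon> S \<cdot> (((k \<rtimes> D) \<rtimes> X) \<cdot> (\<eta> E \<rtimes> X))"
      by (simp add: interchange a k')
    also have "\<dots> = k \<cdot> (\<epsilon> (E \<boxtimes> X) \<cdot> (\<eta> E \<rtimes> X))"
      by (rule comp_tail[OF n\<epsilon>[OF k]]) (simp_all add: a e k')
    finally show ?thesis using z[OF o(3)] k' by simp
  qed
  let ?m = "(m \<rtimes> D) \<cdot> \<eta> E"
  have m': "?m \<in> homset T E (S \<boxtimes> D)" by (simp add: homset_iff a)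
  obtain F where F: "finite F" "F \<subseteq> I" "(coproj I V S \<iota> F \<rtimes> D) \<cdot> ?m = ?m"
    using compact_factors[OF assms(2) sm coproduct_tensor[OF cop o(2)] m']
    unfolding coproj_tensor[OF cop o(2)] by blast
  have em: "coproj I V S \<iota> F \<cdot> m \<in> homset T (E \<boxtimes> X) S" by (simp add: homset_iff e)
  have "((coproj I V S \<iota> F \<cdot> m) \<rtimes> D) \<cdot> \<eta> E = ?m"
    using F(3) by (simp add: interchange_tail e a)
  then have "coproj I V S \<iota> F \<cdot> m = m" using rec[OF em] rec[OF m] by simp
  with F show "\<exists>F. finite F \<and> F \<subseteq> I \<and> coproj I V S \<iota> F \<cdot> m = m" by blast
qed

end

section \<open>Compact objects of a big tt-category\<close>

context category
begin

lemma isomorphic_objsI: "f \<in> isos T X Y \<Longrightarrow> isomorphic_objs T X Y"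
  by (auto simp: isomorphic_objs_def)

lemma isomorphic_objs_sym: "isomorphic_objs T X Y \<Longrightarrow> isomorphic_objs T Y X"
  using isos_inv by (auto simp: isomorphic_objs_def)

lemma isomorphic_objs_trans [trans]:
  "isomorphic_objs T X Y \<Longrightarrow> isomorphic_objs T Y Z \<Longrightarrow> isomorphic_objs T X Z"
  using isos_after by (fastforce simp: isomorphic_objs_def)

end

context triangulated_category
begin

lemma isomorphic_objs_sh: "isomorphic_objs T X Y \<Longrightarrow> isomorphic_objs T (sh T X) (sh T Y)"
  using shm_isos by (fastforce simp: isomorphic_objs_def)

end

context closed_tt_category
begin

lemma isomorphic_tensor:
  "isomorphic_objs T X X' \<Longrightarrow> isomorphic_objs T Y Y' \<Longrightarrow> isomorphic_objs T (X \<boxtimes> Y) (X' \<boxtimes> Y')"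
  using tensor_isos by (fastforce simp: isomorphic_objs_def)

lemma isomorphic_refl: "X \<in> obj T \<Longrightarrow> isomorphic_objs T X X"
  by (rule isomorphic_objsI[OF isos_ident])

lemma isomorphic_braid: "\<lbrakk>X \<in> obj T; Y \<in> obj T\<rbrakk> \<Longrightarrow> isomorphic_objs T (X \<boxtimes> Y) (Y \<boxtimes> X)"
  by (rule isomorphic_objsI[OF braid_iso])

lemma isomorphic_sh_tensor:
  "\<lbrakk>X \<in> obj T; Y \<in> obj T\<rbrakk> \<Longrightarrow> isomorphic_objs T (sh T X \<boxtimes> Y) (sh T (X \<boxtimes> Y))"
  by (rule isomorphic_objsI[OF sh_tensor_iso])

text \<open>Expresses suspension as tensoring with a fixed object, so that closure under tensoring
  will give closure under suspension.\<close>

lemma isomorphic_sh_unit_tensor: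
  assumes "X \<in> obj T"
  shows "isomorphic_objs T (X \<boxtimes> sh T (unit_obj T)) (sh T X)"
proof -
  have "isomorphic_objs T (X \<boxtimes> sh T (unit_obj T)) (sh T (unit_obj T) \<boxtimes> X)"
    using assms by (intro isomorphic_braid) simp_all
  also have "isomorphic_objs T (sh T (unit_obj T) \<boxtimes> X) (sh T (unit_obj T \<boxtimes> X))"
    using assms by (intro isomorphic_sh_tensor) simp_all
  also have "isomorphic_objs T (sh T (unit_obj T \<boxtimes> X)) (sh T X)"
    by (rule isomorphic_objs_sh[OF isomorphic_objsI[OF lunit_iso[OF assms]]])
  finally show ?thesis .
qed

text \<open>The same device for desuspension, with \<open>t\<close> a desuspension of the
  unit.\<close>

lemma isomorphic_desuspended_unit_tensor:
  assumes "X \<in> obj T" "t \<in> obj T" "isomorphic_objs T (sh T t) (unit_obj T)"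
  shows "isomorphic_objs T (sh T X \<boxtimes> t) X"
proof -
  have "isomorphic_objs T (sh T X \<boxtimes> t) (sh T (X \<boxtimes> t))"
    using assms by (intro isomorphic_sh_tensor)
  also have "isomorphic_objs T (sh T (X \<boxtimes> t)) (sh T (t \<boxtimes> X))"
    using assms by (intro isomorphic_objs_sh isomorphic_braid)
  also have "isomorphic_objs T (sh T (t \<boxtimes> X)) (sh T t \<boxtimes> X)"
    using assms by (intro isomorphic_objs_sym[OF isomorphic_sh_tensor])
  also have "isomorphic_objs T (sh T t \<boxtimes> X) (unit_obj T \<boxtimes> X)"
    using assms by (intro isomorphic_tensor isomorphic_refl)
  also have "isomorphic_objs T (unit_obj T \<boxtimes> X) X"
    by (rule isomorphic_objsI[OF lunit_iso[OF assms(1)]])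
  finally show ?thesis .
qed

end

section \<open>The tensor category of compact objects\<close>

context big_tt_category
begin

abbreviation K :: "'o set" where "K \<equiv> compact_objs \<kappa> T"

lemma K_obj [simp]: "x \<in> K \<Longrightarrow> x \<in> obj T"
  by (simp add: compact_objs_def)

lemma K_dual:
  assumes "x \<in> K"
  obtains D where "is_dual T x D"
  using assms unfolding compact_eq_rigid by (auto simp: rigid_objs_def)

lemma K_tensor [simp]: "\<lbrakk>x \<in> K; y \<in> K\<rbrakk> \<Longrightarrow> x \<boxtimes> y \<in> K"
  using K_dual[of y] compact_tensor_rigid by metis

lemma K_unit [simp]: "unit_obj T \<in> K"
  unfolding compact_eq_rigid by (rule unit_rigid)

lemma K_desuspend:
  assumes "x \<in> K"
  obtains y b where "y \<in> K" "b \<in> isos T (sh T y) x"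
proof -
  obtain y b where y: "y \<in> obj T" "b \<in> isos T (sh T y) x"
    using desuspend_obj[OF K_obj[OF assms]] .
  have "sh T y \<in> K" using compact_iso[OF assms isos_inv[OF y(2)]] .
  then show ?thesis using that compact_desuspend y by blast
qed

lemma K_fibre:
  assumes "u \<in> homset T d y" "d \<in> K" "y \<in> K"
  obtains e w h where "e \<in> K" "exact_triangle T e d y w u h"
  using fibre_exists[OF assms(1)] compact_fibre assms(2,3) by metis

lemma K_cone:
  assumes "u \<in> homset T d y" "d \<in> K" "y \<in> K"
  obtains e w h where "e \<in> K" "exact_triangle T d y e u w h"
  using triangle_completion[OF assms(1)] compact_cone assms(2,3) by metis

text \<open>Here \<open>e'\<close> is \<open>D \<boxtimes> e\<close> for a dual \<open>D\<close> of
  \<open>x\<close>. By the last clause a map killed by \<open>x \<ltimes> u\<close> arises from a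
  map killed by \<open>u\<close>, which is how flatness of compact objects is used later.\<close>

lemma rigid_factor:
  assumes "x \<in> K" "e \<in> K" "Y \<in> obj T" "w \<in> homset T e (x \<boxtimes> Y)"
  obtains e' t n where "e' \<in> K" "t \<in> homset T e' Y" "n \<in> homset T e (x \<boxtimes> e')"
    "w = (x \<ltimes> t) \<cdot> n"
    "\<forall>u Z. u \<in> homset T Y Z \<longrightarrow> (x \<ltimes> u) \<cdot> w = zero_mor T e (x \<boxtimes> Z)
      \<longrightarrow> u \<cdot> t = zero_mor T e' Z"
proof -
  obtain D where D: "is_dual T x D" using K_dual[OF assms(1)] .
  have "D \<boxtimes> e \<in> K" using compact_dual_tensor[OF D assms(2)] .
  then show ?thesis using dual_factor[OF D assms(4,3)] that by metis
qed

lemma rigid_factor_right: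
  assumes "x \<in> K" "e \<in> K" "Y \<in> obj T" "w \<in> homset T e (Y \<boxtimes> x)"
  obtains e' t n where "e' \<in> K" "t \<in> homset T e' Y" "n \<in> homset T e (e' \<boxtimes> x)"
    "w = (t \<rtimes> x) \<cdot> n"
    "\<forall>u Z. u \<in> homset T Y Z \<longrightarrow> (u \<rtimes> x) \<cdot> w = zero_mor T e (Z \<boxtimes> x)
      \<longrightarrow> u \<cdot> t = zero_mor T e' Z"
proof -
  note [simp] = assms(1-3)
  note w = assms(4)[unfolded homset_iff]
  have "braid T Y x \<cdot> w \<in> homset T e (x \<boxtimes> Y)" by (simp add: homset_iff w)
  then obtain e' t n where e': "e' \<in> K" "t \<in> homset T e' Y" "n \<in> homset T e (x \<boxtimes> e')"
    "braid T Y x \<cdot> w = (x \<ltimes> t) \<cdot> n"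
    and u: "\<forall>u Z. u \<in> homset T Y Z \<longrightarrow> (x \<ltimes> u) \<cdot> (braid T Y x \<cdot> w) = zero_mor T e (x \<boxtimes> Z)
      \<longrightarrow> u \<cdot> t = zero_mor T e' Z"
    by (rule rigid_factor[OF assms(1-3)])
  note a = e'(1) e'(2,3)[unfolded homset_iff]
  show ?thesis
  proof (rule that[of e' t "braid T x e' \<cdot> n"])
    show "e' \<in> K" "t \<in> homset T e' Y" by (rule e')+
    show "braid T x e' \<cdot> n \<in> homset T e (e' \<boxtimes> x)" by (simp add: homset_iff a)
    have "w = braid T x Y \<cdot> (braid T Y x \<cdot> w)" by (simp add: w)
    also have "\<dots> = braid T x Y \<cdot> ((x \<ltimes> t) \<cdot> n)" unfolding e'(4) ..
    also have "\<dots> = (t \<rtimes> x) \<cdot> (braid T x e' \<cdot> n)"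
      by (rule comp_tail[OF braid_nat]) (simp_all add: a)
    finally show "w = (t \<rtimes> x) \<cdot> (braid T x e' \<cdot> n)" .
    show "\<forall>u Z. u \<in> homset T Y Z \<longrightarrow> (u \<rtimes> x) \<cdot> w = zero_mor T e (Z \<boxtimes> x)
      \<longrightarrow> u \<cdot> t = zero_mor T e' Z"
    proof (intro allI impI)
      fix u' Z assume u': "u' \<in> homset T Y Z" and z: "(u' \<rtimes> x) \<cdot> w = zero_mor T e (Z \<boxtimes> x)"
      note b = u'[unfolded homset_iff]
      have Z: "Z \<in> obj T" using homset_objs[OF u'] by simp
      have "(x \<ltimes> u') \<cdot> (braid T Y x \<cdot> w) = braid T Z x \<cdot> ((u' \<rtimes> x) \<cdot> w)"
        by (rule comp_tail[OF braid_nat[symmetric]]) (simp_all add: b w Z)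
      then have "(x \<ltimes> u') \<cdot> (braid T Y x \<cdot> w) = zero_mor T e (x \<boxtimes> Z)"
        by (simp add: z Z)
      then show "u' \<cdot> t = zero_mor T e' Z" using u u' by blast
    qed
  qed
qed

section \<open>Approximation of maps into tensor products by compact objects\<close>

abbreviation compactly_factors :: "'o \<Rightarrow> 'o \<Rightarrow> 'o \<Rightarrow> 'm \<Rightarrow> bool" where
  "compactly_factors Y F e m \<equiv> \<exists>e' t n. e' \<in> K \<and> t \<in> homset T e' F \<and>
    n \<in> homset T e (Y \<boxtimes> e') \<and> m = (Y \<ltimes> t) \<cdot> n"

text \<open>In terms of functors on \<open>K\<close>: the functor of \<open>Y \<boxtimes> F\<close>
  is covered by the functors of \<open>Y \<boxtimes> e'\<close> for compact \<open>e'\<close> over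
  \<open>F\<close>. This stands in for the compatibility of the restricted Yoneda functor with
  tensor products.\<close>

definition approximable :: "'o \<Rightarrow> bool" where
  "approximable Y \<longleftrightarrow> Y \<in> obj T \<and>
    (\<forall>F\<in>obj T. \<forall>e\<in>K. \<forall>m\<in>homset T e (Y \<boxtimes> F). compactly_factors Y F e m)"

lemma approximableD:
  assumes "approximable Y" "F \<in> obj T" "e \<in> K" "m \<in> homset T e (Y \<boxtimes> F)"
  obtains e' t n where "e' \<in> K" "t \<in> homset T e' F" "n \<in> homset T e (Y \<boxtimes> e')"
    "m = (Y \<ltimes> t) \<cdot> n"
  using assms unfolding approximable_def by blast

lemma approximable_compact: "x \<in> K \<Longrightarrow> approximable x"
  unfolding approximable_def
proof (intro conjI ballI)
  show "x \<in> obj T" if "x \<in> K" using that by simp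
  fix F e m assume "x \<in> K" "F \<in> obj T" "e \<in> K" "m \<in> homset T e (x \<boxtimes> F)"
  then show "compactly_factors x F e m"
    by (metis rigid_factor)
qed

lemma approximable_iso:
  assumes "approximable Y" "a \<in> isos T Y Y'"
  shows "approximable Y'"
  unfolding approximable_def
proof (intro conjI ballI)
  note a = isos_arr[OF assms(2)]
  show Y' [simp]: "Y' \<in> obj T" using a by auto
  have Y [simp]: "Y \<in> obj T" using assms(1) by (simp add: approximable_def)
  fix F e m assume F: "F \<in> obj T" and e: "e \<in> K" and m: "m \<in> homset T e (Y' \<boxtimes> F)"
  note m' = m[unfolded homset_iff]
  have "(inv_mor T a \<rtimes> F) \<cdot> m \<in> homset T e (Y \<boxtimes> F)" by (simp add: homset_iff a F m')
  then obtain e' t n where n: "e' \<in> K" "t \<in> homset T e' F" "n \<in> homset T e (Y \<boxtimes> e')"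
    "(inv_mor T a \<rtimes> F) \<cdot> m = (Y \<ltimes> t) \<cdot> n"
    by (rule approximableD[OF assms(1) F e])
  note b = n(2,3)[unfolded homset_iff]
  have "m = (a \<rtimes> F) \<cdot> ((inv_mor T a \<rtimes> F) \<cdot> m)"
    by (simp add: interchange_tail a F m')
  also have "\<dots> = (a \<rtimes> F) \<cdot> ((Y \<ltimes> t) \<cdot> n)" unfolding n(4) ..
  also have "\<dots> = (Y' \<ltimes> t) \<cdot> ((a \<rtimes> e') \<cdot> n)"
    by (simp add: interchange_tail a F b n(1))
  finally have "m = (Y' \<ltimes> t) \<cdot> ((a \<rtimes> e') \<cdot> n)" .
  moreover have "(a \<rtimes> e') \<cdot> n \<in> homset T e (Y' \<boxtimes> e')" by (simp add: homset_iff a b n(1))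
  ultimately show "compactly_factors Y' F e m"
    using n(1,2) by blast
qed

lemma sh_tensor_arr [simp]:
  assumes "X \<in> obj T" "Y \<in> obj T"
  shows "sh_tensor T X Y \<in> arr T" "src T (sh_tensor T X Y) = sh T X \<boxtimes> Y"
    "tgt T (sh_tensor T X Y) = sh T (X \<boxtimes> Y)"
    "inv_mor T (sh_tensor T X Y) \<in> arr T" "src T (inv_mor T (sh_tensor T X Y)) = sh T (X \<boxtimes> Y)"
    "tgt T (inv_mor T (sh_tensor T X Y)) = sh T X \<boxtimes> Y"
  using isos_arr[OF sh_tensor_iso[OF assms]] by simp_all

lemma sh_tensor_nat:
  "\<lbrakk>f \<in> homset T F F'; Y \<in> obj T\<rbrakk> \<Longrightarrow>
    sh_tensor T Y F' \<cdot> ((sh T Y) \<ltimes> f) = shm T (Y \<ltimes> f) \<cdot> sh_tensor T Y F"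
  using sh_tensor_natural[of "ident T Y" Y Y f F F'] by (simp add: homset_iff)

text \<open>The suspension is moved out of the tensor product by \<open>sh_tensor\<close>, and the
  source \<open>e\<close> is desuspended up to isomorphism, so that a factorization for
  \<open>Y\<close> can be suspended.\<close>

lemma approximable_sh:
  assumes "approximable Y"
  shows "approximable (sh T Y)"
  unfolding approximable_def
proof (intro conjI ballI)
  have Y [simp]: "Y \<in> obj T" using assms(1) by (simp add: approximable_def)
  then show "sh T Y \<in> obj T" by simp
  fix F e m assume F [simp]: "F \<in> obj T" and e: "e \<in> K" and m: "m \<in> homset T e (sh T Y \<boxtimes> F)"
  note m' = m[unfolded homset_iff]
  obtain e0 b where e0: "e0 \<in> K" and b: "b \<in> isos T (sh T e0) e" using K_desuspend[OF e] .
  note b' = isos_arr[OF b]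
  obtain m0 where m0: "m0 \<in> homset T e0 (Y \<boxtimes> F)" "shm T m0 = sh_tensor T Y F \<cdot> (m \<cdot> b)"
    by (rule shm_ex[of "sh_tensor T Y F \<cdot> (m \<cdot> b)" e0 "Y \<boxtimes> F"])
      (simp_all add: homset_iff m' b' e0)
  obtain e' t n where n: "e' \<in> K" "t \<in> homset T e' F" "n \<in> homset T e0 (Y \<boxtimes> e')"
    "m0 = (Y \<ltimes> t) \<cdot> n"
    by (rule approximableD[OF assms F e0 m0(1)])
  note a = n(2,3)[unfolded homset_iff]
  note [simp] = K_obj[OF n(1)]
  let ?n = "inv_mor T (sh_tensor T Y e') \<cdot> (shm T n \<cdot> inv_mor T b)"
  have n': "?n \<in> homset T e (sh T Y \<boxtimes> e')" by (simp add: homset_iff a b')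
  have "sh_tensor T Y F \<cdot> (((sh T Y) \<ltimes> t) \<cdot> ?n)
      = shm T (Y \<ltimes> t) \<cdot> (sh_tensor T Y e' \<cdot> ?n)"
    by (rule comp_tail[OF sh_tensor_nat[OF n(2)]]) (simp_all add: a b')
  also have "sh_tensor T Y e' \<cdot> ?n = shm T n \<cdot> inv_mor T b"
    by (rule isos_cancel(2)[OF sh_tensor_iso]) (simp_all add: a b')
  also have "shm T (Y \<ltimes> t) \<cdot> (shm T n \<cdot> inv_mor T b) = shm T m0 \<cdot> inv_mor T b"
    unfolding n(4) by (simp add: shm_after_arr a b')
  also have "\<dots> = sh_tensor T Y F \<cdot> m"
    unfolding m0(2) by (simp add: m' b')
  finally have "((sh T Y) \<ltimes> t) \<cdot> ?n = m"
    by (rule isos_mono[OF sh_tensor_iso, rotated -1]) (simp_all add: a b' m')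
  then show "compactly_factors (sh T Y) F e m"
    using n(1,2) n' by blast
qed

lemma approximable_desuspend:
  assumes "approximable (sh T Y)" and Y [simp]: "Y \<in> obj T"
  shows "approximable Y"
  unfolding approximable_def
proof (intro conjI ballI)
  show "Y \<in> obj T" by simp
  fix F e m assume F [simp]: "F \<in> obj T" and e: "e \<in> K" and m: "m \<in> homset T e (Y \<boxtimes> F)"
  note m' = m[unfolded homset_iff]
  have "inv_mor T (sh_tensor T Y F) \<cdot> shm T m \<in> homset T (sh T e) (sh T Y \<boxtimes> F)"
    by (simp add: homset_iff m')
  then obtain e' t n where n: "e' \<in> K" "t \<in> homset T e' F" "n \<in> homset T (sh T e) (sh T Y \<boxtimes> e')"
    "inv_mor T (sh_tensor T Y F) \<cdot> shm T m = ((sh T Y) \<ltimes> t) \<cdot> n"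
    by (rule approximableD[OF assms(1) F compact_suspend[OF e]])
  note a = n(2,3)[unfolded homset_iff]
  note [simp] = K_obj[OF n(1)]
  obtain n0 where n0: "n0 \<in> homset T e (Y \<boxtimes> e')" "shm T n0 = sh_tensor T Y e' \<cdot> n"
    by (rule shm_ex[of "sh_tensor T Y e' \<cdot> n" e "Y \<boxtimes> e'"])
      (simp_all add: homset_iff a K_obj[OF e])
  note b = n0(1)[unfolded homset_iff]
  have "shm T m = sh_tensor T Y F \<cdot> (inv_mor T (sh_tensor T Y F) \<cdot> shm T m)"
    by (rule isos_cancel(2)[OF sh_tensor_iso, symmetric]) (simp_all add: m')
  also have "\<dots> = sh_tensor T Y F \<cdot> (((sh T Y) \<ltimes> t) \<cdot> n)" unfolding n(4) ..
  also have "\<dots> = shm T (Y \<ltimes> t) \<cdot> (sh_tensor T Y e' \<cdot> n)"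
    by (rule comp_tail[OF sh_tensor_nat[OF n(2)]]) (simp_all add: a)
  also have "\<dots> = shm T ((Y \<ltimes> t) \<cdot> n0)"
    unfolding n0(2)[symmetric] by (simp add: shm_after_arr a b)
  finally have "m = (Y \<ltimes> t) \<cdot> n0"
    by (rule shm_eq[of _ e "Y \<boxtimes> F", rotated 2]) (simp_all add: homset_iff m' a b)
  then show "compactly_factors Y F e m"
    using n(1,2) n0(1) by blast
qed

end

context big_tt_category
begin

text \<open>The two factorizations are merged over the biproduct of their compact objects.\<close>

lemma compactly_factors_plus:
  assumes [simp]: "Y \<in> obj T" "F \<in> obj T"
    and m: "compactly_factors Y F e m" and m': "compactly_factors Y F e m'"
  shows "compactly_factors Y F e (m \<boxplus> m')"
proof -
  obtain e1 t1 n1 where 1: "e1 \<in> K" "t1 \<in> homset T e1 F" "n1 \<in> homset T e (Y \<boxtimes> e1)"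
    "m = (Y \<ltimes> t1) \<cdot> n1" using m by blast
  obtain e2 t2 n2 where 2: "e2 \<in> K" "t2 \<in> homset T e2 F" "n2 \<in> homset T e (Y \<boxtimes> e2)"
    "m' = (Y \<ltimes> t2) \<cdot> n2" using m' by blast
  note [simp] = K_obj[OF 1(1)] K_obj[OF 2(1)]
  obtain b i j p q where b: "i \<in> homset T e1 b" "j \<in> homset T e2 b" "p \<in> homset T b e1"
    "q \<in> homset T b e2" and z: "p \<cdot> i = ident T e1" "q \<cdot> j = ident T e2" "q \<cdot> i = zero_mor T e1 e2"
    "p \<cdot> j = zero_mor T e2 e1" and s: "(i \<cdot> p) \<boxplus> (j \<cdot> q) = ident T b"
    by (rule biproductE[of e1 e2]) simp_all
  have bK: "b \<in> K" by (rule compact_biproduct[OF 1(1) 2(1) b s])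
  note [simp] = K_obj[OF bK]
  note a = 1(2,3)[unfolded homset_iff] 2(2,3)[unfolded homset_iff] b[unfolded homset_iff]
  have e [simp]: "e \<in> obj T" using homset_objs[OF 1(3)] by simp
  let ?t = "(t1 \<cdot> p) \<boxplus> (t2 \<cdot> q)"
  let ?n1 = "(Y \<ltimes> i) \<cdot> n1" and ?n2 = "(Y \<ltimes> j) \<cdot> n2"
  have t: "?t \<in> homset T b F" by (simp add: homset_iff a)
  have "?t \<cdot> i = (t1 \<cdot> (p \<cdot> i)) \<boxplus> (t2 \<cdot> (q \<cdot> i))"
    by (subst plus_after_arr) (simp_all add: a)
  then have ti: "?t \<cdot> i = t1" by (simp add: z a)
  have "?t \<cdot> j = (t1 \<cdot> (p \<cdot> j)) \<boxplus> (t2 \<cdot> (q \<cdot> j))"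
    by (subst plus_after_arr) (simp_all add: a)
  then have tj: "?t \<cdot> j = t2" by (simp add: z a)
  note t' = t[unfolded homset_iff]
  have "(Y \<ltimes> ?t) \<cdot> (?n1 \<boxplus> ?n2)
      = ((Y \<ltimes> ?t) \<cdot> ?n1) \<boxplus> ((Y \<ltimes> ?t) \<cdot> ?n2)"
    by (rule after_plus_arr) (simp_all add: a)
  also have "(Y \<ltimes> ?t) \<cdot> ?n1 = m"
    unfolding 1(4) by (subst interchange_tail) (simp_all add: a ti)
  also have "(Y \<ltimes> ?t) \<cdot> ?n2 = m'"
    unfolding 2(4) by (subst interchange_tail) (simp_all add: a tj)
  finally have "m \<boxplus> m' = (Y \<ltimes> ?t) \<cdot> (?n1 \<boxplus> ?n2)" ..
  moreover have "?n1 \<boxplus> ?n2 \<in> homset T e (Y \<boxtimes> b)" by (simp add: homset_iff a)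
  ultimately show ?thesis using bK t by blast
qed

text \<open>A chase along two triangles. The image of \<open>m\<close> in
  \<open>sh T Y1 \<boxtimes> F\<close> is approximated by \<open>t1\<close> and dies in the cone
  \<open>C\<close> of \<open>t1\<close>, so over \<open>C\<close> the map \<open>m\<close> comes
  from \<open>Y2\<close>. The approximation found there is pulled back to \<open>F\<close>, up to an
  error that factors through \<open>t1\<close>.\<close>

lemma approximable_cone:
  assumes t: "exact_triangle T Y1 Y2 Y3 f g h" and Y1: "approximable Y1" and Y2: "approximable Y2"
  shows "approximable Y3"
  unfolding approximable_def
proof (intro conjI ballI)
  note a [simp] = exact_arr[OF t]
  show "Y3 \<in> obj T" by simp
  fix F e m assume F [simp]: "F \<in> obj T" and e: "e \<in> K" and m: "m \<in> homset T e (Y3 \<boxtimes> F)"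
  note [simp] = K_obj[OF e] m[unfolded homset_iff]
  have "(h \<rtimes> F) \<cdot> m \<in> homset T e (sh T Y1 \<boxtimes> F)" by (simp add: homset_iff)
  then obtain e1 t1 n1 where e1: "e1 \<in> K" and t1: "t1 \<in> homset T e1 F"
    and n1: "n1 \<in> homset T e (sh T Y1 \<boxtimes> e1)"
    and hm: "(h \<rtimes> F) \<cdot> m = ((sh T Y1) \<ltimes> t1) \<cdot> n1"
    by (rule approximableD[OF approximable_sh[OF Y1] F e])
  note [simp] = K_obj[OF e1] t1[unfolded homset_iff] n1[unfolded homset_iff]
  \<comment> \<open>Over the cone of \<open>t1\<close> the obstruction to lifting \<open>m\<close>
    along \<open>g\<close> disappears.\<close>
  obtain C c k where C: "exact_triangle T e1 F C t1 c k" using triangle_completion[OF t1] by blast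
  note [simp] = exact_arr[OF C] triangle_comp_zero[OF C]
  have "(h \<rtimes> C) \<cdot> ((Y3 \<ltimes> c) \<cdot> m)
      = ((sh T Y1) \<ltimes> c) \<cdot> ((h \<rtimes> F) \<cdot> m)"
    by (simp add: interchange_tail)
  also have "\<dots> = zero_mor T e (sh T Y1 \<boxtimes> C)" unfolding hm by (simp add: interchange_tail)
  finally obtain l where l: "l \<in> homset T e (Y2 \<boxtimes> C)"
    "(Y3 \<ltimes> c) \<cdot> m = (g \<rtimes> C) \<cdot> l"
    using tensor_factor[OF rotate[OF t], of C "(Y3 \<ltimes> c) \<cdot> m" e]
    by (auto simp: homset_iff)
  obtain e2 t2 n2 where e2: "e2 \<in> K" and t2: "t2 \<in> homset T e2 C" and n2: "n2 \<in> homset T e (Y2 \<boxtimes> e2)"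
    and l_eq: "l = (Y2 \<ltimes> t2) \<cdot> n2"
    by (rule approximableD[OF Y2 _ e l(1)]) simp
  note [simp] = K_obj[OF e2] t2[unfolded homset_iff] n2[unfolded homset_iff]
  \<comment> \<open>The fibre of \<open>k \<cdot> t2\<close> is taken because \<open>t2\<close>
    lifts through \<open>c\<close> on it; it is compact, since \<open>e2\<close> and
    \<open>sh T e1\<close> are.\<close>
  have "k \<cdot> t2 \<in> homset T e2 (sh T e1)" by (simp add: homset_iff)
  then obtain e3 w r where e3: "e3 \<in> K" and w: "exact_triangle T e3 e2 (sh T e1) w (k \<cdot> t2) r"
    by (rule K_fibre[OF _ e2 compact_suspend[OF e1]])
  note [simp] = exact_arr(1-3,10)[OF w]
  let ?n2 = "(g \<rtimes> e2) \<cdot> n2"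
  have t2n2: "(Y3 \<ltimes> t2) \<cdot> ?n2 = (Y3 \<ltimes> c) \<cdot> m"
    unfolding l(2) l_eq by (simp add: interchange_tail)
  have "(Y3 \<ltimes> (k \<cdot> t2)) \<cdot> ?n2 = (Y3 \<ltimes> k) \<cdot> ((Y3 \<ltimes> t2) \<cdot> ?n2)"
    by (simp add: interchange_tail)
  also have "\<dots> = zero_mor T e (Y3 \<boxtimes> sh T e1)" unfolding t2n2 by (simp add: interchange_tail)
  finally obtain n3 where n3: "n3 \<in> homset T e (Y3 \<boxtimes> e3)" "?n2 = (Y3 \<ltimes> w) \<cdot> n3"
    using tensor_factor_left[OF w, of Y3 ?n2 e] by (auto simp: homset_iff)
  note [simp] = n3(1)[unfolded homset_iff]
  have "k \<cdot> (t2 \<cdot> w) = zero_mor T e3 (sh T e1)" using triangle_comp_zero(1)[OF w] by simp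
  then obtain t3 where t3: "t3 \<in> homset T e3 F" "t2 \<cdot> w = c \<cdot> t3"
    using factor_first[OF rotate[OF C], of "t2 \<cdot> w" e3] by (auto simp: homset_iff)
  note [simp] = t3(1)[unfolded homset_iff]
  let ?d = "(Y3 \<ltimes> t3) \<cdot> n3"
  have d: "?d \<in> homset T e (Y3 \<boxtimes> F)" by (simp add: homset_iff)
  have "(Y3 \<ltimes> c) \<cdot> ?d = (Y3 \<ltimes> t2) \<cdot> ((Y3 \<ltimes> w) \<cdot> n3)"
    by (simp add: interchange_tail t3(2))
  also have "\<dots> = (Y3 \<ltimes> c) \<cdot> m" unfolding n3(2)[symmetric] t2n2 ..
  finally have cd: "(Y3 \<ltimes> c) \<cdot> ?d = (Y3 \<ltimes> c) \<cdot> m" .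
  \<comment> \<open>\<open>?d\<close> and \<open>m\<close> agree in \<open>Y3 \<boxtimes> C\<close>,
    so their difference lifts to \<open>Y3 \<boxtimes> e1\<close>; hence both summands of
    \<open>m\<close> factor compactly.\<close>
  let ?u = "m \<boxplus> neg_mor T ?d"
  have u: "?u \<in> homset T e (Y3 \<boxtimes> F)" by (simp add: homset_iff)
  have "(Y3 \<ltimes> c) \<cdot> ?u
      = ((Y3 \<ltimes> c) \<cdot> m) \<boxplus> ((Y3 \<ltimes> c) \<cdot> neg_mor T ?d)"
    by (rule after_plus_arr) simp_all
  also have "(Y3 \<ltimes> c) \<cdot> neg_mor T ?d = neg_mor T ((Y3 \<ltimes> c) \<cdot> m)"
    unfolding cd[symmetric] by (rule neg_after(2)) simp_all
  finally have "(Y3 \<ltimes> c) \<cdot> ?u = zero_mor T e (Y3 \<boxtimes> C)" by simp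
  then obtain n where n: "n \<in> homset T e (Y3 \<boxtimes> e1)" "?u = (Y3 \<ltimes> t1) \<cdot> n"
    using tensor_factor_left[OF C _ u] by auto
  have "compactly_factors Y3 F e ?u" using e1 t1 n by blast
  moreover have "compactly_factors Y3 F e ?d" using e3 t3(1) n3(1) by blast
  ultimately have "compactly_factors Y3 F e (?u \<boxplus> ?d)" by (rule compactly_factors_plus[rotated 2]) simp_all
  then show "compactly_factors Y3 F e m" unfolding diff_plus[OF m d] .
qed

text \<open>Compactness of \<open>e\<close> confines \<open>m\<close> to finitely many summands,
  which are treated one at a time and added up.\<close>

lemma approximable_coproduct:
  assumes "small_index \<kappa> I" "is_coproduct T I Y S \<iota>" "\<And>i. i \<in> I \<Longrightarrow> approximable (Y i)"
  shows "approximable S"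
  unfolding approximable_def
proof (intro conjI ballI)
  note a = coproduct_arr[OF assms(2)] coproj_arr[OF assms(2)]
  note [simp] = a(1)
  show "S \<in> obj T" by simp
  fix F e m assume F [simp]: "F \<in> obj T" and e: "e \<in> K" and m: "m \<in> homset T e (S \<boxtimes> F)"
  note [simp] = K_obj[OF e] m[unfolded homset_iff]
  let ?e = "coproj I Y S \<iota>"
  obtain A where A: "finite A" "A \<subseteq> I" "(?e A \<rtimes> F) \<cdot> m = m"
    using compact_factors[OF e assms(1) coproduct_tensor[OF assms(2) F] m]
    unfolding coproj_tensor[OF assms(2) F] by blast
  have "compactly_factors S F e ((?e A \<rtimes> F) \<cdot> m)"
    using A(1,2)
  proof (induction A)
    case empty
    have "(?e {} \<rtimes> F) \<cdot> m = (S \<ltimes> zero_mor T e F) \<cdot> zero_mor T e (S \<boxtimes> e)"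
      by (simp add: coproj_empty[OF assms(2)])
    moreover have "zero_mor T e F \<in> homset T e F" "zero_mor T e (S \<boxtimes> e) \<in> homset T e (S \<boxtimes> e)"
      by (simp_all add: homset_iff)
    ultimately show ?case using e by blast
  next
    case (insert j A)
    then have j: "j \<in> I" by simp
    obtain p where p: "p \<in> homset T S (Y j)" "\<iota> j \<cdot> p = ?e {j}"
      using coproduct_proj[OF assms(2) j] by metis
    note [simp] = p(1)[unfolded homset_iff] a(2-5)[OF j]
    have "(p \<rtimes> F) \<cdot> m \<in> homset T e (Y j \<boxtimes> F)" by (simp add: homset_iff)
    then obtain e' t n where e': "e' \<in> K" "t \<in> homset T e' F" "n \<in> homset T e (Y j \<boxtimes> e')"
      "(p \<rtimes> F) \<cdot> m = ((Y j) \<ltimes> t) \<cdot> n"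
      by (rule approximableD[OF assms(3)[OF j] F e])
    note [simp] = K_obj[OF e'(1)] e'(2,3)[unfolded homset_iff]
    have "(?e {j} \<rtimes> F) \<cdot> m = (\<iota> j \<rtimes> F) \<cdot> ((p \<rtimes> F) \<cdot> m)"
      unfolding p(2)[symmetric] by (simp add: interchange_tail)
    also have "\<dots> = (S \<ltimes> t) \<cdot> ((\<iota> j \<rtimes> e') \<cdot> n)"
      unfolding e'(4) by (simp add: interchange_tail)
    finally have "compactly_factors S F e ((?e {j} \<rtimes> F) \<cdot> m)"
      using e'(1,2) by (intro exI[of _ e'] exI[of _ t] exI[of _ "(\<iota> j \<rtimes> e') \<cdot> n"])
        (simp add: homset_iff)
    moreover have "compactly_factors S F e ((?e A \<rtimes> F) \<cdot> m)" using insert by simp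
    ultimately have "compactly_factors S F e
        (((?e {j} \<rtimes> F) \<cdot> m) \<boxplus> ((?e A \<rtimes> F) \<cdot> m))"
      by (rule compactly_factors_plus[rotated 2]) simp_all
    also have "((?e {j} \<rtimes> F) \<cdot> m) \<boxplus> ((?e A \<rtimes> F) \<cdot> m)
        = ((?e {j} \<rtimes> F) \<boxplus> (?e A \<rtimes> F)) \<cdot> m"
      by (rule plus_after_arr[symmetric]) (simp_all add: a)
    also have "(?e {j} \<rtimes> F) \<boxplus> (?e A \<rtimes> F) = ?e (insert j A) \<rtimes> F"
      unfolding coproj_insert[OF assms(2) insert.hyps(2)]
      by (rule plus_tensor[symmetric]) (simp_all add: a)
    finally show ?case .
  qed
  then show "compactly_factors S F e m" using A(3) by simp
qed

lemma triangulated_subcatI: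
  assumes "L \<subseteq> obj T" "L \<noteq> {}"
    and "\<And>X Y a. X \<in> L \<Longrightarrow> a \<in> isos T X Y \<Longrightarrow> Y \<in> L"
    and "\<And>X. X \<in> L \<Longrightarrow> sh T X \<in> L"
    and "\<And>X. X \<in> obj T \<Longrightarrow> sh T X \<in> L \<Longrightarrow> X \<in> L"
    and "\<And>X Y Z f g h. exact_triangle T X Y Z f g h \<Longrightarrow> X \<in> L \<Longrightarrow> Y \<in> L \<Longrightarrow> Z \<in> L"
  shows "triangulated_subcat T L"
  unfolding triangulated_subcat_def
proof (intro conjI ballI allI impI)
  show "Y \<in> L" if "X \<in> L" "isomorphic_objs T X Y" for X Y
    using that assms(3) by (auto simp: isomorphic_objs_def)
  show "sh T X \<in> L \<longleftrightarrow> X \<in> L" if "X \<in> obj T" for X using assms(4,5) that by blast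
  show "Z \<in> L" if "exact_triangle T X Y Z f g h \<and> X \<in> L \<and> Y \<in> L" for X Y Z f g h
    using that assms(6) by blast
qed (use assms(1,2) in auto)

lemma localizing_induct:
  assumes "localizing_subcat \<kappa> T L" "K \<subseteq> L" "X \<in> obj T"
  shows "X \<in> L"
proof -
  have "X \<in> localizing_hull \<kappa> T K" using compactly_generated assms(3) by simp
  then show ?thesis unfolding localizing_hull_def using assms(1,2) by blast
qed

text \<open>Approximable objects form a localizing subcategory containing the compact ones. For big
  objects this is the substitute for the duality available in \<open>K\<close>.\<close>

lemma all_approximable:
  assumes "Y \<in> obj T"
  shows "approximable Y"
proof -
  let ?L = "{Y. approximable Y}"
  have "localizing_subcat \<kappa> T ?L"
    unfolding localizing_subcat_def
  proof (intro conjI allI impI)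
    show "triangulated_subcat T ?L"
    proof (rule triangulated_subcatI)
      show "?L \<subseteq> obj T" by (auto simp: approximable_def)
      show "?L \<noteq> {}" using approximable_compact[OF K_unit] by blast
    qed (use approximable_iso approximable_sh approximable_desuspend approximable_cone in blast)+
    show "S \<in> ?L" if "small_index \<kappa> I \<and> (\<forall>i\<in>I. X i \<in> ?L) \<and> is_coproduct T I X S \<iota>"
      for I X S \<iota>
      using that approximable_coproduct[of I X S \<iota>] by blast
  qed
  moreover have "K \<subseteq> ?L" using approximable_compact by blast
  ultimately show ?thesis using localizing_induct[OF _ _ assms] by blast
qed

end

section \<open>Ideals of maps between compact objects\<close>

context big_tt_category
begin

text \<open>The outer maps are left unspecified, since torsion maps are stable under composition on
  both sides.\<close>

lemma tensor_swap:
  assumes [simp]: "f \<in> arr T" "x \<in> obj T" "y \<in> obj T"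
  obtains \<theta> \<phi> where "\<theta> \<in> homset T ((src T f \<boxtimes> y) \<boxtimes> x) ((src T f \<boxtimes> x) \<boxtimes> y)"
    "\<phi> \<in> homset T ((tgt T f \<boxtimes> x) \<boxtimes> y) ((tgt T f \<boxtimes> y) \<boxtimes> x)"
    "(f \<rtimes> y) \<rtimes> x = \<phi> \<cdot> (((f \<rtimes> x) \<rtimes> y) \<cdot> \<theta>)"
proof -
  let ?a = "src T f" and ?b = "tgt T f"
  let ?s = "\<lambda>a x y. a \<ltimes> braid T x y"
  let ?\<theta> = "inv_mor T (assoc T ?a x y) \<cdot> (?s ?a y x \<cdot> assoc T ?a y x)"
  let ?\<phi> = "inv_mor T (assoc T ?b y x) \<cdot> (?s ?b x y \<cdot> assoc T ?b x y)"
  have 1: "assoc T ?b x y \<cdot> ((f \<rtimes> x) \<rtimes> y) = (f \<rtimes> (x \<boxtimes> y)) \<cdot> assoc T ?a x y"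
    using assoc_nat[of f "ident T x" "ident T y"] by simp
  have 2: "assoc T ?b y x \<cdot> ((f \<rtimes> y) \<rtimes> x) = (f \<rtimes> (y \<boxtimes> x)) \<cdot> assoc T ?a y x"
    using assoc_nat[of f "ident T y" "ident T x"] by simp
  have "?\<phi> \<cdot> (((f \<rtimes> x) \<rtimes> y) \<cdot> ?\<theta>)
      = inv_mor T (assoc T ?b y x) \<cdot> (?s ?b x y \<cdot> (assoc T ?b x y \<cdot>
        (((f \<rtimes> x) \<rtimes> y) \<cdot> ?\<theta>)))"
    by simp
  also have "assoc T ?b x y \<cdot> (((f \<rtimes> x) \<rtimes> y) \<cdot> ?\<theta>)
      = (f \<rtimes> (x \<boxtimes> y)) \<cdot> (assoc T ?a x y \<cdot> ?\<theta>)"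
    by (rule comp_tail[OF 1]) simp_all
  also have "assoc T ?a x y \<cdot> ?\<theta> = ?s ?a y x \<cdot> assoc T ?a y x" by simp
  also have "?s ?b x y \<cdot> ((f \<rtimes> (x \<boxtimes> y)) \<cdot> (?s ?a y x \<cdot> assoc T ?a y x))
      = (f \<rtimes> (y \<boxtimes> x)) \<cdot> assoc T ?a y x"
    by (simp add: interchange interchange_tail)
  also have "\<dots> = assoc T ?b y x \<cdot> ((f \<rtimes> y) \<rtimes> x)" by (rule 2[symmetric])
  finally have "(f \<rtimes> y) \<rtimes> x = ?\<phi> \<cdot> (((f \<rtimes> x) \<rtimes> y) \<cdot> ?\<theta>)"
    by simp
  then show ?thesis by (rule that[rotated 2]) (simp_all add: homset_iff)
qed

end

text \<open>An ideal of maps between compact objects. Sending \<open>f\<close> to the image of the map it induces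
  on representable functors identifies these with the Serre ideals of the category of finitely
  presented functors on \<open>K\<close>; \<open>ideal_ext\<close> is closure under extensions.\<close>

locale compact_ideal = big_tt_category \<kappa> T
  for \<kappa> :: "'i rel" and T :: "('o, 'm, 'z) tt_data_scheme" (structure) +
  fixes I :: "'m set"
  assumes ideal_arr: "f \<in> I \<Longrightarrow> f \<in> arr T \<and> src T f \<in> compact_objs \<kappa> T \<and> tgt T f \<in> compact_objs \<kappa> T"
    and ideal_zero: "\<lbrakk>x \<in> compact_objs \<kappa> T; y \<in> compact_objs \<kappa> T\<rbrakk> \<Longrightarrow> zero_mor T x y \<in> I"
    and ideal_post: "\<lbrakk>f \<in> I; g \<in> homset T (tgt T f) z; z \<in> compact_objs \<kappa> T\<rbrakk> \<Longrightarrow> g \<cdot> f \<in> I"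
    and ideal_pre: "\<lbrakk>f \<in> I; g \<in> homset T z (src T f); z \<in> compact_objs \<kappa> T\<rbrakk> \<Longrightarrow> f \<cdot> g \<in> I"
    and ideal_tensor: "\<lbrakk>f \<in> I; x \<in> compact_objs \<kappa> T\<rbrakk> \<Longrightarrow> f \<rtimes> x \<in> I"
    and ideal_ext: "\<lbrakk>exact_triangle T e d y w u h; e \<in> compact_objs \<kappa> T; d \<in> compact_objs \<kappa> T;
      y \<in> compact_objs \<kappa> T; z \<in> compact_objs \<kappa> T; u \<in> I; v \<in> homset T d z; v \<cdot> w \<in> I\<rbrakk> \<Longrightarrow> v \<in> I"
begin

text \<open>Replaces the fibre of \<open>u\<close> by all compact maps killed by \<open>u\<close>,
  the form in which torsion tests supply their hypothesis.\<close>

lemma ideal_ext':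
  assumes u: "u \<in> I" "u \<in> homset T d y" and v: "v \<in> homset T d z" "z \<in> K"
    and *: "\<And>e w. \<lbrakk>e \<in> K; w \<in> homset T e d; u \<cdot> w = zero_mor T e y\<rbrakk> \<Longrightarrow> v \<cdot> w \<in> I"
  shows "v \<in> I"
proof -
  have K: "d \<in> K" "y \<in> K" using ideal_arr[OF u(1)] u(2) by (auto simp: homset_iff)
  obtain e w h where e: "e \<in> K" and t: "exact_triangle T e d y w u h" using K_fibre[OF u(2) K] .
  have "v \<cdot> w \<in> I"
    by (rule *[OF e]) (use exact_arr[OF t] triangle_comp_zero[OF t] in \<open>simp_all add: homset_iff\<close>)
  then show ?thesis using ideal_ext[OF t e K v(2) u(1) v(1)] by blast
qed

text \<open>A map of \<open>T\<close> is torsion if it vanishes in the quotient of the module category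
  of \<open>K\<close> by the localizing subcategory generated by the Serre ideal \<open>I\<close>. This is tested against
  finitely generated submodules, given by maps \<open>u\<close> from compact objects, and their
  finitely presented quotients, given by maps \<open>v\<close>.\<close>

definition torsion :: "'m set" where
  "torsion = {g \<in> arr T. \<forall>c d z u v. c \<in> K \<longrightarrow> d \<in> K \<longrightarrow> z \<in> K \<longrightarrow>
    u \<in> homset T d (src T g \<boxtimes> c) \<longrightarrow> v \<in> homset T d z \<longrightarrow>
    (\<forall>e w. e \<in> K \<longrightarrow> w \<in> homset T e d \<longrightarrow>
      (g \<rtimes> c) \<cdot> (u \<cdot> w) = zero_mor T e (tgt T g \<boxtimes> c) \<longrightarrow> v \<cdot> w \<in> I) \<longrightarrow> v \<in> I}"

section \<open>Closure properties of torsion maps\<close>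

lemma torsionI:
  assumes "g \<in> homset T X Y"
    and "\<And>c d z u v. \<lbrakk>c \<in> K; d \<in> K; z \<in> K; u \<in> homset T d (X \<boxtimes> c); v \<in> homset T d z;
      \<And>e w. \<lbrakk>e \<in> K; w \<in> homset T e d; (g \<rtimes> c) \<cdot> (u \<cdot> w) = zero_mor T e (Y \<boxtimes> c)\<rbrakk>
        \<Longrightarrow> v \<cdot> w \<in> I\<rbrakk> \<Longrightarrow> v \<in> I"
  shows "g \<in> torsion"
proof -
  have g: "g \<in> arr T" "src T g = X" "tgt T g = Y" using assms(1) by (simp_all add: homset_iff)
  show ?thesis unfolding torsion_def using assms(2) by (simp add: g)
qed

lemma torsionD:
  assumes "g \<in> torsion" "g \<in> homset T X Y" "c \<in> K" "d \<in> K" "z \<in> K"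
    "u \<in> homset T d (X \<boxtimes> c)" "v \<in> homset T d z"
    "\<And>e w. \<lbrakk>e \<in> K; w \<in> homset T e d; (g \<rtimes> c) \<cdot> (u \<cdot> w) = zero_mor T e (Y \<boxtimes> c)\<rbrakk>
        \<Longrightarrow> v \<cdot> w \<in> I"
  shows "v \<in> I"
proof -
  have g: "src T g = X" "tgt T g = Y" using assms(2) by (simp_all add: homset_iff)
  have "\<forall>c d z u v. c \<in> K \<longrightarrow> d \<in> K \<longrightarrow> z \<in> K \<longrightarrow>
    u \<in> homset T d (X \<boxtimes> c) \<longrightarrow> v \<in> homset T d z \<longrightarrow>
    (\<forall>e w. e \<in> K \<longrightarrow> w \<in> homset T e d \<longrightarrow>
      (g \<rtimes> c) \<cdot> (u \<cdot> w) = zero_mor T e (Y \<boxtimes> c) \<longrightarrow> v \<cdot> w \<in> I) \<longrightarrow> v \<in> I"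
    using assms(1) unfolding torsion_def by (simp add: g)
  then show ?thesis using assms(3-8) by blast
qed

lemma torsion_arr: "g \<in> torsion \<Longrightarrow> g \<in> arr T"
  by (simp add: torsion_def)

text \<open>Whatever is killed by \<open>g\<close> is killed by \<open>h \<cdot> g\<close>, so a
  test for the composite is also a test for \<open>g\<close>.\<close>

lemma torsion_post:
  assumes "g \<in> torsion" "h \<in> arr T" "src T h = tgt T g"
  shows "h \<cdot> g \<in> torsion"
proof -
  note g [simp] = torsion_arr[OF assms(1)] and h [simp] = assms(2,3)
  have gh: "g \<in> homset T (src T g) (tgt T g)" by (simp add: homset_iff)
  show ?thesis
  proof (rule torsionI[of _ "src T g" "tgt T h"])
    show "h \<cdot> g \<in> homset T (src T g) (tgt T h)" by (simp add: homset_iff)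
    fix c d z u v assume c: "c \<in> K" "d \<in> K" "z \<in> K"
      and u: "u \<in> homset T d (src T g \<boxtimes> c)" and v: "v \<in> homset T d z"
      and *: "\<And>e w. \<lbrakk>e \<in> K; w \<in> homset T e d;
        ((h \<cdot> g) \<rtimes> c) \<cdot> (u \<cdot> w) = zero_mor T e (tgt T h \<boxtimes> c)\<rbrakk> \<Longrightarrow> v \<cdot> w \<in> I"
    note u' = u[unfolded homset_iff]
    show "v \<in> I"
    proof (rule torsionD[OF assms(1) gh c u v])
      fix e w assume e: "e \<in> K" and w: "w \<in> homset T e d"
        and z: "(g \<rtimes> c) \<cdot> (u \<cdot> w) = zero_mor T e (tgt T g \<boxtimes> c)"
      note w' = w[unfolded homset_iff]
      have "((h \<cdot> g) \<rtimes> c) \<cdot> (u \<cdot> w) = (h \<rtimes> c) \<cdot> ((g \<rtimes> c) \<cdot> (u \<cdot> w))"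
        by (simp add: interchange_tail u' w' c e)
      also have "\<dots> = zero_mor T e (tgt T h \<boxtimes> c)" unfolding z by (simp add: c e)
      finally show "v \<cdot> w \<in> I" by (rule *[OF e w])
    qed
  qed
qed

lemma torsion_pre:
  assumes "g \<in> torsion" "h \<in> arr T" "tgt T h = src T g"
  shows "g \<cdot> h \<in> torsion"
proof -
  note g [simp] = torsion_arr[OF assms(1)] and h [simp] = assms(2,3)
  have gh: "g \<in> homset T (src T g) (tgt T g)" by (simp add: homset_iff)
  show ?thesis
  proof (rule torsionI[of _ "src T h" "tgt T g"])
    show "g \<cdot> h \<in> homset T (src T h) (tgt T g)" by (simp add: homset_iff)
    fix c d z u v assume c: "c \<in> K" "d \<in> K" "z \<in> K"
      and u: "u \<in> homset T d (src T h \<boxtimes> c)" and v: "v \<in> homset T d z"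
      and *: "\<And>e w. \<lbrakk>e \<in> K; w \<in> homset T e d;
        ((g \<cdot> h) \<rtimes> c) \<cdot> (u \<cdot> w) = zero_mor T e (tgt T g \<boxtimes> c)\<rbrakk> \<Longrightarrow> v \<cdot> w \<in> I"
    note u' = u[unfolded homset_iff]
    have hu: "(h \<rtimes> c) \<cdot> u \<in> homset T d (src T g \<boxtimes> c)" by (simp add: homset_iff u' c)
    show "v \<in> I"
    proof (rule torsionD[OF assms(1) gh c hu v])
      fix e w assume e: "e \<in> K" and w: "w \<in> homset T e d"
        and z: "(g \<rtimes> c) \<cdot> (((h \<rtimes> c) \<cdot> u) \<cdot> w) = zero_mor T e (tgt T g \<boxtimes> c)"
      note w' = w[unfolded homset_iff]
      have "((g \<cdot> h) \<rtimes> c) \<cdot> (u \<cdot> w) = (g \<rtimes> c) \<cdot> (((h \<rtimes> c) \<cdot> u) \<cdot> w)"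
        by (simp add: interchange_tail u' w' c e)
      then show "v \<cdot> w \<in> I" using z by (intro *[OF e w]) simp
    qed
  qed
qed

text \<open>A test for \<open>g \<rtimes> x\<close> against \<open>c\<close> is a test for
  \<open>g\<close> against \<open>x \<boxtimes> c\<close>; the compact factor in the definition of
  \<open>torsion\<close> makes this possible.\<close>

lemma torsion_tensor:
  assumes "g \<in> torsion" "x \<in> K"
  shows "g \<rtimes> x \<in> torsion"
proof -
  note g [simp] = torsion_arr[OF assms(1)] and x [simp] = assms(2)
  have gh: "g \<in> homset T (src T g) (tgt T g)" by (simp add: homset_iff)
  show ?thesis
  proof (rule torsionI[of _ "src T g \<boxtimes> x" "tgt T g \<boxtimes> x"])
    show "g \<rtimes> x \<in> homset T (src T g \<boxtimes> x) (tgt T g \<boxtimes> x)" by (simp add: homset_iff)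
    fix c d z u v assume c: "c \<in> K" "d \<in> K" "z \<in> K"
      and u: "u \<in> homset T d ((src T g \<boxtimes> x) \<boxtimes> c)" and v: "v \<in> homset T d z"
      and *: "\<And>e w. \<lbrakk>e \<in> K; w \<in> homset T e d;
        ((g \<rtimes> x) \<rtimes> c) \<cdot> (u \<cdot> w) = zero_mor T e ((tgt T g \<boxtimes> x) \<boxtimes> c)\<rbrakk> \<Longrightarrow> v \<cdot> w \<in> I"
    note u' = u[unfolded homset_iff]
    let ?u = "assoc T (src T g) x c \<cdot> u"
    have au: "?u \<in> homset T d (src T g \<boxtimes> (x \<boxtimes> c))" by (simp add: homset_iff u' c)
    have n: "assoc T (tgt T g) x c \<cdot> ((g \<rtimes> x) \<rtimes> c)
        = (g \<rtimes> (x \<boxtimes> c)) \<cdot> assoc T (src T g) x c"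
      using assoc_nat[of g "ident T x" "ident T c"] c by simp
    show "v \<in> I"
    proof (rule torsionD[OF assms(1) gh _ c(2,3) au v])
      show "x \<boxtimes> c \<in> K" using c by simp
      fix e w assume e: "e \<in> K" and w: "w \<in> homset T e d"
        and z: "(g \<rtimes> (x \<boxtimes> c)) \<cdot> (?u \<cdot> w) = zero_mor T e (tgt T g \<boxtimes> (x \<boxtimes> c))"
      note w' = w[unfolded homset_iff]
      have "assoc T (tgt T g) x c \<cdot> (((g \<rtimes> x) \<rtimes> c) \<cdot> (u \<cdot> w))
          = (g \<rtimes> (x \<boxtimes> c)) \<cdot> (assoc T (src T g) x c \<cdot> (u \<cdot> w))"
        by (rule comp_tail[OF n]) (simp_all add: u' w' c)
      also have "\<dots> = zero_mor T e (tgt T g \<boxtimes> (x \<boxtimes> c))" using z by (simp add: u' w' c)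
      finally have 0: "assoc T (tgt T g) x c \<cdot> (((g \<rtimes> x) \<rtimes> c) \<cdot> (u \<cdot> w))
          = zero_mor T e (tgt T g \<boxtimes> (x \<boxtimes> c))" .
      have "((g \<rtimes> x) \<rtimes> c) \<cdot> (u \<cdot> w) = zero_mor T e ((tgt T g \<boxtimes> x) \<boxtimes> c)"
        by (rule isos_mono[OF assoc_iso[of "tgt T g" x c]]) (simp_all add: u' w' c e 0)
      then show "v \<cdot> w \<in> I" by (rule *[OF e w])
    qed
  qed
qed

text \<open>The counterpart of \<open>ideal_ext\<close> for maps between arbitrary objects. A map
  killed by \<open>g\<close> lifts to \<open>E\<close>, where \<open>f \<cdot> k\<close> provides a
  second test; the two tests are applied one inside the other.\<close>

lemma torsion_ext:
  assumes t: "exact_triangle T E D Y k g h" and g: "g \<in> torsion" and f: "f \<in> homset T D Z"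
    and fk: "f \<cdot> k \<in> torsion"
  shows "f \<in> torsion"
proof (rule torsionI[OF f])
  note [simp] = exact_arr[OF t] f[unfolded homset_iff]
  have gh: "g \<in> homset T D Y" and fkh: "f \<cdot> k \<in> homset T E Z" by (simp_all add: homset_iff)
  fix c d z u v assume c [simp]: "c \<in> K" "d \<in> K" "z \<in> K"
    and u: "u \<in> homset T d (D \<boxtimes> c)" and v: "v \<in> homset T d z"
    and *: "\<And>e w. \<lbrakk>e \<in> K; w \<in> homset T e d; (f \<rtimes> c) \<cdot> (u \<cdot> w) = zero_mor T e (Z \<boxtimes> c)\<rbrakk>
      \<Longrightarrow> v \<cdot> w \<in> I"
  note [simp] = u[unfolded homset_iff] v[unfolded homset_iff]
  show "v \<in> I"
  proof (rule torsionD[OF g gh c u v])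
    fix e w assume e [simp]: "e \<in> K" and w: "w \<in> homset T e d"
      and z: "(g \<rtimes> c) \<cdot> (u \<cdot> w) = zero_mor T e (Y \<boxtimes> c)"
    note [simp] = w[unfolded homset_iff]
    have uw: "u \<cdot> w \<in> homset T e (D \<boxtimes> c)" by (simp add: homset_iff)
    obtain l where l: "l \<in> homset T e (E \<boxtimes> c)" "u \<cdot> w = (k \<rtimes> c) \<cdot> l"
      by (rule tensor_factor[OF t K_obj[OF c(1)] uw z])
    note [simp] = l(1)[unfolded homset_iff]
    have vw: "v \<cdot> w \<in> homset T e z" by (simp add: homset_iff)
    show "v \<cdot> w \<in> I"
    proof (rule torsionD[OF fk fkh c(1) e c(3) l(1) vw])
      fix e' w' assume e' [simp]: "e' \<in> K" and w': "w' \<in> homset T e' e"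
        and z': "((f \<cdot> k) \<rtimes> c) \<cdot> (l \<cdot> w') = zero_mor T e' (Z \<boxtimes> c)"
      note [simp] = w'[unfolded homset_iff]
      have "(f \<rtimes> c) \<cdot> (u \<cdot> (w \<cdot> w')) = (f \<rtimes> c) \<cdot> ((u \<cdot> w) \<cdot> w')" by simp
      also have "\<dots> = ((f \<cdot> k) \<rtimes> c) \<cdot> (l \<cdot> w')"
        unfolding l(2) by (simp add: interchange_tail)
      finally have "(f \<rtimes> c) \<cdot> (u \<cdot> (w \<cdot> w')) = zero_mor T e' (Z \<boxtimes> c)" using z' by simp
      then have "v \<cdot> (w \<cdot> w') \<in> I" by (intro *) (simp_all add: homset_iff)
      then show "(v \<cdot> w) \<cdot> w' \<in> I" by simp
    qed
  qed
qed

lemma torsion_zero: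
  assumes [simp]: "X \<in> obj T" "Y \<in> obj T"
  shows "zero_mor T X Y \<in> torsion"
proof (rule torsionI[of _ X Y])
  show "zero_mor T X Y \<in> homset T X Y" by (simp add: homset_iff)
  fix c d z u v assume c [simp]: "c \<in> K" "d \<in> K" "z \<in> K"
    and u: "u \<in> homset T d (X \<boxtimes> c)" and v: "v \<in> homset T d z"
    and *: "\<And>e w. \<lbrakk>e \<in> K; w \<in> homset T e d;
      (zero_mor T X Y \<rtimes> c) \<cdot> (u \<cdot> w) = zero_mor T e (Y \<boxtimes> c)\<rbrakk> \<Longrightarrow> v \<cdot> w \<in> I"
  note [simp] = u[unfolded homset_iff] v[unfolded homset_iff]
  \<comment> \<open>The zero map kills everything, so the test hypothesis applies to the identity of
    \<open>d\<close>.\<close>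
  have "v \<cdot> ident T d \<in> I" by (rule *) (simp_all add: homset_iff)
  then show "v \<in> I" by simp
qed

text \<open>On the fibre of \<open>f\<close> the sum agrees with \<open>g\<close>, so
  \<open>torsion_ext\<close> applies with \<open>f\<close> as its torsion map.\<close>

lemma torsion_plus:
  assumes f: "f \<in> torsion" and g: "g \<in> torsion" and [simp]: "src T f = src T g" "tgt T f = tgt T g"
  shows "f \<boxplus> g \<in> torsion"
proof -
  note [simp] = torsion_arr[OF f] torsion_arr[OF g]
  obtain W w k where t: "exact_triangle T W (src T g) (tgt T g) w f k"
    using fibre_exists[of f "src T g" "tgt T g"] by (auto simp: homset_iff)
  note [simp] = exact_arr(1-3)[OF t]
  have "(f \<boxplus> g) \<cdot> w = (f \<cdot> w) \<boxplus> (g \<cdot> w)" by (rule plus_after_arr) simp_all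
  also have "\<dots> = g \<cdot> w" using triangle_comp_zero(1)[OF t] exact_arr(10)[OF t] by simp
  finally have "(f \<boxplus> g) \<cdot> w \<in> torsion" using torsion_pre[OF g, of w] by simp
  then show ?thesis using torsion_ext[OF t f, of "f \<boxplus> g" "tgt T g"] by (simp add: homset_iff)
qed

text \<open>Rigidity of the source \<open>x\<close> of \<open>f\<close> lets a test map into
  \<open>x \<boxtimes> (W \<boxtimes> c)\<close> factor through \<open>x \<boxtimes> e\<close> with
  \<open>e\<close> compact, and there \<open>f \<rtimes> e\<close> belongs to the ideal.\<close>

lemma ideal_tensor_torsion:
  assumes f: "f \<in> I" and W [simp]: "W \<in> obj T"
  shows "f \<rtimes> W \<in> torsion"
proof -
  define x y where "x = src T f" and "y = tgt T f"
  have [simp]: "f \<in> arr T" "src T f = x" "tgt T f = y" and x [simp]: "x \<in> K" and y [simp]: "y \<in> K"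
    using ideal_arr[OF f] by (simp_all add: x_def y_def)
  show ?thesis
  proof (rule torsionI[of _ "x \<boxtimes> W" "y \<boxtimes> W"])
    show "f \<rtimes> W \<in> homset T (x \<boxtimes> W) (y \<boxtimes> W)" by (simp add: homset_iff)
    fix c d z u v assume c [simp]: "c \<in> K" "d \<in> K" "z \<in> K"
      and u: "u \<in> homset T d ((x \<boxtimes> W) \<boxtimes> c)" and v: "v \<in> homset T d z"
      and *: "\<And>e w. \<lbrakk>e \<in> K; w \<in> homset T e d;
        ((f \<rtimes> W) \<rtimes> c) \<cdot> (u \<cdot> w) = zero_mor T e ((y \<boxtimes> W) \<boxtimes> c)\<rbrakk> \<Longrightarrow> v \<cdot> w \<in> I"
    note [simp] = u[unfolded homset_iff] v[unfolded homset_iff]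
    have "assoc T x W c \<cdot> u \<in> homset T d (x \<boxtimes> (W \<boxtimes> c))" by (simp add: homset_iff)
    then obtain e t n where e [simp]: "e \<in> K" and t: "t \<in> homset T e (W \<boxtimes> c)"
      and n: "n \<in> homset T d (x \<boxtimes> e)" and au: "assoc T x W c \<cdot> u = (x \<ltimes> t) \<cdot> n"
      by (rule rigid_factor[OF x c(2) tensor_in[OF W K_obj[OF c(1)]]])
    note [simp] = t[unfolded homset_iff] n[unfolded homset_iff]
    let ?\<nu> = "(f \<rtimes> e) \<cdot> n"
    have \<nu>: "?\<nu> \<in> I" by (rule ideal_pre[OF ideal_tensor[OF f e], of _ d]) (simp_all add: homset_iff)
    have nat: "assoc T y W c \<cdot> ((f \<rtimes> W) \<rtimes> c)
        = (f \<rtimes> (W \<boxtimes> c)) \<cdot> assoc T x W c"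
      using assoc_nat[of f "ident T W" "ident T c"] by simp
    show "v \<in> I"
    proof (rule ideal_ext'[OF \<nu> _ v c(3)])
      show "?\<nu> \<in> homset T d (y \<boxtimes> e)" by (simp add: homset_iff)
      fix e' w assume e' [simp]: "e' \<in> K" and w: "w \<in> homset T e' d"
        and z: "?\<nu> \<cdot> w = zero_mor T e' (y \<boxtimes> e)"
      note [simp] = w[unfolded homset_iff]
      have "assoc T y W c \<cdot> (((f \<rtimes> W) \<rtimes> c) \<cdot> (u \<cdot> w))
          = (f \<rtimes> (W \<boxtimes> c)) \<cdot> (assoc T x W c \<cdot> (u \<cdot> w))"
        by (rule comp_tail[OF nat]) simp_all
      also have "assoc T x W c \<cdot> (u \<cdot> w) = (x \<ltimes> t) \<cdot> (n \<cdot> w)"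
        by (rule comp_tail[OF au]) simp_all
      also have "(f \<rtimes> (W \<boxtimes> c)) \<cdot> ((x \<ltimes> t) \<cdot> (n \<cdot> w))
          = (y \<ltimes> t) \<cdot> (?\<nu> \<cdot> w)"
        by (simp add: interchange_tail)
      also have "\<dots> = zero_mor T e' (y \<boxtimes> (W \<boxtimes> c))" unfolding z by simp
      finally have 0: "assoc T y W c \<cdot> (((f \<rtimes> W) \<rtimes> c) \<cdot> (u \<cdot> w))
          = zero_mor T e' (y \<boxtimes> (W \<boxtimes> c))" .
      have "((f \<rtimes> W) \<rtimes> c) \<cdot> (u \<cdot> w) = zero_mor T e' ((y \<boxtimes> W) \<boxtimes> c)"
        by (rule isos_mono[OF assoc_iso[of y W c]]) (simp_all add: 0)
      then show "v \<cdot> w \<in> I" by (rule *[OF e' w])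
    qed
  qed
qed

text \<open>No further compact maps become torsion: testing \<open>f\<close> against itself, with
  the unit for \<open>c\<close>, already forces \<open>f\<close> into the ideal.\<close>

lemma torsion_compact_iff:
  assumes [simp]: "f \<in> arr T" "src T f \<in> K" "tgt T f \<in> K"
  shows "f \<in> torsion \<longleftrightarrow> f \<in> I"
proof
  let ?x = "src T f" and ?y = "tgt T f"
  have fh: "f \<in> homset T ?x ?y" by (simp add: homset_iff)
  note rn = runit_nat[of f ?x ?y, simplified]
  show "f \<in> I" if f: "f \<in> torsion"
  proof (rule torsionD[OF f fh K_unit assms(2,3) _ fh])
    show "inv_mor T (runit T ?x) \<in> homset T ?x (?x \<boxtimes> unit_obj T)" by (simp add: homset_iff)
    fix e w assume e [simp]: "e \<in> K" and w: "w \<in> homset T e ?x"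
      and z: "(f \<rtimes> (unit_obj T)) \<cdot> (inv_mor T (runit T ?x) \<cdot> w) = zero_mor T e (?y \<boxtimes> unit_obj T)"
    note [simp] = w[unfolded homset_iff]
    have "runit T ?y \<cdot> ((f \<rtimes> (unit_obj T)) \<cdot> (inv_mor T (runit T ?x) \<cdot> w))
        = f \<cdot> (runit T ?x \<cdot> (inv_mor T (runit T ?x) \<cdot> w))"
      by (rule comp_tail[OF rn]) simp_all
    then have "f \<cdot> w = zero_mor T e ?y" unfolding z by simp
    then show "f \<cdot> w \<in> I" by (simp add: ideal_zero)
  qed
  show "f \<in> torsion" if f: "f \<in> I"
  proof -
    have "f = runit T ?y \<cdot> ((f \<rtimes> (unit_obj T)) \<cdot> inv_mor T (runit T ?x))"
      using comp_tail[OF rn, of "inv_mor T (runit T ?x)"] by simp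
    moreover have "runit T ?y \<cdot> ((f \<rtimes> (unit_obj T)) \<cdot> inv_mor T (runit T ?x)) \<in> torsion"
      by (rule torsion_post[OF torsion_pre[OF ideal_tensor_torsion[OF f unit_in]]]) simp_all
    ultimately show ?thesis by simp
  qed
qed

section \<open>The localizing ideal of torsion objects\<close>

definition torsion_objs :: "'o set" where
  "torsion_objs = {X \<in> obj T. ident T X \<in> torsion}"

lemma torsion_objs_obj: "X \<in> torsion_objs \<Longrightarrow> X \<in> obj T"
  by (simp add: torsion_objs_def)

lemma torsion_if_src: "\<lbrakk>f \<in> arr T; src T f \<in> torsion_objs\<rbrakk> \<Longrightarrow> f \<in> torsion"
  using torsion_post[of "ident T (src T f)" f] by (simp add: torsion_objs_def)

lemma torsion_if_tgt: "\<lbrakk>f \<in> arr T; tgt T f \<in> torsion_objs\<rbrakk> \<Longrightarrow> f \<in> torsion"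
  using torsion_pre[of "ident T (tgt T f)" f] by (simp add: torsion_objs_def)

lemma torsion_objs_iso:
  assumes "X \<in> torsion_objs" "isomorphic_objs T X Y"
  shows "Y \<in> torsion_objs"
proof -
  obtain a where a: "a \<in> isos T X Y" using assms(2) by (auto simp: isomorphic_objs_def)
  note a = isos_arr[OF a]
  have "a \<cdot> inv_mor T a \<in> torsion"
    by (rule torsion_pre[OF torsion_if_src]) (simp_all add: a assms(1))
  moreover have "Y \<in> obj T" using a by auto
  ultimately show ?thesis by (simp add: a torsion_objs_def)
qed

lemma torsion_objs_tensor_compact: "\<lbrakk>X \<in> torsion_objs; x \<in> K\<rbrakk> \<Longrightarrow> X \<boxtimes> x \<in> torsion_objs"
  using torsion_tensor[of "ident T X" x] by (simp add: torsion_objs_def)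

lemma compact_torsion_iff: "x \<in> K \<Longrightarrow> x \<in> torsion_objs \<longleftrightarrow> ident T x \<in> I"
  using torsion_compact_iff[of "ident T x"] by (simp add: torsion_objs_def)

lemma torsion_objs_sh:
  assumes [simp]: "X \<in> torsion_objs"
  shows "sh T X \<in> torsion_objs"
  using torsion_objs_iso[OF torsion_objs_tensor_compact[OF assms compact_suspend[OF K_unit]]]
    isomorphic_sh_unit_tensor[OF torsion_objs_obj[OF assms]] by blast

lemma torsion_objs_desuspend:
  assumes "sh T X \<in> torsion_objs" "X \<in> obj T"
  shows "X \<in> torsion_objs"
proof -
  obtain t b where t: "t \<in> K" "b \<in> isos T (sh T t) (unit_obj T)" using K_desuspend[OF K_unit] .
  show ?thesis
    using torsion_objs_iso[OF torsion_objs_tensor_compact[OF assms(1) t(1)]]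
      isomorphic_desuspended_unit_tensor[OF assms(2) K_obj[OF t(1)] isomorphic_objsI[OF t(2)]]
    by blast
qed

text \<open>In the rotated triangle \<open>Y \<rightarrow> Z \<rightarrow> sh T X\<close> one map is
  torsion by its source and the other by its target, so \<open>torsion_ext\<close> applies to the
  identity of \<open>Z\<close>.\<close>

lemma torsion_objs_cone:
  assumes t: "exact_triangle T X Y Z f g h" and X: "X \<in> torsion_objs" and Y: "Y \<in> torsion_objs"
  shows "Z \<in> torsion_objs"
proof -
  note a = exact_arr[OF t]
  have g: "g \<in> torsion" by (rule torsion_if_src) (simp_all add: a Y)
  have h: "h \<in> torsion" by (rule torsion_if_tgt) (simp_all add: a torsion_objs_sh[OF X])
  have "ident T Z \<in> torsion"
    by (rule torsion_ext[OF rotate[OF t] h, of _ Z]) (simp_all add: a g homset_iff)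
  then show ?thesis by (simp add: torsion_objs_def a)
qed

text \<open>Projections onto finitely many summands are torsion. A test map from a compact object is
  fixed by such a projection, so a test for the identity becomes a test for the projection.\<close>

lemma torsion_objs_coproduct:
  assumes sm: "small_index \<kappa> A" and cop: "is_coproduct T A X S \<iota>" and X: "\<And>i. i \<in> A \<Longrightarrow> X i \<in> torsion_objs"
  shows "S \<in> torsion_objs"
proof -
  note a = coproduct_arr[OF cop] coproj_arr[OF cop]
  note [simp] = a(1)
  let ?e = "coproj A X S \<iota>"
  have fin: "?e F \<in> torsion" if "finite F" "F \<subseteq> A" for F
    using that
  proof (induction F)
    case empty
    show ?case unfolding coproj_empty[OF cop] by (rule torsion_zero) simp_all
  next
    case (insert j F)
    then have j: "j \<in> A" by simp
    obtain p where p: "p \<in> homset T S (X j)" "\<iota> j \<cdot> p = ?e {j}"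
      using coproduct_proj[OF cop j] by metis
    have "\<iota> j \<in> torsion" by (rule torsion_if_src) (simp_all add: a j X)
    then have "?e {j} \<in> torsion"
      unfolding p(2)[symmetric] by (rule torsion_pre) (use p(1) a j in \<open>simp_all add: homset_iff\<close>)
    then show ?case
      unfolding coproj_insert[OF cop insert.hyps(2)] using insert
      by (intro torsion_plus) (simp_all add: a)
  qed
  have "ident T S \<in> torsion"
  proof (rule torsionI[of _ S S])
    show "ident T S \<in> homset T S S" by (simp add: homset_iff)
    fix c d z u v assume c [simp]: "c \<in> K" "d \<in> K" "z \<in> K"
      and u: "u \<in> homset T d (S \<boxtimes> c)" and v: "v \<in> homset T d z"
      and *: "\<And>e w. \<lbrakk>e \<in> K; w \<in> homset T e d;
        (ident T S \<rtimes> c) \<cdot> (u \<cdot> w) = zero_mor T e (S \<boxtimes> c)\<rbrakk> \<Longrightarrow> v \<cdot> w \<in> I"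
    note [simp] = u[unfolded homset_iff] v[unfolded homset_iff]
    obtain F where F: "finite F" "F \<subseteq> A" "(?e F \<rtimes> c) \<cdot> u = u"
      using compact_factors[OF c(2) sm coproduct_tensor[OF cop K_obj[OF c(1)]] u]
      unfolding coproj_tensor[OF cop K_obj[OF c(1)]] by blast
    show "v \<in> I"
    proof (rule torsionD[OF fin[OF F(1,2)] coproj_hom[OF cop] c u v])
      fix e w assume e [simp]: "e \<in> K" and w: "w \<in> homset T e d"
        and z: "(?e F \<rtimes> c) \<cdot> (u \<cdot> w) = zero_mor T e (S \<boxtimes> c)"
      note [simp] = w[unfolded homset_iff]
      have "(?e F \<rtimes> c) \<cdot> (u \<cdot> w) = u \<cdot> w"
        by (rule comp_tail1[OF F(3)]) (simp_all add: a)
      then show "v \<cdot> w \<in> I" using z by (intro *[OF e w]) simp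
    qed
  qed
  then show ?thesis by (simp add: torsion_objs_def)
qed

lemma torsion_objs_localizing: "localizing_subcat \<kappa> T torsion_objs"
  unfolding localizing_subcat_def
proof (intro conjI allI impI)
  show "triangulated_subcat T torsion_objs"
  proof (rule triangulated_subcatI)
    show "torsion_objs \<subseteq> obj T" by (auto simp: torsion_objs_def)
    obtain Z where Z: "zero_object T Z" using zero_object_exists by blast
    then have "Z \<in> obj T" by (simp add: zero_object_def)
    then have "Z \<in> torsion_objs"
      using zero_object_ident[OF Z] torsion_zero[of Z Z] by (simp add: torsion_objs_def)
    then show "torsion_objs \<noteq> {}" by blast
  qed (use torsion_objs_iso isomorphic_objsI torsion_objs_sh torsion_objs_desuspend
      torsion_objs_cone in blast)+
  show "S \<in> torsion_objs"
    if "small_index \<kappa> A \<and> (\<forall>i\<in>A. X i \<in> torsion_objs) \<and> is_coproduct T A X S \<iota>" for A X S \<iota>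
    using that torsion_objs_coproduct[of A X S \<iota>] by blast
qed

text \<open>Localizing induction on \<open>Y\<close>: for compact \<open>Y\<close> the claim is
  \<open>torsion_objs_tensor_compact\<close> up to braiding, and tensoring with \<open>X\<close>
  respects triangles and coproducts.\<close>

lemma torsion_objs_tensor:
  assumes X: "X \<in> torsion_objs" and Y: "Y \<in> obj T"
  shows "Y \<boxtimes> X \<in> torsion_objs"
proof -
  let ?L = "{Y \<in> obj T. Y \<boxtimes> X \<in> torsion_objs}"
  note X' [simp] = torsion_objs_obj[OF X]
  have cpt: "K \<subseteq> ?L"
  proof
    fix y assume y: "y \<in> K"
    then have "y \<boxtimes> X \<in> torsion_objs"
      using torsion_objs_iso[OF torsion_objs_tensor_compact[OF X y] isomorphic_braid] by simp
    with y show "y \<in> ?L" by simp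
  qed
  have "localizing_subcat \<kappa> T ?L"
    unfolding localizing_subcat_def
  proof (intro conjI allI impI)
    show "triangulated_subcat T ?L"
    proof (rule triangulated_subcatI)
      show "?L \<subseteq> obj T" by blast
      show "?L \<noteq> {}" using cpt K_unit by blast
      show "B \<in> ?L" if "A \<in> ?L" "a \<in> isos T A B" for A B a
        using that torsion_objs_iso isomorphic_tensor[OF isomorphic_objsI isomorphic_refl[OF X']]
          isos_arr(3)[OF that(2)] tgt_in[OF isos_arr(1)[OF that(2)]] by blast
      show "sh T A \<in> ?L" if "A \<in> ?L" for A
        using that torsion_objs_iso[OF torsion_objs_sh isomorphic_objs_sym[OF isomorphic_sh_tensor]]
        by simp
      show "A \<in> ?L" if "A \<in> obj T" "sh T A \<in> ?L" for A
        using that torsion_objs_desuspend[of "A \<boxtimes> X"] torsion_objs_iso[OF _ isomorphic_sh_tensor]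
        by simp
      show "C \<in> ?L" if "exact_triangle T A B C f g h" "A \<in> ?L" "B \<in> ?L" for A B C f g h
        using that torsion_objs_cone[OF tensor_exact[OF that(1) X']] exact_arr(12)[OF that(1)] by blast
    qed
    show "S \<in> ?L" if "small_index \<kappa> A \<and> (\<forall>i\<in>A. F i \<in> ?L) \<and> is_coproduct T A F S \<iota>" for A F S \<iota>
      using that torsion_objs_coproduct[OF _ coproduct_tensor[OF _ X']] coproduct_arr(1) by blast
  qed
  then show ?thesis using localizing_induct[OF _ cpt Y] by blast
qed

lemma torsion_objs_ideal: "localizing_ideal \<kappa> T torsion_objs"
  unfolding localizing_ideal_def using torsion_objs_localizing torsion_objs_tensor by blast

text \<open>The kernel of tensoring with \<open>W\<close> modulo torsion. Closure under extensions
  comes from exactness of \<open>- \<otimes> W\<close> and \<open>torsion_ext\<close>; for closure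
  under tensoring the factors \<open>x\<close> and \<open>W\<close> are interchanged by
  \<open>tensor_swap\<close>.\<close>

lemma compact_ideal_quotient:
  assumes [simp]: "W \<in> obj T"
  shows "compact_ideal \<kappa> T {f \<in> arr T. src T f \<in> K \<and> tgt T f \<in> K \<and> f \<rtimes> W \<in> torsion}"
proof (unfold_locales, goal_cases)
  case (1 f)
  then show ?case by simp
next
  case (2 x y)
  then show ?case by (simp add: torsion_zero)
next
  case (3 f g z)
  then have a: "f \<in> arr T" "g \<in> arr T" "src T g = tgt T f" "tgt T g = z" by (auto simp: homset_iff)
  have "(g \<rtimes> W) \<cdot> (f \<rtimes> W) \<in> torsion"
    by (rule torsion_post) (use 3 a in simp_all)
  then show ?case using 3 by (simp add: a interchange)
next
  case (4 f g z)
  then have a: "f \<in> arr T" "g \<in> arr T" "src T g = z" "tgt T g = src T f" by (auto simp: homset_iff)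
  have "(f \<rtimes> W) \<cdot> (g \<rtimes> W) \<in> torsion"
    by (rule torsion_pre) (use 4 a in simp_all)
  then show ?case using 4 by (simp add: a interchange)
next
  case (5 f x)
  then have a [simp]: "f \<in> arr T" "src T f \<in> K" "tgt T f \<in> K" "x \<in> K"
    and t: "f \<rtimes> W \<in> torsion" by auto
  obtain \<theta> \<phi> where \<theta>: "\<theta> \<in> homset T ((src T f \<boxtimes> x) \<boxtimes> W) ((src T f \<boxtimes> W) \<boxtimes> x)"
    and \<phi>: "\<phi> \<in> homset T ((tgt T f \<boxtimes> W) \<boxtimes> x) ((tgt T f \<boxtimes> x) \<boxtimes> W)"
    and eq: "(f \<rtimes> x) \<rtimes> W = \<phi> \<cdot> (((f \<rtimes> W) \<rtimes> x) \<cdot> \<theta>)"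
    by (rule tensor_swap[of f W x]) simp_all
  note [simp] = \<theta>[unfolded homset_iff] \<phi>[unfolded homset_iff]
  have "(f \<rtimes> x) \<rtimes> W \<in> torsion"
    unfolding eq by (rule torsion_post[OF torsion_pre[OF torsion_tensor[OF t]]]) simp_all
  then show ?case by simp
next
  case (6 e d y w u h z v)
  note [simp] = exact_arr[OF 6(1)] 6(7)[unfolded homset_iff]
  have u: "u \<rtimes> W \<in> torsion" and vw: "(v \<cdot> w) \<rtimes> W \<in> torsion" using 6 by auto
  have "v \<rtimes> W \<in> torsion"
  proof (rule torsion_ext[OF tensor_exact[OF 6(1) assms] u])
    show "v \<rtimes> W \<in> homset T (d \<boxtimes> W) (z \<boxtimes> W)" by (simp add: homset_iff)
    show "(v \<rtimes> W) \<cdot> (w \<rtimes> W) \<in> torsion" using vw by (simp add: interchange)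
  qed
  then show ?case using 6 by simp
qed

end

context compact_ideal
begin

text \<open>A map from a compact object into the kernel of \<open>u \<otimes> G\<close> factors, after enlarging \<open>G\<close> to
  compact objects over it, through the kernel of \<open>u\<close> tensored with a compact object.\<close>

lemma tensor_kernel_ideal:
  assumes K [simp]: "d \<in> K" "z \<in> K" "q \<in> K" and [simp]: "W \<in> obj T" "G \<in> obj T"
    and u: "u \<in> homset T d W" and v: "v \<in> homset T d z"
    and H: "\<And>e w. \<lbrakk>e \<in> K; w \<in> homset T e d; u \<cdot> w = zero_mor T e W\<rbrakk> \<Longrightarrow> v \<cdot> w \<in> I"
    and M: "M \<in> homset T q (d \<boxtimes> G)" and uM: "(u \<rtimes> G) \<cdot> M = zero_mor T q (W \<boxtimes> G)"
  obtains \<nu> where "\<nu> \<in> I" "src T \<nu> = q"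
    "\<And>w. \<lbrakk>w \<in> arr T; tgt T w = q; \<nu> \<cdot> w = zero_mor T (src T w) (tgt T \<nu>)\<rbrakk>
      \<Longrightarrow> (v \<rtimes> G) \<cdot> (M \<cdot> w) = zero_mor T (src T w) (z \<boxtimes> G)"
proof -
  note [simp] = u[unfolded homset_iff] v[unfolded homset_iff] M[unfolded homset_iff]
  obtain e t n where e [simp]: "e \<in> K" and t: "t \<in> homset T e G" and n: "n \<in> homset T q (d \<boxtimes> e)"
    and M_eq: "M = (d \<ltimes> t) \<cdot> n"
    by (rule rigid_factor[OF K(1,3) \<open>G \<in> obj T\<close> M])
  note [simp] = t[unfolded homset_iff] n[unfolded homset_iff]
  let ?l = "(u \<rtimes> e) \<cdot> n"
  have l: "?l \<in> homset T q (W \<boxtimes> e)" by (simp add: homset_iff)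
  have "(W \<ltimes> t) \<cdot> ?l = (u \<rtimes> G) \<cdot> M"
    unfolding M_eq by (simp add: interchange_tail)
  then have tl: "(W \<ltimes> t) \<cdot> ?l = zero_mor T q (W \<boxtimes> G)" unfolding uM .
  \<comment> \<open>The fibre of \<open>t\<close> need not be compact, as \<open>G\<close> is
    arbitrary. The lift of \<open>?l\<close> to \<open>W \<boxtimes> F\<close> is therefore
    approximated by a compact object over \<open>F\<close>.\<close>
  obtain F s r where F: "exact_triangle T F e G s t r" using fibre_exists[OF t] .
  note [simp] = exact_arr(1-3,10)[OF F]
  obtain k where k: "k \<in> homset T q (W \<boxtimes> F)" "?l = (W \<ltimes> s) \<cdot> k"
    by (rule tensor_factor_left[OF F \<open>W \<in> obj T\<close> l tl])
  \<comment> \<open>\<open>W\<close> need not be rigid, so \<open>all_approximable\<close> takes the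
    place of duality.\<close>
  obtain e1 t1 k1 where e1 [simp]: "e1 \<in> K" and t1: "t1 \<in> homset T e1 F"
    and k1: "k1 \<in> homset T q (W \<boxtimes> e1)" and k_eq: "k = (W \<ltimes> t1) \<cdot> k1"
    by (rule approximableD[OF all_approximable[OF \<open>W \<in> obj T\<close>] exact_arr(10)[OF F] K(3) k(1)])
  note [simp] = t1[unfolded homset_iff] k1[unfolded homset_iff]
  have st: "s \<cdot> t1 \<in> homset T e1 e" by (simp add: homset_iff)
  \<comment> \<open>Passing to the cone of \<open>s \<cdot> t1\<close> kills the obstruction
    \<open>?l\<close>, while \<open>t\<close> still factors through the cone because
    \<open>t \<cdot> s\<close> is zero.\<close>
  obtain e3 \<rho> h where e3 [simp]: "e3 \<in> K" and C: "exact_triangle T e1 e e3 (s \<cdot> t1) \<rho> h"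
    by (rule K_cone[OF st e1 e])
  note [simp] = exact_arr(4-6)[OF C]
  have \<rho>0: "\<rho> \<cdot> (s \<cdot> t1) = zero_mor T e1 e3" by (rule triangle_comp_zero(1)[OF C])
  have "t \<cdot> (s \<cdot> t1) = zero_mor T F G \<cdot> t1"
    by (rule comp_tail1[OF triangle_comp_zero(1)[OF F]]) simp_all
  then have t0: "t \<cdot> (s \<cdot> t1) = zero_mor T e1 G" by simp
  obtain t' where t': "t' \<in> homset T e3 G" "t = t' \<cdot> \<rho>" by (rule factor_last[OF C t t0])
  note [simp] = t'(1)[unfolded homset_iff]
  let ?n = "(d \<ltimes> \<rho>) \<cdot> n"
  have n': "?n \<in> homset T q (d \<boxtimes> e3)" by (simp add: homset_iff)
  have M': "M = (d \<ltimes> t') \<cdot> ?n" unfolding M_eq t'(2) by (simp add: interchange_tail)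
  have "(u \<rtimes> e3) \<cdot> ?n = (W \<ltimes> \<rho>) \<cdot> ?l" by (simp add: interchange_tail)
  also have "\<dots> = zero_mor T q (W \<boxtimes> e3)"
    unfolding k(2) k_eq by (simp add: interchange_tail \<rho>0)
  finally have un: "(u \<rtimes> e3) \<cdot> ?n = zero_mor T q (W \<boxtimes> e3)" .
  \<comment> \<open>Now \<open>?n\<close> is killed by \<open>u \<rtimes> e3\<close> with
    \<open>e3\<close> rigid, so it comes from a map \<open>t4\<close> killed by \<open>u\<close>, to
    which the hypothesis on \<open>v\<close> applies.\<close>
  obtain e4 t4 n4 where e4 [simp]: "e4 \<in> K" and t4: "t4 \<in> homset T e4 d"
    and n4: "n4 \<in> homset T q (e4 \<boxtimes> e3)" and n_eq: "?n = (t4 \<rtimes> e3) \<cdot> n4"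
    and kill: "\<forall>u Z. u \<in> homset T d Z \<longrightarrow> (u \<rtimes> e3) \<cdot> ?n = zero_mor T q (Z \<boxtimes> e3)
      \<longrightarrow> u \<cdot> t4 = zero_mor T e4 Z"
    by (rule rigid_factor_right[OF e3 K(3) K_obj[OF K(1)] n'])
  note [simp] = t4[unfolded homset_iff] n4[unfolded homset_iff]
  have vt: "v \<cdot> t4 \<in> I" using H[OF e4 t4] kill u un by blast
  let ?\<nu> = "(v \<rtimes> e3) \<cdot> ?n"
  have "?\<nu> = ((v \<cdot> t4) \<rtimes> e3) \<cdot> n4" unfolding n_eq by (simp add: interchange_tail)
  moreover have "((v \<cdot> t4) \<rtimes> e3) \<cdot> n4 \<in> I"
    by (rule ideal_pre[OF ideal_tensor[OF vt e3], of _ q]) (simp_all add: homset_iff)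
  ultimately have \<nu>: "?\<nu> \<in> I" by simp
  show ?thesis
  proof (rule that[OF \<nu>])
    show "src T ?\<nu> = q" by simp
    fix w assume w [simp]: "w \<in> arr T" "tgt T w = q"
      and z: "?\<nu> \<cdot> w = zero_mor T (src T w) (tgt T ?\<nu>)"
    have "(v \<rtimes> G) \<cdot> (M \<cdot> w) = (z \<ltimes> t') \<cdot> (?\<nu> \<cdot> w)"
      unfolding M' by (simp add: interchange_tail)
    then show "(v \<rtimes> G) \<cdot> (M \<cdot> w) = zero_mor T (src T w) (z \<boxtimes> G)"
      unfolding z by simp
  qed
qed

end

section \<open>Primality of the torsion objects of a maximal ideal\<close>

locale maximal_compact_ideal = compact_ideal \<kappa> T I
  for \<kappa> :: "'i rel" and T :: "('o, 'm, 'z) tt_data_scheme" (structure) and I :: "'m set" +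
  fixes p :: "'o set"
  assumes p_compact: "p \<subseteq> compact_objs \<kappa> T" and p_proper: "p \<noteq> compact_objs \<kappa> T"
    and p_prime: "\<lbrakk>x \<in> compact_objs \<kappa> T; y \<in> compact_objs \<kappa> T; x \<boxtimes> y \<in> p\<rbrakk> \<Longrightarrow> x \<in> p \<or> y \<in> p"
    and p_ideal: "x \<in> compact_objs \<kappa> T \<Longrightarrow> ident T x \<in> I \<longleftrightarrow> x \<in> p"
    and maximal: "\<lbrakk>compact_ideal \<kappa> T J; I \<subseteq> J; \<And>x. \<lbrakk>x \<in> compact_objs \<kappa> T; ident T x \<in> J\<rbrakk> \<Longrightarrow> x \<in> p\<rbrakk>
      \<Longrightarrow> J \<subseteq> I"
begin

text \<open>Maximality of \<open>I\<close> applied to the kernel of tensoring with \<open>W\<close>;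
  the assumption on \<open>W\<close> says that this larger ideal contains no identity of an object
  outside \<open>p\<close>.\<close>

lemma quotient_maximal:
  assumes [simp]: "W \<in> obj T" and W: "\<And>x. \<lbrakk>x \<in> K; x \<boxtimes> W \<in> torsion_objs\<rbrakk> \<Longrightarrow> x \<in> p"
    and f: "f \<in> arr T" "src T f \<in> K" "tgt T f \<in> K" "f \<rtimes> W \<in> torsion"
  shows "f \<in> I"
proof -
  let ?J = "{f \<in> arr T. src T f \<in> K \<and> tgt T f \<in> K \<and> f \<rtimes> W \<in> torsion}"
  have "?J \<subseteq> I"
  proof (rule maximal)
    show "compact_ideal \<kappa> T ?J" by (rule compact_ideal_quotient) simp
    show "I \<subseteq> ?J" using ideal_arr ideal_tensor_torsion by auto
    fix x assume x: "x \<in> K" "ident T x \<in> ?J"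
    then have "x \<boxtimes> W \<in> torsion_objs" by (simp add: torsion_objs_def)
    then show "x \<in> p" using W x by blast
  qed
  then show ?thesis using f by blast
qed

text \<open>For \<open>W = x\<close> the assumption of \<open>quotient_maximal\<close> reduces to
  primeness of \<open>p\<close>.\<close>

lemma ideal_tensor_cancel:
  assumes x [simp]: "x \<in> K" "x \<notin> p" and f [simp]: "f \<in> arr T" "src T f \<in> K" "tgt T f \<in> K"
    and "f \<rtimes> x \<in> I"
  shows "f \<in> I"
proof (rule quotient_maximal[OF _ _ f])
  show "f \<rtimes> x \<in> torsion" using assms(6) by (simp add: torsion_compact_iff)
  show "y \<in> p" if y: "y \<in> K" "y \<boxtimes> x \<in> torsion_objs" for y
    using y p_prime[OF y(1) x(1)] x compact_torsion_iff[of "y \<boxtimes> x"] p_ideal[of "y \<boxtimes> x"] by simp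
qed simp

text \<open>A test for \<open>Y\<close>, tensored with \<open>x\<close>, is a test for
  \<open>Y \<boxtimes> x\<close>: by rigidity of \<open>x\<close>, maps killed by
  \<open>u \<rtimes> x\<close> come from maps killed by \<open>u\<close>. This puts
  \<open>v \<rtimes> x\<close> into \<open>I\<close>, and then \<open>x\<close> is
  cancelled.\<close>

lemma torsion_objs_tensor_compact_cancel:
  assumes x [simp]: "x \<in> K" "x \<notin> p" and Y [simp]: "Y \<in> obj T" and t: "Y \<boxtimes> x \<in> torsion_objs"
  shows "Y \<in> torsion_objs"
proof -
  have t': "ident T (Y \<boxtimes> x) \<in> torsion" using t by (simp add: torsion_objs_def)
  have "ident T Y \<in> torsion"
  proof (rule torsionI[of _ Y Y])
    show "ident T Y \<in> homset T Y Y" by (simp add: homset_iff)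
    fix c d z u v assume c [simp]: "c \<in> K" "d \<in> K" "z \<in> K"
      and u: "u \<in> homset T d (Y \<boxtimes> c)" and v: "v \<in> homset T d z"
      and *: "\<And>e w. \<lbrakk>e \<in> K; w \<in> homset T e d;
        (ident T Y \<rtimes> c) \<cdot> (u \<cdot> w) = zero_mor T e (Y \<boxtimes> c)\<rbrakk> \<Longrightarrow> v \<cdot> w \<in> I"
    note [simp] = u[unfolded homset_iff] v[unfolded homset_iff]
    obtain \<theta> where \<theta>: "\<theta> \<in> isos T ((Y \<boxtimes> c) \<boxtimes> x) ((Y \<boxtimes> x) \<boxtimes> c)"
    proof
      show "inv_mor T (assoc T Y x c) \<cdot> ((Y \<ltimes> braid T c x) \<cdot> assoc T Y c x)
          \<in> isos T ((Y \<boxtimes> c) \<boxtimes> x) ((Y \<boxtimes> x) \<boxtimes> c)"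
        by (rule isos_after[OF isos_after[OF assoc_iso tensor_isos[OF isos_ident braid_iso]]
              isos_inv[OF assoc_iso]]) simp_all
    qed
    note [simp] = isos_arr[OF \<theta>]
    let ?u = "\<theta> \<cdot> (u \<rtimes> x)"
    have "v \<rtimes> x \<in> I"
    proof (rule torsionD[OF t', of "Y \<boxtimes> x" "Y \<boxtimes> x" c "d \<boxtimes> x" "z \<boxtimes> x" ?u])
      show "ident T (Y \<boxtimes> x) \<in> homset T (Y \<boxtimes> x) (Y \<boxtimes> x)"
        "?u \<in> homset T (d \<boxtimes> x) ((Y \<boxtimes> x) \<boxtimes> c)" "v \<rtimes> x \<in> homset T (d \<boxtimes> x) (z \<boxtimes> x)"
        by (simp_all add: homset_iff)
      fix e w assume e [simp]: "e \<in> K" and w: "w \<in> homset T e (d \<boxtimes> x)"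
        and z: "(ident T (Y \<boxtimes> x) \<rtimes> c) \<cdot> (?u \<cdot> w) = zero_mor T e ((Y \<boxtimes> x) \<boxtimes> c)"
      note [simp] = w[unfolded homset_iff]
      have 0: "(u \<rtimes> x) \<cdot> w = zero_mor T e ((Y \<boxtimes> c) \<boxtimes> x)"
        by (rule isos_mono[OF \<theta>]) (use z in simp_all)
      obtain e' t n where e' [simp]: "e' \<in> K" and t: "t \<in> homset T e' d" and n: "n \<in> homset T e (e' \<boxtimes> x)"
        and w_eq: "w = (t \<rtimes> x) \<cdot> n"
        and kill: "\<forall>u Z. u \<in> homset T d Z \<longrightarrow> (u \<rtimes> x) \<cdot> w = zero_mor T e (Z \<boxtimes> x)
          \<longrightarrow> u \<cdot> t = zero_mor T e' Z"
        by (rule rigid_factor_right[OF x(1) e K_obj[OF c(2)] w])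
      note [simp] = t[unfolded homset_iff] n[unfolded homset_iff]
      have "u \<cdot> t = zero_mor T e' (Y \<boxtimes> c)" using kill u 0 by blast
      then have vt: "v \<cdot> t \<in> I" by (intro *[OF e' t]) simp
      have "((v \<cdot> t) \<rtimes> x) \<cdot> n \<in> I"
        by (rule ideal_pre[OF ideal_tensor[OF vt x(1)], of _ e]) (simp_all add: homset_iff)
      then show "(v \<rtimes> x) \<cdot> w \<in> I" unfolding w_eq by (simp add: interchange_tail)
    qed simp_all
    then show "v \<in> I" by (rule ideal_tensor_cancel[OF x, rotated -1]) simp_all
  qed
  then show ?thesis by (simp add: torsion_objs_def)
qed

text \<open>Two tests are nested. To see that \<open>v \<rtimes> Y\<close> is torsion, a test
  \<open>(a, b)\<close> for it is turned into a test for \<open>X \<boxtimes> Y\<close>, and the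
  maps killed there are handled by \<open>tensor_kernel_ideal\<close>. If \<open>Y\<close> is not
  torsion, every compact \<open>x\<close> with \<open>x \<boxtimes> Y\<close> torsion lies in
  \<open>p\<close>, so \<open>quotient_maximal\<close> puts \<open>v\<close> into
  \<open>I\<close>.\<close>

lemma torsion_objs_prime:
  assumes X [simp]: "X \<in> obj T" and Y [simp]: "Y \<in> obj T" and XY: "X \<boxtimes> Y \<in> torsion_objs"
  shows "X \<in> torsion_objs \<or> Y \<in> torsion_objs"
proof (rule disjCI)
  assume nY: "Y \<notin> torsion_objs"
  have idX: "ident T X \<in> homset T X X" by (simp add: homset_iff)
  have t': "ident T (X \<boxtimes> Y) \<in> torsion" using XY by (simp add: torsion_objs_def)
  have "ident T X \<in> torsion"
  proof (rule torsionI[OF idX])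
    fix c d z u v assume c [simp]: "c \<in> K" "d \<in> K" "z \<in> K"
      and u: "u \<in> homset T d (X \<boxtimes> c)" and v: "v \<in> homset T d z"
      and *: "\<And>e w. \<lbrakk>e \<in> K; w \<in> homset T e d;
        (ident T X \<rtimes> c) \<cdot> (u \<cdot> w) = zero_mor T e (X \<boxtimes> c)\<rbrakk> \<Longrightarrow> v \<cdot> w \<in> I"
    note [simp] = u[unfolded homset_iff] v[unfolded homset_iff]
    have H: "v \<cdot> w \<in> I" if "e \<in> K" "w \<in> homset T e d" "u \<cdot> w = zero_mor T e (X \<boxtimes> c)" for e w
      using *[OF that(1,2)] that by simp
    have "v \<rtimes> Y \<in> torsion"
    proof (rule torsionI[of _ "d \<boxtimes> Y" "z \<boxtimes> Y"])
      show "v \<rtimes> Y \<in> homset T (d \<boxtimes> Y) (z \<boxtimes> Y)" by (simp add: homset_iff)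
      fix c' q r a b assume c' [simp]: "c' \<in> K" "q \<in> K" "r \<in> K"
        and a: "a \<in> homset T q ((d \<boxtimes> Y) \<boxtimes> c')" and b: "b \<in> homset T q r"
        and **: "\<And>e w. \<lbrakk>e \<in> K; w \<in> homset T e q;
          ((v \<rtimes> Y) \<rtimes> c') \<cdot> (a \<cdot> w) = zero_mor T e ((z \<boxtimes> Y) \<boxtimes> c')\<rbrakk> \<Longrightarrow> b \<cdot> w \<in> I"
      note [simp] = a[unfolded homset_iff] b[unfolded homset_iff]
      \<comment> \<open>\<open>G\<close> absorbs the inner test object \<open>c'\<close>, so that
        \<open>u\<close> and \<open>v\<close> are whiskered by the same object.\<close>
      define G where "G = Y \<boxtimes> c'"
      have G [simp]: "G \<in> obj T" by (simp add: G_def)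
      have nu: "assoc T (X \<boxtimes> c) Y c' \<cdot> ((u \<rtimes> Y) \<rtimes> c')
          = (u \<rtimes> G) \<cdot> assoc T d Y c'"
        using assoc_nat[of u "ident T Y" "ident T c'"] by (simp add: G_def)
      have nv: "assoc T z Y c' \<cdot> ((v \<rtimes> Y) \<rtimes> c')
          = (v \<rtimes> G) \<cdot> assoc T d Y c'"
        using assoc_nat[of v "ident T Y" "ident T c'"] by (simp add: G_def)
      \<comment> \<open>Any isomorphism will do, because composing with it does not change which
        maps are killed.\<close>
      obtain \<theta> where \<theta>: "\<theta> \<in> isos T ((X \<boxtimes> c) \<boxtimes> G) ((X \<boxtimes> Y) \<boxtimes> (c \<boxtimes> c'))"
      proof -
        have "isomorphic_objs T (c \<boxtimes> G) ((c \<boxtimes> Y) \<boxtimes> c')"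
          unfolding G_def by (rule isomorphic_objs_sym[OF isomorphic_objsI[OF assoc_iso]]) simp_all
        also have "isomorphic_objs T ((c \<boxtimes> Y) \<boxtimes> c') ((Y \<boxtimes> c) \<boxtimes> c')"
          by (rule isomorphic_tensor[OF isomorphic_braid isomorphic_refl]) simp_all
        also have "isomorphic_objs T ((Y \<boxtimes> c) \<boxtimes> c') (Y \<boxtimes> (c \<boxtimes> c'))"
          by (rule isomorphic_objsI[OF assoc_iso]) simp_all
        finally have 1: "isomorphic_objs T (c \<boxtimes> G) (Y \<boxtimes> (c \<boxtimes> c'))" .
        have "isomorphic_objs T ((X \<boxtimes> c) \<boxtimes> G) (X \<boxtimes> (c \<boxtimes> G))"
          by (rule isomorphic_objsI[OF assoc_iso]) simp_all
        also have "isomorphic_objs T (X \<boxtimes> (c \<boxtimes> G)) (X \<boxtimes> (Y \<boxtimes> (c \<boxtimes> c')))"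
          by (rule isomorphic_tensor[OF isomorphic_refl 1]) simp
        also have "isomorphic_objs T (X \<boxtimes> (Y \<boxtimes> (c \<boxtimes> c'))) ((X \<boxtimes> Y) \<boxtimes> (c \<boxtimes> c'))"
          by (rule isomorphic_objs_sym[OF isomorphic_objsI[OF assoc_iso]]) simp_all
        finally show ?thesis using that by (auto simp: isomorphic_objs_def)
      qed
      note [simp] = isos_arr[OF \<theta>]
      let ?m = "assoc T d Y c' \<cdot> a"
      have m: "?m \<in> homset T q (d \<boxtimes> G)" by (simp add: homset_iff G_def)
      note [simp] = m[unfolded homset_iff, THEN conjunct1] m[unfolded homset_iff, THEN conjunct2]
      let ?u = "\<theta> \<cdot> ((u \<rtimes> G) \<cdot> ?m)"
      have u': "?u \<in> homset T q ((X \<boxtimes> Y) \<boxtimes> (c \<boxtimes> c'))" by (simp add: homset_iff)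
      show "b \<in> I"
      proof (rule torsionD[OF t' _ _ c'(2,3) u' b])
        show "ident T (X \<boxtimes> Y) \<in> homset T (X \<boxtimes> Y) (X \<boxtimes> Y)" "c \<boxtimes> c' \<in> K" by (simp_all add: homset_iff)
        fix q' w assume q' [simp]: "q' \<in> K" and w: "w \<in> homset T q' q"
          and z: "(ident T (X \<boxtimes> Y) \<rtimes> (c \<boxtimes> c')) \<cdot> (?u \<cdot> w)
            = zero_mor T q' ((X \<boxtimes> Y) \<boxtimes> (c \<boxtimes> c'))"
        note [simp] = w[unfolded homset_iff]
        define M where "M = ?m \<cdot> w"
        have M: "M \<in> homset T q' (d \<boxtimes> G)" unfolding M_def using m w by (rule after_hom[rotated])
        note [simp] = M[unfolded homset_iff]
        have "\<theta> \<cdot> ((u \<rtimes> G) \<cdot> M) = (ident T (X \<boxtimes> Y) \<rtimes> (c \<boxtimes> c')) \<cdot> (?u \<cdot> w)"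
          unfolding M_def by (simp add: G_def)
        then have \<theta>uM: "\<theta> \<cdot> ((u \<rtimes> G) \<cdot> M) = zero_mor T q' ((X \<boxtimes> Y) \<boxtimes> (c \<boxtimes> c'))"
          unfolding z .
        have uM: "(u \<rtimes> G) \<cdot> M = zero_mor T q' ((X \<boxtimes> c) \<boxtimes> G)"
          by (rule isos_mono[OF \<theta>]) (simp_all add: \<theta>uM)
        \<comment> \<open>\<open>M\<close> is killed by \<open>u \<rtimes> G\<close>. This is traded
          for an ideal map \<open>\<nu>\<close> such that whatever \<open>\<nu>\<close> kills is
          also killed by \<open>(v \<rtimes> G) \<cdot> M\<close>, the situation that
          \<open>ideal_ext'\<close> settles.\<close>
        obtain \<nu> where \<nu>: "\<nu> \<in> I" "src T \<nu> = q'"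
          and kill: "\<And>w'. \<lbrakk>w' \<in> arr T; tgt T w' = q'; \<nu> \<cdot> w' = zero_mor T (src T w') (tgt T \<nu>)\<rbrakk>
            \<Longrightarrow> (v \<rtimes> G) \<cdot> (M \<cdot> w') = zero_mor T (src T w') (z \<boxtimes> G)"
          by (rule tensor_kernel_ideal[OF c(2,3) q' _ G u v H M uM]) simp_all
        have bw: "b \<cdot> w \<in> homset T q' r" by (simp add: homset_iff)
        show "b \<cdot> w \<in> I"
        proof (rule ideal_ext'[OF \<nu>(1) _ bw c'(3)])
          show "\<nu> \<in> homset T q' (tgt T \<nu>)" using ideal_arr[OF \<nu>(1)] \<nu>(2) by (simp add: homset_iff)
          fix e w' assume e [simp]: "e \<in> K" and w': "w' \<in> homset T e q'"
            and \<nu>w: "\<nu> \<cdot> w' = zero_mor T e (tgt T \<nu>)"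
          note [simp] = w'[unfolded homset_iff]
          have "assoc T z Y c' \<cdot> (((v \<rtimes> Y) \<rtimes> c') \<cdot> (a \<cdot> (w \<cdot> w')))
              = (v \<rtimes> G) \<cdot> (assoc T d Y c' \<cdot> (a \<cdot> (w \<cdot> w')))"
            by (rule comp_tail[OF nv]) (simp_all add: G_def)
          also have "\<dots> = (v \<rtimes> G) \<cdot> (M \<cdot> w')" by (simp add: M_def)
          also have "\<dots> = zero_mor T e (z \<boxtimes> G)" using kill[of w'] \<nu>w by simp
          finally have 0: "assoc T z Y c' \<cdot> (((v \<rtimes> Y) \<rtimes> c') \<cdot> (a \<cdot> (w \<cdot> w')))
              = zero_mor T e (z \<boxtimes> G)" .
          have "((v \<rtimes> Y) \<rtimes> c') \<cdot> (a \<cdot> (w \<cdot> w')) = zero_mor T e ((z \<boxtimes> Y) \<boxtimes> c')"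
            by (rule isos_mono[OF assoc_iso[of z Y c']]) (simp_all add: 0, simp_all add: G_def)
          then have "b \<cdot> (w \<cdot> w') \<in> I" by (intro **) (simp_all add: homset_iff)
          then show "(b \<cdot> w) \<cdot> w' \<in> I" by simp
        qed
      qed
    qed
    then show "v \<in> I"
    proof (intro quotient_maximal[OF Y])
      fix x assume x: "x \<in> K" "x \<boxtimes> Y \<in> torsion_objs"
      then have "Y \<boxtimes> x \<in> torsion_objs" using torsion_objs_iso isomorphic_braid by simp
      then show "x \<in> p" using torsion_objs_tensor_compact_cancel[OF x(1) _ Y] nY by blast
    qed simp_all
  qed
  then show "X \<in> torsion_objs" by (simp add: torsion_objs_def)
qed

end

section \<open>Maps factoring through a prime\<close>

locale big_tt_prime = big_tt_category \<kappa> T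
  for \<kappa> :: "'i rel" and T :: "('o, 'm, 'z) tt_data_scheme" (structure) +
  fixes p :: "'o set"
  assumes p_Spc: "p \<in> Spc (compact_part \<kappa> T)"
begin

section \<open>The prime as a thick subcategory of the compact objects\<close>

lemma compact_part_simps [simp]:
  "obj (compact_part \<kappa> T) = K" "src (compact_part \<kappa> T) = src T" "tgt (compact_part \<kappa> T) = tgt T"
  "ident (compact_part \<kappa> T) = ident T" "after (compact_part \<kappa> T) = after T"
  "plus_mor (compact_part \<kappa> T) = plus_mor T" "zero_mor (compact_part \<kappa> T) = zero_mor T"
  "sh (compact_part \<kappa> T) = sh T" "shm (compact_part \<kappa> T) = shm T"
  "tensor (compact_part \<kappa> T) = tensor T"
  by (simp_all add: compact_part_def full_subcat_def)

lemma homset_compact_part: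
  "homset (compact_part \<kappa> T) x y = (if x \<in> K \<and> y \<in> K then homset T x y else {})"
  by (auto simp: homset_def compact_part_def full_subcat_def)

lemma exact_compact_part:
  assumes "exact_triangle T x y z f g h" "x \<in> K" "y \<in> K" "z \<in> K"
  shows "exact_triangle (compact_part \<kappa> T) x y z f g h"
proof -
  have "sh T x \<in> K" using assms(2) by (rule compact_suspend)
  moreover have "(f, g, h) \<in> dist (compact_part \<kappa> T)"
    using assms exact_arr[OF assms(1)]
    by (simp add: compact_part_def full_subcat_def exact_triangle_def)
  ultimately show ?thesis
    using assms by (simp add: exact_triangle_def candidate_triangle_def homset_compact_part)
qed

lemma isomorphic_compact_part:
  assumes "isomorphic_objs T x y" "x \<in> K" "y \<in> K"
  shows "isomorphic_objs (compact_part \<kappa> T) x y"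
proof -
  obtain f where f: "f \<in> isos T x y" using assms(1) by (auto simp: isomorphic_objs_def)
  note a = isos_arr[OF f]
  have fh: "f \<in> homset (compact_part \<kappa> T) x y"
    using assms a by (simp add: homset_compact_part homset_iff)
  then have fa: "f \<in> arr (compact_part \<kappa> T)" by (simp add: homset_def)
  have "inverse_mors (compact_part \<kappa> T) f (inv_mor T f)"
    using a assms(2,3) unfolding inverse_mors_def
    by (simp add: homset_compact_part homset_iff fa)
  then show ?thesis using fh by (auto simp: isomorphic_objs_def isos_def iso_mor_def)
qed

lemma p_subcat: "triangulated_subcat (compact_part \<kappa> T) p"
  and p_thick: "is_biproduct (compact_part \<kappa> T) x y z \<Longrightarrow> z \<in> p \<Longrightarrow> x \<in> p"
  and p_tensor: "a \<in> K \<Longrightarrow> x \<in> p \<Longrightarrow> a \<boxtimes> x \<in> p"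
  and p_neq: "p \<noteq> K"
  and p_prime: "a \<in> K \<Longrightarrow> b \<in> K \<Longrightarrow> a \<boxtimes> b \<in> p \<Longrightarrow> a \<in> p \<or> b \<in> p"
  using p_Spc unfolding Spc_def thick_tensor_ideal_def compact_part_simps by blast+

lemma p_subcatD:
  shows "p \<subseteq> K" "p \<noteq> {}"
    "\<And>x y. x \<in> p \<Longrightarrow> y \<in> K \<Longrightarrow> isomorphic_objs (compact_part \<kappa> T) x y \<Longrightarrow> y \<in> p"
    "\<And>x. x \<in> K \<Longrightarrow> sh T x \<in> p \<longleftrightarrow> x \<in> p"
    "\<And>x y z f g h. exact_triangle (compact_part \<kappa> T) x y z f g h \<Longrightarrow> x \<in> p \<Longrightarrow> y \<in> p \<Longrightarrow> z \<in> p"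
  using p_subcat unfolding triangulated_subcat_def compact_part_simps by blast+

lemma p_K [simp]: "x \<in> p \<Longrightarrow> x \<in> K"
  using p_subcatD(1) by blast

lemmas p_nonempty = p_subcatD(2)
lemmas p_sh = p_subcatD(4)

lemma p_iso: "\<lbrakk>x \<in> p; y \<in> K; isomorphic_objs T x y\<rbrakk> \<Longrightarrow> y \<in> p"
  using p_subcatD(3) isomorphic_compact_part p_K by blast

lemma p_cone: "\<lbrakk>exact_triangle T x y z f g h; x \<in> p; y \<in> p\<rbrakk> \<Longrightarrow> z \<in> p"
  using p_subcatD(5) exact_compact_part compact_cone p_K by metis

text \<open>Two rotations exhibit \<open>sh T y\<close> as the cone of a map from \<open>z\<close>
  to \<open>sh T x\<close>.\<close>

lemma p_middle:
  assumes "exact_triangle T x y z f g h" "x \<in> p" "z \<in> p" "y \<in> K"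
  shows "y \<in> p"
  using p_cone[OF rotate[OF rotate[OF assms(1)]] assms(3)] assms p_sh by simp

text \<open>These are the maps that become zero in the Verdier quotient of the compact objects by
  \<open>p\<close>.\<close>

definition p_maps :: "'m set" where
  "p_maps = {f \<in> arr T. src T f \<in> K \<and> tgt T f \<in> K \<and>
    (\<exists>a r s. a \<in> p \<and> r \<in> homset T (src T f) a \<and> s \<in> homset T a (tgt T f) \<and> f = s \<cdot> r)}"

lemma p_mapsI:
  assumes "a \<in> p" "r \<in> homset T x a" "s \<in> homset T a y" "x \<in> K" "y \<in> K"
  shows "s \<cdot> r \<in> p_maps"
  using assms unfolding p_maps_def by (auto simp: homset_iff)

lemma p_mapsE:
  assumes "f \<in> p_maps"
  obtains a r s where "a \<in> p" "r \<in> homset T (src T f) a" "s \<in> homset T a (tgt T f)" "f = s \<cdot> r"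
    "f \<in> arr T" "src T f \<in> K" "tgt T f \<in> K"
  using assms unfolding p_maps_def by blast

lemma p_maps_factor:
  assumes "f \<in> p_maps" "f \<in> homset T x y"
  obtains a r s where "a \<in> p" "r \<in> homset T x a" "s \<in> homset T a y" "f = s \<cdot> r"
proof -
  have f: "src T f = x" "tgt T f = y" using assms(2) by (simp_all add: homset_iff)
  show ?thesis using p_mapsE[OF assms(1)] that unfolding f by blast
qed

lemma p_maps_ideal: "compact_ideal \<kappa> T p_maps"
proof (unfold_locales, goal_cases)
  case (1 f)
  then show ?case by (simp add: p_maps_def)
next
  case (2 x y)
  obtain a where a: "a \<in> p" using p_nonempty by blast
  have "zero_mor T a y \<cdot> zero_mor T x a \<in> p_maps"
    by (rule p_mapsI[OF a, of _ x _ y]) (use 2 a in \<open>simp_all add: homset_iff\<close>)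
  then show ?case using 2 a by simp
next
  case (3 f g z)
  obtain a r s where f: "a \<in> p" "r \<in> homset T (src T f) a" "s \<in> homset T a (tgt T f)" "f = s \<cdot> r"
    "f \<in> arr T" "src T f \<in> K" "tgt T f \<in> K" using p_mapsE[OF 3(1)] .
  have "(g \<cdot> s) \<cdot> r \<in> p_maps"
    by (rule p_mapsI[OF f(1,2) after_hom[OF f(3) 3(2)] f(6) 3(3)])
  also have "(g \<cdot> s) \<cdot> r = g \<cdot> f"
    unfolding f(4) by (rule after_assoc[OF f(2,3) 3(2)])
  finally show ?case .
next
  case (4 f g z)
  obtain a r s where f: "a \<in> p" "r \<in> homset T (src T f) a" "s \<in> homset T a (tgt T f)" "f = s \<cdot> r"
    "f \<in> arr T" "src T f \<in> K" "tgt T f \<in> K" using p_mapsE[OF 4(1)] .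
  have "s \<cdot> (r \<cdot> g) \<in> p_maps"
    by (rule p_mapsI[OF f(1) after_hom[OF 4(2) f(2)] f(3) 4(3) f(7)])
  also have "s \<cdot> (r \<cdot> g) = (s \<cdot> r) \<cdot> g" by (rule after_assoc[OF 4(2) f(2,3), symmetric])
  also have "s \<cdot> r = f" using f(4) ..
  finally show ?case .
next
  case (5 f x)
  obtain a r s where f: "a \<in> p" "r \<in> homset T (src T f) a" "s \<in> homset T a (tgt T f)" "f = s \<cdot> r"
    "f \<in> arr T" "src T f \<in> K" "tgt T f \<in> K" using p_mapsE[OF 5(1)] .
  have x: "ident T x \<in> homset T x x" using 5(2) by (simp add: homset_iff)
  have "a \<boxtimes> x \<in> p"
    by (rule p_iso[OF p_tensor[OF 5(2) f(1)] _ isomorphic_braid]) (use f(1) 5(2) in simp_all)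
  then have "(s \<rtimes> x) \<cdot> (r \<rtimes> x) \<in> p_maps"
    by (rule p_mapsI[OF _ tensorm_hom[OF f(2) x] tensorm_hom[OF f(3) x]]) (use f 5(2) in simp_all)
  also have "(s \<rtimes> x) \<cdot> (r \<rtimes> x) = f \<rtimes> x"
    using tensorm_after[OF f(2,3) x x] f(4) 5(2) by simp
  finally show ?case .
next
  \<comment> \<open>Closure under extensions: \<open>v\<close> is restricted along two successive
    fibres until it vanishes, so it factors through the cone \<open>c'\<close> of the composite,
    which is built from \<open>b\<close> and \<open>c\<close>.\<close>
  case (6 e d y w u h z v)
  note t = 6(1) and K = 6(2-5) and v = 6(7)
  note a [simp] = exact_arr(1-6,10-12)[OF t] v[unfolded homset_iff]
  obtain b r s where b: "b \<in> p" and r: "r \<in> homset T d b" and s: "s \<in> homset T b y" and u: "u = s \<cdot> r"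
    by (rule p_maps_factor[OF 6(6)]) (simp add: homset_iff)
  obtain c r' s' where c: "c \<in> p" and r': "r' \<in> homset T e c" and s': "s' \<in> homset T c z"
    and vw: "v \<cdot> w = s' \<cdot> r'"
    by (rule p_maps_factor[OF 6(8)]) (simp add: homset_iff)
  note [simp] = r[unfolded homset_iff] s[unfolded homset_iff] r'[unfolded homset_iff] s'[unfolded homset_iff]
  note [simp] = K_obj[OF p_K[OF b]] K_obj[OF p_K[OF c]] K_obj[OF K(4)]
  obtain d1 k h1 where d1: "d1 \<in> K" and t1: "exact_triangle T d1 d b k r h1"
    using K_fibre[OF r K(2) p_K[OF b]] .
  note [simp] = exact_arr(1-3,10)[OF t1]
  have "u \<cdot> k = zero_mor T d1 y" unfolding u by (simp add: triangle_comp_zero[OF t1])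
  then obtain l where l: "l \<in> homset T d1 e" "k = w \<cdot> l"
    using factor_first[OF t, of k d1] by (auto simp: homset_iff)
  note [simp] = l(1)[unfolded homset_iff]
  have rl: "r' \<cdot> l \<in> homset T d1 c" by (simp add: homset_iff)
  obtain d2 m h2 where d2: "d2 \<in> K" and t2: "exact_triangle T d2 d1 c m (r' \<cdot> l) h2"
    using K_fibre[OF rl d1 p_K[OF c]] .
  note [simp] = exact_arr(1-3,10)[OF t2]
  have km: "k \<cdot> m \<in> homset T d2 d" by (simp add: homset_iff)
  obtain c' g' h' where c': "c' \<in> K" and t3: "exact_triangle T d2 d c' (k \<cdot> m) g' h'"
    using K_cone[OF km d2 K(2)] .
  \<comment> \<open>The octahedron makes \<open>c'\<close> an extension of \<open>b\<close> by
    \<open>c\<close>, so it lies in \<open>p\<close>.\<close>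
  have "\<exists>f g h. exact_triangle T c c' b f g h" using octahedral[OF t2 t1 t3] by blast
  then have "c' \<in> p" using p_middle c b c' by blast
  have "v \<cdot> (k \<cdot> m) = (v \<cdot> w) \<cdot> (l \<cdot> m)" unfolding l(2) by simp
  also have "\<dots> = s' \<cdot> ((r' \<cdot> l) \<cdot> m)" unfolding vw by simp
  also have "\<dots> = zero_mor T d2 z" unfolding triangle_comp_zero(1)[OF t2] by simp
  finally have "v \<cdot> (k \<cdot> m) = zero_mor T d2 z" .
  then obtain v' where v': "v' \<in> homset T c' z" "v = v' \<cdot> g'" using factor_last[OF t3 v] by blast
  have "g' \<in> homset T d c'" using exact_arr[OF t3] by (simp add: homset_iff)
  then show ?case unfolding v'(2) by (rule p_mapsI[OF \<open>c' \<in> p\<close> _ v'(1) K(2,4)])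
qed

text \<open>An identity that factors through \<open>a \<in> p\<close> makes \<open>x\<close> a
  retract of \<open>a\<close>. Thickness is formulated through biproducts, so a complement has to be
  constructed: the cone \<open>c\<close> of the section \<open>r\<close>.\<close>

lemma ident_p_maps_iff:
  assumes x: "x \<in> K"
  shows "ident T x \<in> p_maps \<longleftrightarrow> x \<in> p"
proof
  assume "x \<in> p"
  moreover have "ident T x \<in> homset T x x" using x by (simp add: homset_iff)
  ultimately show "ident T x \<in> p_maps" using p_mapsI[of x "ident T x" x "ident T x" x] x by simp
next
  assume "ident T x \<in> p_maps"
  then obtain a r s where a: "a \<in> p" and "r \<in> homset T x a" "s \<in> homset T a x"
    and id: "ident T x = s \<cdot> r"
    by (rule p_maps_factor) (use x in \<open>simp add: homset_iff\<close>)
  then have [simp]: "r \<in> arr T" "src T r = x" "tgt T r = a" "s \<in> arr T" "src T s = a" "tgt T s = x"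
    by (simp_all add: homset_iff)
  note [simp] = x p_K[OF a] id[symmetric]
  have r: "r \<in> homset T x a" by (simp add: homset_iff)
  obtain c g h where c: "c \<in> K" and t: "exact_triangle T x a c r g h" using K_cone[OF r x p_K[OF a]] .
  note [simp] = c exact_arr(4-9)[OF t] triangle_comp_zero[OF t]
  \<comment> \<open>As \<open>r\<close> is a split monomorphism, the connecting map \<open>h\<close>
    will turn out to be zero.\<close>
  have "shm T r \<cdot> h = zero_mor T c (sh T a)"
    using triangle_comp_zero(2)[OF rotate[OF t]] neg_after(1)[of h "shm T r"]
      neg_neg[of "shm T r \<cdot> h"] by simp
  then have "shm T s \<cdot> (shm T r \<cdot> h) = zero_mor T c (sh T x)" by simp
  moreover have "shm T s \<cdot> shm T r = ident T (sh T x)" using shm_after_arr[of r s] by simp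
  ultimately have h: "h = zero_mor T c (sh T x)"
    using comp_tail1[of "shm T s" "shm T r" "ident T (sh T x)" h] by simp
  \<comment> \<open>With \<open>h\<close> zero, \<open>g\<close> is an epimorphism, so equations
    between maps out of \<open>c\<close> may be checked after precomposition with
    \<open>g\<close>.\<close>
  have epi: "n = zero_mor T c y" if n: "n \<in> homset T c y" "n \<cdot> g = zero_mor T a y" for n y
  proof -
    obtain n' where n': "n' \<in> homset T (sh T x) y" "n = n' \<cdot> h"
      using factor_last[OF rotate[OF t] n] by blast
    then show ?thesis using h homset_objs[OF n'(1)] by (simp add: homset_iff)
  qed
  \<comment> \<open>The idempotent complementary to \<open>r \<cdot> s\<close>. It kills
    \<open>r\<close>, and its factorization through \<open>g\<close> gives the second inclusion
    \<open>j\<close>.\<close>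
  let ?k = "ident T a \<boxplus> neg_mor T (r \<cdot> s)"
  have k: "?k \<in> homset T a a" by (simp add: homset_iff)
  have "?k \<cdot> r = (ident T a \<cdot> r) \<boxplus> (neg_mor T (r \<cdot> s) \<cdot> r)" by (rule plus_after_arr) simp_all
  also have "neg_mor T (r \<cdot> s) \<cdot> r = neg_mor T r" by (subst neg_after) simp_all
  finally have "?k \<cdot> r = zero_mor T x a" by simp
  then obtain j where j: "j \<in> homset T c a" and kj: "?k = j \<cdot> g" using factor_last[OF t k] by blast
  note [simp] = j[unfolded homset_iff]
  have gr: "g \<cdot> (r \<cdot> s) = zero_mor T a c" by (subst comp_tail1[OF triangle_comp_zero(1)[OF t]]) simp_all
  have "g \<cdot> ?k = (g \<cdot> ident T a) \<boxplus> (g \<cdot> neg_mor T (r \<cdot> s))" by (rule after_plus_arr) simp_all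
  also have "g \<cdot> neg_mor T (r \<cdot> s) = zero_mor T a c" by (subst neg_after) (simp_all add: gr)
  finally have gk: "g \<cdot> ?k = g" by simp
  have "s \<cdot> ?k = (s \<cdot> ident T a) \<boxplus> (s \<cdot> neg_mor T (r \<cdot> s))" by (rule after_plus_arr) simp_all
  also have "s \<cdot> neg_mor T (r \<cdot> s) = neg_mor T (s \<cdot> (r \<cdot> s))" by (subst neg_after) simp_all
  also have "s \<cdot> (r \<cdot> s) = s" by (subst comp_tail1[OF id[symmetric]]) simp_all
  finally have sk: "s \<cdot> ?k = zero_mor T a x" by simp
  have sj: "s \<cdot> j = zero_mor T c x"
    by (rule epi) (use sk kj in \<open>simp_all add: homset_iff\<close>)
  have "((g \<cdot> j) \<boxplus> neg_mor T (ident T c)) \<cdot> g = ((g \<cdot> j) \<cdot> g) \<boxplus> (neg_mor T (ident T c) \<cdot> g)"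
    by (rule plus_after_arr) simp_all
  also have "(g \<cdot> j) \<cdot> g = g" using gk kj by simp
  also have "neg_mor T (ident T c) \<cdot> g = neg_mor T g" by (subst neg_after) simp_all
  finally have "((g \<cdot> j) \<boxplus> neg_mor T (ident T c)) \<cdot> g = zero_mor T a c" by simp
  then have "(g \<cdot> j) \<boxplus> neg_mor T (ident T c) = zero_mor T c c"
    by (intro epi) (simp_all add: homset_iff)
  then have gj: "g \<cdot> j = ident T c"
    by (rule eq_if_diff_zero[rotated 2]) (simp_all add: homset_iff)
  have sum: "(r \<cdot> s) \<boxplus> (j \<cdot> g) = ident T a"
    unfolding kj[symmetric]
    using diff_plus[of "ident T a" a a "r \<cdot> s"] plus_comm[of ?k a a "r \<cdot> s"]
    by (simp add: homset_iff)
  have "is_biproduct (compact_part \<kappa> T) x c a"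
    unfolding is_biproduct_def
    by (intro conjI bexI[of _ r] bexI[of _ j] bexI[of _ s] bexI[of _ g])
      (simp_all add: homset_compact_part homset_iff sj gj sum)
  then show "x \<in> p" using p_thick a by blast
qed

section \<open>Existence of a maximal ideal over the prime\<close>

lemma compact_ideal_Union:
  assumes "C \<noteq> {}" "\<And>J. J \<in> C \<Longrightarrow> compact_ideal \<kappa> T J" "\<And>J J'. J \<in> C \<Longrightarrow> J' \<in> C \<Longrightarrow> J \<subseteq> J' \<or> J' \<subseteq> J"
  shows "compact_ideal \<kappa> T (\<Union>C)"
proof (unfold_locales, goal_cases)
  case (1 f)
  then show ?case using compact_ideal.ideal_arr[OF assms(2)] by blast
next
  case (2 x y)
  then show ?case using compact_ideal.ideal_zero[OF assms(2)] assms(1) by blast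
next
  case (3 f g z)
  then show ?case using compact_ideal.ideal_post[OF assms(2)] by blast
next
  case (4 f g z)
  then show ?case using compact_ideal.ideal_pre[OF assms(2)] by blast
next
  case (5 f x)
  then show ?case using compact_ideal.ideal_tensor[OF assms(2)] by blast
next
  \<comment> \<open>This axiom has two membership hypotheses; the chain condition places both in one
    member.\<close>
  case (6 e d y w u h z v)
  obtain J where J: "J \<in> C" "u \<in> J" "v \<cdot> w \<in> J" using 6(6,8) assms(3) by blast
  then have "v \<in> J" using compact_ideal.ideal_ext[OF assms(2)[OF J(1)] 6(1-5) J(2) 6(7) J(3)] by blast
  then show ?case using J(1) by blast
qed

lemma maximal_compact_ideal_exists: "\<exists>M. maximal_compact_ideal \<kappa> T M p"
proof -
  \<comment> \<open>Containing \<open>p_maps\<close> guarantees the identities of the objects of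
    \<open>p\<close>, and the last condition excludes all others.\<close>
  let ?A = "{J. compact_ideal \<kappa> T J \<and> p_maps \<subseteq> J \<and> (\<forall>x\<in>K. ident T x \<in> J \<longrightarrow> x \<in> p)}"
  have "\<exists>M\<in>?A. \<forall>J\<in>?A. M \<subseteq> J \<longrightarrow> J = M"
  proof (rule subset_Zorn_nonempty)
    show "?A \<noteq> {}" using p_maps_ideal ident_p_maps_iff by blast
    fix C assume C: "C \<noteq> {}" "subset.chain ?A C"
    then have sub: "C \<subseteq> ?A" and tot: "\<And>J J'. J \<in> C \<Longrightarrow> J' \<in> C \<Longrightarrow> J \<subseteq> J' \<or> J' \<subseteq> J"
      unfolding subset.chain_def by blast+
    have "compact_ideal \<kappa> T (\<Union>C)" using compact_ideal_Union[OF C(1) _ tot] sub by blast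
    then show "\<Union>C \<in> ?A" using sub C(1) by blast
  qed
  then obtain M where MA: "M \<in> ?A" and max: "\<forall>J\<in>?A. M \<subseteq> J \<longrightarrow> J = M" by (rule bexE)
  then have M: "compact_ideal \<kappa> T M" "p_maps \<subseteq> M" "\<forall>x\<in>K. ident T x \<in> M \<longrightarrow> x \<in> p" by blast+
  interpret M: compact_ideal \<kappa> T M by (rule M(1))
  have "maximal_compact_ideal \<kappa> T M p"
  proof
    show "p \<subseteq> K" by auto
    show "p \<noteq> K" by (rule p_neq)
    show "x \<in> p \<or> y \<in> p" if "x \<in> K" "y \<in> K" "x \<boxtimes> y \<in> p" for x y using p_prime that .
    show "ident T x \<in> M \<longleftrightarrow> x \<in> p" if "x \<in> K" for x
      using that M(2,3) ident_p_maps_iff[OF that] by blast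
    show "J \<subseteq> M" if "compact_ideal \<kappa> T J" "M \<subseteq> J" "\<And>x. \<lbrakk>x \<in> K; ident T x \<in> J\<rbrakk> \<Longrightarrow> x \<in> p" for J
    proof -
      have "J \<in> ?A" using that M(2) by blast
      then show ?thesis using max that(2) by blast
    qed
  qed
  then show ?thesis by blast
qed

end

section \<open>The torsion objects form a big prime\<close>

context maximal_compact_ideal
begin

lemma tensor_power_obj: "X \<in> obj T \<Longrightarrow> tensor_power T X (Suc n) \<in> obj T"
  by (induction n) simp_all

lemma torsion_objs_radical:
  assumes "X \<in> obj T" "tensor_power T X (Suc n) \<in> torsion_objs"
  shows "X \<in> torsion_objs"
  using assms(2)
proof (induction n)
  case (Suc n)
  then show ?case using torsion_objs_prime[OF assms(1) tensor_power_obj[OF assms(1), of n]] by auto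
qed simp

text \<open>If neither of two ideals consists of torsion objects, nontorsion objects chosen from
  each have a tensor product that lies in both ideals and, by \<open>torsion_objs_prime\<close>, is
  not torsion.\<close>

lemma torsion_objs_big_prime: "big_prime \<kappa> T torsion_objs"
  unfolding big_prime_def
proof (intro conjI allI impI)
  show "radical_localizing_ideal \<kappa> T torsion_objs"
    unfolding radical_localizing_ideal_def
  proof (intro conjI ballI allI impI)
    fix X n assume "X \<in> obj T" "n \<ge> (1::nat)" "tensor_power T X n \<in> torsion_objs"
    \<comment> \<open>As \<open>n\<close> is at least 1, it is a successor, the case covered by
      \<open>torsion_objs_radical\<close>; the zeroth power would be the unit.\<close>
    then show "X \<in> torsion_objs" using torsion_objs_radical[of X "n - 1"] by simp
  qed (rule torsion_objs_ideal)
  obtain x where "x \<in> K" "x \<notin> p" using p_compact p_proper by blast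
  then show "torsion_objs \<noteq> obj T" using compact_torsion_iff p_ideal K_obj by blast
  fix I J assume *: "radical_localizing_ideal \<kappa> T I \<and> radical_localizing_ideal \<kappa> T J \<and> I \<inter> J \<subseteq> torsion_objs"
  then have I: "localizing_ideal \<kappa> T I" and J: "localizing_ideal \<kappa> T J"
    by (auto simp: radical_localizing_ideal_def)
  have sub: "I \<subseteq> obj T" "J \<subseteq> obj T"
    using I J by (auto simp: localizing_ideal_def localizing_subcat_def triangulated_subcat_def)
  show "I \<subseteq> torsion_objs \<or> J \<subseteq> torsion_objs"
  proof (rule ccontr)
    assume "\<not> (I \<subseteq> torsion_objs \<or> J \<subseteq> torsion_objs)"
    then obtain X Y where X: "X \<in> I" "X \<notin> torsion_objs" and Y: "Y \<in> J" "Y \<notin> torsion_objs" by blast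
    have o: "X \<in> obj T" "Y \<in> obj T" using X Y sub by auto
    \<comment> \<open>Ideals are closed under tensoring on the left, so membership in the first
      ideal is obtained for \<open>Y \<boxtimes> X\<close> and carried over by the braiding.\<close>
    have "X \<boxtimes> Y \<in> J" using J Y(1) o(1) by (simp add: localizing_ideal_def)
    moreover have "Y \<boxtimes> X \<in> I" using I X(1) o(2) by (simp add: localizing_ideal_def)
    moreover have "B \<in> I" if "A \<in> I" "B \<in> obj T" "isomorphic_objs T A B" for A B
      using I that unfolding localizing_ideal_def localizing_subcat_def triangulated_subcat_def by blast
    ultimately have "X \<boxtimes> Y \<in> I \<and> X \<boxtimes> Y \<in> J" using isomorphic_braid[OF o(2,1)] o by simp
    then have "X \<boxtimes> Y \<in> torsion_objs" using * by blast
    then show False using torsion_objs_prime[OF o] X Y by blast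
  qed
qed

end

theorem theoremB:
  fixes \<kappa> :: "'i rel" and T :: "('o, 'm, 'z) tt_data_scheme" and p :: "'o set"
  assumes "big_tt_category \<kappa> T"
    and "p \<in> Spc (compact_part \<kappa> T)"
  shows "\<exists>P. big_prime \<kappa> T P \<and> P \<inter> obj (compact_part \<kappa> T) = p"
proof -
  interpret big_tt_prime \<kappa> T p using assms by (intro big_tt_prime.intro big_tt_prime_axioms.intro)
  obtain M where "maximal_compact_ideal \<kappa> T M p" using maximal_compact_ideal_exists by blast
  then interpret M: maximal_compact_ideal \<kappa> T M p .
  \<comment> \<open>A compact object is torsion exactly if its identity lies in \<open>M\<close>,
    and the identities in \<open>M\<close> are those of objects of \<open>p\<close>.\<close>
  have "M.torsion_objs \<inter> K = p" using M.compact_torsion_iff M.p_ideal by auto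
  then show ?thesis using M.torsion_objs_big_prime by auto
qed

end
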